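(* Let $\pi : E \to B$ be a metric fibration, and let $F=\pi^{-1}(b)$ (for some $b\in B$) be its fiber. For every real $\ell>0$ there is a chain homotopy equivalence \[ \mathsf{MC}^{\ell}_\ast(E) \simeq \bigoplus_{\ell_v + \ell_h = \ell} \mathsf{MC}^{\ell_v}_\ast(F)\otimes \mathsf{MC}^{\ell_h}_\ast(B), \] where $\mathsf{MC}$ denotes the magnitude chain complex and the direct sum is over all pairs of reals $\ell_v,\ell_h\ge 0$ with $\ell_v+\ell_h=\ell$.
   Context: Metric fibration: a Lipschitz map $\pi:E\to B$ of metric spaces such that for all $x\in E$ and $b\in B$ there is a unique point $x^b\in\pi^{-1}(b)$ satisfying (1) $d(x,x^b)=d(\pi x,b)$ and (2) $d(x,y)=d(x,x^b)+d(x^b,y)$ for all $y\in\pi^{-1}(b)$. The fiber of $\pi$ is $\pi^{-1}(b)$ with the restricted metric, for a point $b\in B$ (all fibers are isometric). For a metric space $(X,d)$ and $x,y,z\in X$ write $x\prec y\prec z$ if $d(x,z)=d(x,y)+d(y,z)$. For $\ell\in\mathbb{R}_{\ge0}$, $n\in\mathbb{Z}_{\ge0}$ let $P^\ell_n(X)=\{(x_0,\dots,x_n)\in X^{n+1}\mid x_i\ne x_{i+1},\ \sum_{i=0}^{n-1}d(x_i,x_{i+1})=\ell\}$. The magnitude chain complex $\mathsf{MC}^\ell_\ast(X)$ has $\mathsf{MC}^\ell_n(X)=\mathbb{Z}P^\ell_n(X)$ (free abelian group) and boundary $\partial_n(x_0,\dots,x_n)=\sum (-1)^i(x_0,\dots,\hat{x}_i,\dots,x_n)$,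 the sum being over those $1\le i\le n-1$ with $x_{i-1}\prec x_i\prec x_{i+1}$. Tensor products are tensor products of chain complexes over $\mathbb{Z}$. *)

theory Defs
  imports "HOL-Analysis.Abstract_Metric_Spaces" "HOL-Algebra.Free_Abelian_Groups"
begin

section \<open>Metric fibrations\<close>

definition metric_fiber :: "'a metric \<Rightarrow> ('a \<Rightarrow> 'b) \<Rightarrow> 'b \<Rightarrow> 'a metric" where
  "metric_fiber E p b = submetric E {x \<in> mspace E. p x = b}"

definition metric_fibration :: "'a metric \<Rightarrow> 'b metric \<Rightarrow> ('a \<Rightarrow> 'b) \<Rightarrow> bool" where
  "metric_fibration E B p \<longleftrightarrow>
     Lipschitz_continuous_map E B p \<and>
     (\<forall>x \<in> mspace E. \<forall>b \<in> mspace B. \<exists>!x'.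
        x' \<in> mspace (metric_fiber E p b) \<and>
        mdist E x x' = mdist B (p x) b \<and>
        (\<forall>y \<in> mspace (metric_fiber E p b). mdist E x y = mdist E x x' + mdist E x' y))"


section \<open>Chain complexes of abelian groups\<close>

text \<open>
  Complexes are concentrated in non-negative degrees. The differential \<open>dif C n\<close> goes from
  degree \<open>n\<close> to degree \<open>n - 1\<close> and is meaningful for \<open>n \<ge> 1\<close> only; \<open>dif C 0\<close> is a junk value.
  Groups are written multiplicatively, as always in HOL-Algebra.
\<close>

record 'a chain_cplx =
  grp :: "nat \<Rightarrow> 'a monoid"
  dif :: "nat \<Rightarrow> 'a \<Rightarrow> 'a"

definition chain_complex :: "'a chain_cplx \<Rightarrow> bool" where
  "chain_complex C \<longleftrightarrow>
     (\<forall>n. comm_group (grp C n)) \<and>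
     (\<forall>n. dif C (Suc n) \<in> hom (grp C (Suc n)) (grp C n)) \<and>
     (\<forall>n. \<forall>x \<in> carrier (grp C (Suc (Suc n))).
        dif C (Suc n) (dif C (Suc (Suc n)) x) = \<one>\<^bsub>grp C n\<^esub>)"

definition chain_map :: "'a chain_cplx \<Rightarrow> 'b chain_cplx \<Rightarrow> (nat \<Rightarrow> 'a \<Rightarrow> 'b) \<Rightarrow> bool" where
  "chain_map C D f \<longleftrightarrow>
     (\<forall>n. f n \<in> hom (grp C n) (grp D n)) \<and>
     (\<forall>n. \<forall>x \<in> carrier (grp C (Suc n)). f n (dif C (Suc n) x) = dif D (Suc n) (f (Suc n) x))"

text \<open>
  In additive notation: \<open>f - g = d h + h d\<close>, where the second summand is absent in degree \<open>0\<close>.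
\<close>

definition chain_homotopic ::
  "'a chain_cplx \<Rightarrow> 'b chain_cplx \<Rightarrow> (nat \<Rightarrow> 'a \<Rightarrow> 'b) \<Rightarrow> (nat \<Rightarrow> 'a \<Rightarrow> 'b) \<Rightarrow> bool" where
  "chain_homotopic C D f g \<longleftrightarrow>
     (\<exists>h. (\<forall>n. h n \<in> hom (grp C n) (grp D (Suc n))) \<and>
          (\<forall>x \<in> carrier (grp C 0).
             f 0 x \<otimes>\<^bsub>grp D 0\<^esub> inv\<^bsub>grp D 0\<^esub> (g 0 x) = dif D (Suc 0) (h 0 x)) \<and>
          (\<forall>n. \<forall>x \<in> carrier (grp C (Suc n)).
             f (Suc n) x \<otimes>\<^bsub>grp D (Suc n)\<^esub> inv\<^bsub>grp D (Suc n)\<^esub> (g (Suc n) x)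
             = dif D (Suc (Suc n)) (h (Suc n) x) \<otimes>\<^bsub>grp D (Suc n)\<^esub> h n (dif C (Suc n) x)))"

definition chain_homotopy_equivalent :: "'a chain_cplx \<Rightarrow> 'b chain_cplx \<Rightarrow> bool" where
  "chain_homotopy_equivalent C D \<longleftrightarrow>
     chain_complex C \<and> chain_complex D \<and>
     (\<exists>f g. chain_map C D f \<and> chain_map D C g \<and>
        chain_homotopic C C (\<lambda>n x. g n (f n x)) (\<lambda>n x. x) \<and>
        chain_homotopic D D (\<lambda>n y. f n (g n y)) (\<lambda>n y. y))"

definition sum_complex :: "'i set \<Rightarrow> ('i \<Rightarrow> 'a chain_cplx) \<Rightarrow> ('i \<Rightarrow> 'a) chain_cplx" where
  "sum_complex I C =
     \<lparr>grp = (\<lambda>n. sum_group I (\<lambda>i. grp (C i) n)),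
      dif = (\<lambda>n x. \<lambda>i\<in>I. dif (C i) n (x i))\<rparr>"


section \<open>Tensor products over the integers\<close>

text \<open>
  The tensor product of abelian groups \<open>G\<close> and \<open>H\<close> is the free abelian group on
  \<open>carrier G \<times> carrier H\<close> modulo the bilinearity relations.
\<close>

definition tensor_rel ::
  "('a, 'c) monoid_scheme \<Rightarrow> ('b, 'd) monoid_scheme \<Rightarrow> ('a \<times> 'b \<Rightarrow>\<^sub>0 int) set" where
  "tensor_rel G H = generate (free_Abelian_group (carrier G \<times> carrier H))
     ({frag_of (x \<otimes>\<^bsub>G\<^esub> x', y) - frag_of (x, y) - frag_of (x', y) | x x' y.
         x \<in> carrier G \<and> x' \<in> carrier G \<and> y \<in> carrier H} \<union>
      {frag_of (x, y \<otimes>\<^bsub>H\<^esub> y') - frag_of (x, y) - frag_of (x, y') | x y y'.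
         x \<in> carrier G \<and> y \<in> carrier H \<and> y' \<in> carrier H})"

definition tensor_group ::
  "('a, 'c) monoid_scheme \<Rightarrow> ('b, 'd) monoid_scheme \<Rightarrow> ('a \<times> 'b \<Rightarrow>\<^sub>0 int) set monoid" where
  "tensor_group G H = free_Abelian_group (carrier G \<times> carrier H) Mod tensor_rel G H"

text \<open>
  The map \<open>f \<otimes> g\<close> into \<open>tensor_group G' H'\<close>, computed on representatives of cosets
  (only the target groups are needed for this).
\<close>

definition tensor_map ::
  "('c, 'e) monoid_scheme \<Rightarrow> ('d, 'f) monoid_scheme \<Rightarrow> ('a \<Rightarrow> 'c) \<Rightarrow> ('b \<Rightarrow> 'd) \<Rightarrow>
   ('a \<times> 'b \<Rightarrow>\<^sub>0 int) set \<Rightarrow> ('c \<times> 'd \<Rightarrow>\<^sub>0 int) set" where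
  "tensor_map G' H' f g X = the_elem
     ((\<lambda>c. tensor_rel G' H' #>\<^bsub>free_Abelian_group (carrier G' \<times> carrier H')\<^esub>
           frag_extend (\<lambda>(x, y). frag_of (f x, g y)) c) ` X)"

text \<open>
  In degree \<open>n\<close> the tensor product of complexes is the direct sum of \<open>C\<^sub>i \<otimes> D\<^sub>j\<close> over
  \<open>i + j = n\<close>, with \<open>d (x \<otimes> y) = d x \<otimes> y + (-1)\<^sup>i x \<otimes> d y\<close> for \<open>x\<close> of degree \<open>i\<close>.
  The differential is given by its components: the \<open>(i, j)\<close> component of \<open>d z\<close> receives
  contributions from the components of \<open>z\<close> in bidegrees \<open>(i + 1, j)\<close> and \<open>(i, j + 1)\<close>.
\<close>

definition tensor_complex ::
  "'a chain_cplx \<Rightarrow> 'b chain_cplx \<Rightarrow> (nat \<times> nat \<Rightarrow> ('a \<times> 'b \<Rightarrow>\<^sub>0 int) set) chain_cplx" where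
  "tensor_complex C D =
     \<lparr>grp = (\<lambda>n. sum_group {(i, j). i + j = n} (\<lambda>(i, j). tensor_group (grp C i) (grp D j))),
      dif = (\<lambda>n z. \<lambda>(i, j) \<in> {(i, j). i + j = n - 1}.
        tensor_map (grp C i) (grp D j) (dif C (Suc i)) (\<lambda>y. y) (z (Suc i, j))
        \<otimes>\<^bsub>tensor_group (grp C i) (grp D j)\<^esub>
        (tensor_map (grp C i) (grp D j) (\<lambda>x. x) (dif D (Suc j)) (z (i, Suc j))
          [^]\<^bsub>tensor_group (grp C i) (grp D j)\<^esub> ((-1) ^ i :: int)))\<rparr>"


section \<open>The magnitude chain complex\<close>

text \<open>A tuple \<open>(x\<^sub>0, \<dots>, x\<^sub>n)\<close> is a list of length \<open>n + 1\<close>.\<close>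

definition magnitude_tuples :: "'a metric \<Rightarrow> real \<Rightarrow> nat \<Rightarrow> 'a list set" where
  "magnitude_tuples X l n =
     {xs. length xs = Suc n \<and> set xs \<subseteq> mspace X \<and>
          (\<forall>i<n. xs ! i \<noteq> xs ! Suc i) \<and>
          (\<Sum>i<n. mdist X (xs ! i) (xs ! Suc i)) = l}"

definition metric_between :: "'a metric \<Rightarrow> 'a \<Rightarrow> 'a \<Rightarrow> 'a \<Rightarrow> bool" where
  "metric_between X x y z \<longleftrightarrow> mdist X x z = mdist X x y + mdist X y z"

definition magnitude_boundary ::
  "'a metric \<Rightarrow> nat \<Rightarrow> ('a list \<Rightarrow>\<^sub>0 int) \<Rightarrow> ('a list \<Rightarrow>\<^sub>0 int)" where
  "magnitude_boundary X n = frag_extend (\<lambda>xs.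
     \<Sum>i \<in> {i. 1 \<le> i \<and> i < n \<and> metric_between X (xs ! (i - 1)) (xs ! i) (xs ! (i + 1))}.
       frag_cmul ((-1) ^ i) (frag_of (take i xs @ drop (Suc i) xs)))"

definition magnitude_complex :: "'a metric \<Rightarrow> real \<Rightarrow> ('a list \<Rightarrow>\<^sub>0 int) chain_cplx" where
  "magnitude_complex X l =
     \<lparr>grp = (\<lambda>n. free_Abelian_group (magnitude_tuples X l n)),
      dif = magnitude_boundary X\<rparr>"

end

theory Submission
  imports Defs
begin

text \<open>
  Write \<open>x\<^sup>c\<close> for the point of the fibre over \<open>c\<close> singled out by the definition of a metric
  fibration.  A step from \<open>x\<close> to \<open>y\<close> in the total space is \<^emph>\<open>vertical\<close> if \<open>x\<close> and \<open>y\<close> lie in the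
  same fibre, \<^emph>\<open>horizontal\<close> if \<open>y = x\<^sup>c\<close> for some other base point \<open>c\<close>, and \<^emph>\<open>tilted\<close> otherwise.  A
  tilted step from \<open>x\<close> to \<open>y\<close> over \<open>c\<close> always factors as the horizontal step to \<open>x\<^sup>c\<close> followed
  by a vertical step, without any change of length.  Hence a tuple that contains a tilted step
  can be paired with the tuple that contains the horizontal-vertical corner instead.  Pairing
  every tuple at the first place where a tilted step or such a corner occurs leaves exactly the
  tuples that run vertically first and horizontally afterwards.  Such a tuple is a tuple in a
  fibre followed by the horizontal lift of a tuple in the base, and the fibre can be moved to
  the fixed one by the isometry \<open>x \<mapsto> x\<^sup>b\<close>.

  The transports \<open>x \<mapsto> x\<^sup>c\<close> do not compose in general, so two horizontal steps may merge
  into a tilted one and there is no direct Eilenberg-Zilber map.  What saves the argument is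
  that transports do compose along geodesics of the base (\<open>tr_tr_between\<close>).  It follows that a
  vertical step can only be subdivided into vertical steps, and a horizontal one only into
  horizontal steps over a geodesic.  So the unpaired tuples span a quotient complex of
  \<open>MC(E)\<close>, in which every face with a tilted step vanishes; there the corner between the
  vertical and the horizontal part contributes nothing and the boundary is that of the tensor
  product (\<open>face_sum_emb\<close>).

  The paired tuples span a contractible subcomplex, because the pairing is acyclic: merging two
  steps strictly lowers, in the lexicographic order, the triple consisting of the number of base
  movements, the number of fibre movements and the number of pairs in which a fibre movement
  precedes a base movement, the only exception being the merging of a horizontal-vertical corner (\<open>face_decreases\<close>).  Algebraic discrete Morse
  theory (\<open>chain_homotopy_equivalent_critical\<close>) then makes the projection to the quotient
  complex a chain homotopy equivalence.

  It remains to identify the quotient complex, which is free on pairs of a fibre tuple and a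
  base tuple, with the sum of tensor products.  Tensor products of free abelian groups are
  free on pairs of basis elements (\<open>tensor_iso_iso\<close>), the lengths and degrees of its two
  entries determine the summand to which a pair belongs, and chain homotopy equivalences can be
  transported along isomorphisms (\<open>chain_homotopy_equivalent_iso\<close>).
\<close>

section \<open>Acyclic matchings on based complexes\<close>

lemmas frag_extend_linear =
  frag_extend_add frag_extend_diff frag_extend_minus frag_extend_cmul

lemma keys_add_subset: "Poly_Mapping.keys a \<subseteq> S \<Longrightarrow> Poly_Mapping.keys b \<subseteq> S \<Longrightarrow> Poly_Mapping.keys (a + b) \<subseteq> S"
  by (meson Un_least keys_add order_trans)

lemma keys_diff_subset: "Poly_Mapping.keys a \<subseteq> S \<Longrightarrow> Poly_Mapping.keys b \<subseteq> S \<Longrightarrow> Poly_Mapping.keys (a - b) \<subseteq> S"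
  by (meson Un_least keys_diff order_trans)

lemma keys_cmul_subset: "Poly_Mapping.keys a \<subseteq> S \<Longrightarrow> Poly_Mapping.keys (frag_cmul k a) \<subseteq> S"
  by auto

lemma frag_cmul_diff: "frag_cmul k (a - b) = frag_cmul k a - frag_cmul k b"
  by (rule poly_mapping_eqI) (simp add: lookup_minus right_diff_distrib)

lemma keys_sum_subset:
  "(\<And>i. i \<in> I \<Longrightarrow> Poly_Mapping.keys (f i) \<subseteq> S) \<Longrightarrow> Poly_Mapping.keys (sum f I) \<subseteq> S"
  by (rule order_trans[OF keys_sum]) blast

lemma keys_frag_extend_subset:
  assumes "Poly_Mapping.keys c \<subseteq> A" "\<And>x. x \<in> A \<Longrightarrow> Poly_Mapping.keys (f x) \<subseteq> S"
  shows "Poly_Mapping.keys (frag_extend f c) \<subseteq> S"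
  using keys_frag_extend[of f c] assms by fast

text \<open>Identities between composites of linear extensions are checked with this lemma on basis
  elements only.\<close>

lemma frag_additive_eq:
  fixes F G :: "('a \<Rightarrow>\<^sub>0 int) \<Rightarrow> 'b::ab_group_add"
  assumes "Poly_Mapping.keys c \<subseteq> S"
    and "\<And>x. x \<in> S \<Longrightarrow> F (frag_of x) = G (frag_of x)"
    and "\<And>a b. F (a - b) = F a - F b" "\<And>a b. G (a - b) = G a - G b"
  shows "F c = G c"
  using assms(1)
proof (induction c rule: frag_induction)
  case zero
  have "F 0 = 0" "G 0 = 0"
    using assms(3,4)[of 0 0] by simp_all
  then show ?case by simp
qed (simp_all add: assms)

definition frag_restrict :: "'a set \<Rightarrow> ('a \<Rightarrow>\<^sub>0 int) \<Rightarrow> ('a \<Rightarrow>\<^sub>0 int)" where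
  "frag_restrict A = frag_extend (\<lambda>x. if x \<in> A then frag_of x else 0)"

lemma keys_frag_restrict: "Poly_Mapping.keys (frag_restrict A c) \<subseteq> A \<inter> Poly_Mapping.keys c"
  unfolding frag_restrict_def
  by (rule order_trans[OF keys_frag_extend]) (auto split: if_splits)

text \<open>
  This is the algebraic form of discrete Morse theory.  The chain groups have the bases \<open>X n\<close>,
  and \<open>emb\<close> embeds the basis \<open>Q n\<close> of the complex of critical cells into \<open>X n\<close>.  The other
  basis elements are matched in pairs: a lower cell \<open>x\<close> occurs with coefficient \<open>sg x\<close> in the
  boundary of the upper cell \<open>up x\<close> of the next degree.  Acyclicity is the last assumption: apart
  from \<open>x\<close> itself, the boundary of \<open>up x\<close> involves only upper cells and cells that are smaller
  than \<open>x\<close> in a well-founded relation.  By \<open>bd_noncrit\<close> the noncritical cells span a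
  subcomplex, so the critical cells carry the quotient complex, whose boundary is \<open>bdq\<close>.

  The boundaries do not depend on the degree here, which is recorded by the basis elements.
  They vanish in degree 0, so that no separate treatment of this degree is necessary.
\<close>

locale acyclic_matching =
  fixes X :: "nat \<Rightarrow> 'a set" and bd :: "'a \<Rightarrow> ('a \<Rightarrow>\<^sub>0 int)"
    and Q :: "nat \<Rightarrow> 'q set" and bdq :: "'q \<Rightarrow> ('q \<Rightarrow>\<^sub>0 int)"
    and emb :: "'q \<Rightarrow> 'a"
    and L U :: "'a set" and up :: "'a \<Rightarrow> 'a" and sg :: "'a \<Rightarrow> int"
    and r :: "('a \<times> 'a) set"
  fixes noncrit :: "nat \<Rightarrow> 'a set"
  defines "noncrit n \<equiv> X n - emb ` Q n"
  assumes bd_0: "x \<in> X 0 \<Longrightarrow> bd x = 0"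
    and keys_bd: "x \<in> X (Suc n) \<Longrightarrow> Poly_Mapping.keys (bd x) \<subseteq> X n"
    and bd_bd: "x \<in> X n \<Longrightarrow> frag_extend bd (bd x) = 0"
    and bdq_0: "q \<in> Q 0 \<Longrightarrow> bdq q = 0"
    and keys_bdq: "q \<in> Q (Suc n) \<Longrightarrow> Poly_Mapping.keys (bdq q) \<subseteq> Q n"
    and emb_in: "q \<in> Q n \<Longrightarrow> emb q \<in> X n"
    and inj_emb: "inj_on emb (Q n)"
    and bd_noncrit: "x \<in> noncrit (Suc n) \<Longrightarrow> Poly_Mapping.keys (bd x) \<inter> emb ` Q n = {}"
    and bd_emb: "q \<in> Q (Suc n) \<Longrightarrow>
          frag_restrict (emb ` Q n) (bd (emb q)) = frag_extend (\<lambda>q. frag_of (emb q)) (bdq q)"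
    and wf_r: "wf r"
    and lower_or_upper: "x \<in> noncrit n \<Longrightarrow> x \<in> L \<or> x \<in> U"
    and disjoint: "L \<inter> U = {}"
    and up_upper: "x \<in> L \<Longrightarrow> x \<in> noncrit n \<Longrightarrow> up x \<in> U \<inter> noncrit (Suc n)"
    and upper_up: "u \<in> U \<Longrightarrow> u \<in> noncrit n \<Longrightarrow> \<exists>m x. n = Suc m \<and> x \<in> L \<inter> noncrit m \<and> u = up x"
    and sg: "sg x * sg x = 1"
    and bd_up: "x \<in> L \<Longrightarrow> x \<in> noncrit n \<Longrightarrow>
          Poly_Mapping.keys (bd (up x) - frag_cmul (sg x) (frag_of x)) \<subseteq> U \<union> {y. (y, x) \<in> r}"
begin

abbreviation D where "D \<equiv> frag_extend bd"
abbreviation Dq where "Dq \<equiv> frag_extend bdq"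
abbreviation S where "S \<equiv> frag_extend (\<lambda>q. frag_of (emb q))"

text \<open>The projection to the quotient complex; its kernel is spanned by the noncritical cells.\<close>

definition proj :: "nat \<Rightarrow> ('a \<Rightarrow>\<^sub>0 int) \<Rightarrow> ('q \<Rightarrow>\<^sub>0 int)" where
  "proj n = frag_extend (\<lambda>x. if x \<in> emb ` Q n then frag_of (inv_into (Q n) emb x) else 0)"

lemma proj_diff: "proj n (a - b) = proj n a - proj n b"
  by (simp add: proj_def frag_extend_linear)

lemma keys_proj: "Poly_Mapping.keys (proj n c) \<subseteq> Q n"
  unfolding proj_def by (rule keys_frag_extend_subset[of _ UNIV]) (auto intro: inv_into_into)

lemma proj_emb: "q \<in> Q n \<Longrightarrow> proj n (frag_of (emb q)) = frag_of q"
  using inj_emb by (simp add: proj_def)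

lemma proj_S: "Poly_Mapping.keys c \<subseteq> Q n \<Longrightarrow> proj n (S c) = c"
  by (rule frag_additive_eq[of _ "Q n" "\<lambda>c. proj n (S c)"])
     (auto simp: proj_emb proj_diff frag_extend_linear)

lemma proj_noncrit: "Poly_Mapping.keys c \<subseteq> noncrit n \<Longrightarrow> proj n c = 0"
  unfolding proj_def noncrit_def by (rule frag_extend_eq_0) auto

lemma keys_S: "Poly_Mapping.keys c \<subseteq> Q n \<Longrightarrow> Poly_Mapping.keys (S c) \<subseteq> X n"
  by (rule keys_frag_extend_subset) (auto intro: emb_in)

lemma keys_diff_S_proj:
  "Poly_Mapping.keys c \<subseteq> X n \<Longrightarrow> Poly_Mapping.keys (c - S (proj n c)) \<subseteq> noncrit n"
proof (induction c rule: frag_induction)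
  case (one x)
  show ?case
  proof (cases "x \<in> emb ` Q n")
    case True
    then show ?thesis by (auto simp: proj_emb)
  next
    case False
    then show ?thesis using one by (auto simp: proj_def noncrit_def)
  qed
next
  case (diff a b)
  have "a - b - S (proj n (a - b)) = (a - S (proj n a)) - (b - S (proj n b))"
    by (simp add: proj_diff frag_extend_linear)
  then show ?case using diff by (simp only: keys_diff_subset)
qed (auto simp: proj_def)

lemma kernel_proj:
  assumes "Poly_Mapping.keys c \<subseteq> X n" "proj n c = 0"
  shows "Poly_Mapping.keys c \<subseteq> noncrit n"
  using keys_diff_S_proj[OF assms(1)] assms(2) by simp

lemma keys_D: "Poly_Mapping.keys c \<subseteq> X (Suc n) \<Longrightarrow> Poly_Mapping.keys (D c) \<subseteq> X n"
  by (rule keys_frag_extend_subset) (auto dest: keys_bd)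

lemma keys_Dq: "Poly_Mapping.keys c \<subseteq> Q (Suc n) \<Longrightarrow> Poly_Mapping.keys (Dq c) \<subseteq> Q n"
  by (rule keys_frag_extend_subset) (auto dest: keys_bdq)

lemma D_0: "Poly_Mapping.keys c \<subseteq> X 0 \<Longrightarrow> D c = 0"
  using bd_0 by (intro frag_extend_eq_0) auto

lemma Dq_0: "Poly_Mapping.keys c \<subseteq> Q 0 \<Longrightarrow> Dq c = 0"
  using bdq_0 by (intro frag_extend_eq_0) auto

lemma DD: "Poly_Mapping.keys c \<subseteq> X n \<Longrightarrow> D (D c) = 0"
  by (rule frag_additive_eq[of _ "X n" "\<lambda>c. D (D c)" "\<lambda>c. 0"])
     (auto simp: bd_bd frag_extend_linear)

lemma proj_restrict: "proj n c = proj n (frag_restrict (emb ` Q n) c)"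
  by (rule frag_additive_eq[of _ UNIV "\<lambda>c. proj n c" "\<lambda>c. proj n (frag_restrict (emb ` Q n) c)"])
     (auto simp: frag_restrict_def proj_diff frag_extend_linear, auto simp: proj_def)

lemma proj_D:
  "Poly_Mapping.keys c \<subseteq> X (Suc n) \<Longrightarrow> proj n (D c) = Dq (proj (Suc n) c)"
proof (rule frag_additive_eq[of _ "X (Suc n)" "\<lambda>c. proj n (D c)" "\<lambda>c. Dq (proj (Suc n) c)"])
  fix x assume x: "x \<in> X (Suc n)"
  show "proj n (D (frag_of x)) = Dq (proj (Suc n) (frag_of x))"
  proof (cases "x \<in> emb ` Q (Suc n)")
    case True
    then obtain q where q: "q \<in> Q (Suc n)" "x = emb q" by auto
    have "proj n (bd (emb q)) = bdq q"
      by (subst proj_restrict) (simp add: bd_emb[OF q(1)] proj_S keys_bdq[OF q(1)])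
    with q show ?thesis by (simp add: proj_emb)
  next
    case False
    then have "Poly_Mapping.keys (bd x) \<subseteq> noncrit n"
      using x bd_noncrit[of x n] keys_bd[of x n] by (auto simp: noncrit_def)
    then show ?thesis using False by (simp add: proj_noncrit) (simp add: proj_def)
  qed
qed (auto simp: proj_diff frag_extend_linear)

lemma keys_D_noncrit:
  assumes "Poly_Mapping.keys c \<subseteq> noncrit (Suc n)" shows "Poly_Mapping.keys (D c) \<subseteq> noncrit n"
proof (rule kernel_proj)
  have c: "Poly_Mapping.keys c \<subseteq> X (Suc n)" using assms by (auto simp: noncrit_def)
  show "Poly_Mapping.keys (D c) \<subseteq> X n" using c by (rule keys_D)
  show "proj n (D c) = 0" using proj_D[OF c] proj_noncrit[OF assms] by simp
qed

text \<open>The remainder \<open>rest x\<close> is what prevents \<open>sg x \<cdot> up x\<close> from having boundary \<open>x\<close>.\<close>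

definition rest :: "'a \<Rightarrow> ('a \<Rightarrow>\<^sub>0 int)" where
  "rest x = frag_cmul (sg x) (bd (up x)) - frag_of x"

text \<open>The contraction \<open>H\<close> of the noncritical subcomplex vanishes on upper cells, and its value
  \<open>hb x\<close> on a lower cell is forced by \<open>H (bd (up x)) = up x\<close>: this says
  \<open>hb x = sg x \<cdot> up x - H (rest x)\<close>, a recursion along \<open>r\<close> because only lower cells
  contribute to \<open>H (rest x)\<close> and these are smaller than \<open>x\<close>.  The membership in \<open>r\<close> is
  repeated in the body to make the recursion unfold.\<close>

definition hb :: "'a \<Rightarrow> ('a \<Rightarrow>\<^sub>0 int)" where
  "hb = wfrec r (\<lambda>h x. frag_cmul (sg x) (frag_of (up x))
      - frag_extend (\<lambda>y. if y \<in> L \<and> (y, x) \<in> r then h y else 0) (rest x))"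

definition H :: "('a \<Rightarrow>\<^sub>0 int) \<Rightarrow> ('a \<Rightarrow>\<^sub>0 int)" where
  "H = frag_extend (\<lambda>y. if y \<in> L then hb y else 0)"

lemma H_linear: "H (a + b) = H a + H b" "H (a - b) = H a - H b" "H (- a) = - H a"
    "H (frag_cmul k a) = frag_cmul k (H a)" "H 0 = 0"
  by (simp_all add: H_def frag_extend_linear)

lemma keys_rest:
  assumes "x \<in> L" "x \<in> noncrit n"
  shows "Poly_Mapping.keys (rest x) \<subseteq> (U \<union> {y. (y, x) \<in> r}) \<inter> noncrit n"
proof -
  have "rest x = frag_cmul (sg x) (bd (up x) - frag_cmul (sg x) (frag_of x))"
    by (simp add: rest_def frag_cmul_diff sg)
  then have "Poly_Mapping.keys (rest x) \<subseteq> U \<union> {y. (y, x) \<in> r}"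
    using keys_cmul_subset[OF bd_up[OF assms]] by simp
  moreover have "Poly_Mapping.keys (bd (up x)) \<subseteq> noncrit n"
    using keys_D_noncrit[of "frag_of (up x)" n] up_upper[OF assms] by simp
  then have "Poly_Mapping.keys (rest x) \<subseteq> noncrit n"
    unfolding rest_def using assms(2) by (intro keys_diff_subset keys_cmul_subset) auto
  ultimately show ?thesis by blast
qed

lemma hb_eq:
  assumes "x \<in> L" "x \<in> noncrit n"
  shows "hb x = frag_cmul (sg x) (frag_of (up x)) - H (rest x)"
proof -
  have "hb x = frag_cmul (sg x) (frag_of (up x))
      - frag_extend (\<lambda>y. if y \<in> L \<and> (y, x) \<in> r then hb y else 0) (rest x)"
    unfolding hb_def
    by (subst wfrec[OF wf_r]) (auto simp: cut_apply intro!: frag_extend_eq)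
  also have "frag_extend (\<lambda>y. if y \<in> L \<and> (y, x) \<in> r then hb y else 0) (rest x) = H (rest x)"
    unfolding H_def using keys_rest[OF assms] disjoint by (intro frag_extend_eq) auto
  finally show ?thesis .
qed

lemma keys_hb: "x \<in> L \<Longrightarrow> x \<in> noncrit n \<Longrightarrow> Poly_Mapping.keys (hb x) \<subseteq> noncrit (Suc n)"
proof (induction x rule: wf_induct_rule[OF wf_r])
  case (1 x)
  have "Poly_Mapping.keys (H (rest x)) \<subseteq> noncrit (Suc n)"
    unfolding H_def using keys_rest[OF 1(2,3)] 1(1) disjoint
    by (intro keys_frag_extend_subset[of _ "(U \<union> {y. (y, x) \<in> r}) \<inter> noncrit n"]) auto
  then show ?case
    using up_upper[OF 1(2,3)] unfolding hb_eq[OF 1(2,3)]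
    by (intro keys_diff_subset keys_cmul_subset) auto
qed

lemma keys_H: "Poly_Mapping.keys c \<subseteq> noncrit n \<Longrightarrow> Poly_Mapping.keys (H c) \<subseteq> noncrit (Suc n)"
  unfolding H_def by (rule keys_frag_extend_subset) (auto dest: keys_hb)

lemma H_D_upper:
  assumes "u \<in> U" "u \<in> noncrit n" shows "H (bd u) = frag_of u"
proof -
  obtain m x where x: "n = Suc m" "x \<in> L" "x \<in> noncrit m" "u = up x"
    using upper_up[OF assms] by auto
  have "bd u = frag_cmul (sg x) (frag_of x + rest x)"
    by (simp only: rest_def x add_diff_cancel_left' add.commute[of "frag_of x"] diff_add_cancel frag_cmul_cmul sg frag_cmul_one)
  then have "H (bd u) = frag_cmul (sg x) (hb x + H (rest x))"
    using x by (simp add: H_linear) (simp add: H_def)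
  then show ?thesis using x by (simp add: hb_eq sg)
qed

text \<open>By induction \<open>H\<close> contracts all cells of \<open>rest x\<close>: the upper ones by the previous lemma, the
  lower ones because they are smaller.  As \<open>D (rest x) = - D x\<close>, this computes \<open>D (H (rest x))\<close>
  and with it \<open>D (hb x)\<close>.\<close>

lemma contraction_lower:
  "x \<in> L \<Longrightarrow> x \<in> noncrit n \<Longrightarrow> D (hb x) + H (bd x) = frag_of x"
proof (induction x rule: wf_induct_rule[OF wf_r])
  case (1 x)
  let ?R = "rest x"
  have "D (H ?R) + H (D ?R) = ?R"
  proof (rule frag_additive_eq[of _ "(U \<union> {y. (y, x) \<in> r}) \<inter> noncrit n" "\<lambda>c. D (H c) + H (D c)" "\<lambda>c. c"])
    show "Poly_Mapping.keys ?R \<subseteq> (U \<union> {y. (y, x) \<in> r}) \<inter> noncrit n"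
      using 1 by (intro keys_rest)
    fix y assume y: "y \<in> (U \<union> {y. (y, x) \<in> r}) \<inter> noncrit n"
    show "D (H (frag_of y)) + H (D (frag_of y)) = frag_of y"
    proof (cases "y \<in> U")
      case True
      then have "y \<notin> L" using disjoint by auto
      then have "H (frag_of y) = 0" by (simp add: H_def)
      then show ?thesis using H_D_upper[OF True] y by auto
    next
      case False
      then have "y \<in> L" using lower_or_upper y by auto
      then have "H (frag_of y) = hb y" by (simp add: H_def)
      with 1(1) y False \<open>y \<in> L\<close> show ?thesis by simp
    qed
  qed (auto simp: H_linear frag_extend_linear)
  moreover have "D ?R = - bd x"
  proof -
    have "up x \<in> X (Suc n)" using up_upper 1 by (auto simp: noncrit_def)
    then have "D (bd (up x)) = 0" by (rule bd_bd)
    then show ?thesis by (simp add: rest_def frag_extend_linear)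
  qed
  then have "H (D ?R) = - H (bd x)"
    by (simp only: H_linear)
  ultimately have "D (H ?R) = ?R + H (bd x)"
    by (simp only: add_uminus_conv_diff diff_eq_eq)
  then show ?case
    by (simp add: hb_eq[OF 1(2,3)] frag_extend_linear rest_def)
qed

lemma contraction:
  assumes "Poly_Mapping.keys c \<subseteq> noncrit n" shows "D (H c) + H (D c) = c"
proof (rule frag_additive_eq[of _ "noncrit n" "\<lambda>c. D (H c) + H (D c)" "\<lambda>c. c"])
  fix y assume y: "y \<in> noncrit n"
  show "D (H (frag_of y)) + H (D (frag_of y)) = frag_of y"
  proof (cases "y \<in> U")
    case True
    then have "y \<notin> L" using disjoint by auto
    then have "H (frag_of y) = 0" by (simp add: H_def)
    then show ?thesis using H_D_upper[OF True] y by auto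
  next
    case False
    then have "y \<in> L" using lower_or_upper y by auto
    then show ?thesis using contraction_lower[of y n] y by (simp add: H_def)
  qed
qed (use assms in \<open>auto simp: H_linear frag_extend_linear\<close>)

text \<open>The linear section \<open>S\<close> of the projection fails to be a chain map by a noncritical chain, and
  contracting this defect repairs it.\<close>

definition lift :: "('q \<Rightarrow>\<^sub>0 int) \<Rightarrow> ('a \<Rightarrow>\<^sub>0 int)" where
  "lift c = S c - H (D (S c) - S (Dq c))"

lemma lift_diff: "lift (a - b) = lift a - lift b"
  by (simp add: lift_def H_linear frag_extend_linear)

lemma keys_lift_defect:
  assumes "Poly_Mapping.keys c \<subseteq> Q (Suc n)"
  shows "Poly_Mapping.keys (D (S c) - S (Dq c)) \<subseteq> noncrit n"
proof (rule kernel_proj)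
  show "Poly_Mapping.keys (D (S c) - S (Dq c)) \<subseteq> X n"
    using assms by (intro keys_diff_subset keys_D keys_S keys_Dq)
  show "proj n (D (S c) - S (Dq c)) = 0"
    using assms by (simp add: proj_diff proj_D proj_S keys_S keys_Dq)
qed

lemma keys_H_lift_defect:
  assumes "Poly_Mapping.keys c \<subseteq> Q n"
  shows "Poly_Mapping.keys (H (D (S c) - S (Dq c))) \<subseteq> noncrit n"
proof (cases n)
  case 0
  then show ?thesis using assms by (simp add: D_0 Dq_0 keys_S H_linear)
next
  case (Suc m)
  then show ?thesis using keys_H keys_lift_defect assms by simp
qed

lemma keys_lift: "Poly_Mapping.keys c \<subseteq> Q n \<Longrightarrow> Poly_Mapping.keys (lift c) \<subseteq> X n"
  unfolding lift_def using keys_H_lift_defect[of c n]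
  by (intro keys_diff_subset keys_S) (auto simp: noncrit_def)

lemma proj_lift: "Poly_Mapping.keys c \<subseteq> Q n \<Longrightarrow> proj n (lift c) = c"
  by (simp add: lift_def proj_diff proj_S proj_noncrit keys_H_lift_defect)

lemma D_lift:
  assumes "Poly_Mapping.keys c \<subseteq> Q (Suc n)" shows "D (lift c) = lift (Dq c)"
proof -
  have DqDq: "Dq (Dq c) = 0"
  proof (cases n)
    case 0
    then show ?thesis using assms by (simp add: Dq_0 keys_Dq)
  next
    case (Suc m)
    have "Dq (Dq c) = Dq (proj n (D (S c)))"
      using assms by (simp add: proj_D keys_S proj_S)
    also have "\<dots> = proj m (D (D (S c)))"
      using assms Suc by (simp add: proj_D keys_S keys_D)
    also have "\<dots> = 0" using assms by (subst DD[of _ "Suc n"]) (auto simp: proj_def keys_S)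
    finally show ?thesis .
  qed
  let ?e = "D (S c) - S (Dq c)"
  have "D (H ?e) + H (D ?e) = ?e"
    by (rule contraction[OF keys_lift_defect[OF assms]])
  moreover have "D ?e = - D (S (Dq c))"
    using assms by (simp add: frag_extend_linear DD[of _ "Suc n"] keys_S)
  then have "H (D ?e) = - H (D (S (Dq c)))"
    by (simp only: H_linear)
  ultimately have "D (H ?e) = ?e + H (D (S (Dq c)))"
    by (simp only: add_uminus_conv_diff diff_eq_eq)
  then show ?thesis by (simp add: lift_def frag_extend_linear DqDq)
qed

text \<open>The projection is an exact left inverse of \<open>lift\<close>.  In the other direction
  \<open>lift (proj c) - c\<close> is noncritical, so the contraction \<open>H\<close> applied to it is the required
  homotopy.\<close>

theorem chain_homotopy_equivalent_critical:
  assumes C: "grp C = (\<lambda>n. free_Abelian_group (X n))"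
      "\<And>n c. Poly_Mapping.keys c \<subseteq> X (Suc n) \<Longrightarrow> dif C (Suc n) c = D c"
    and C': "grp C' = (\<lambda>n. free_Abelian_group (Q n))"
      "\<And>n c. Poly_Mapping.keys c \<subseteq> Q (Suc n) \<Longrightarrow> dif C' (Suc n) c = Dq c"
  shows "chain_homotopy_equivalent C C'"
proof -
  have DqDq: "Dq (Dq c) = 0" if "Poly_Mapping.keys c \<subseteq> Q (Suc (Suc n))" for c n
  proof -
    have "Dq (Dq c) = proj n (D (D (lift c)))"
      using that by (simp add: proj_D keys_lift keys_D proj_lift)
    also have "\<dots> = 0" using that by (subst DD[of _ "Suc (Suc n)"]) (auto simp: proj_def keys_lift)
    finally show ?thesis .
  qed
  have plus: "F (a + b) = F a + F b" if "\<And>a b. F (a - b) = F a - F b"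
    for F :: "('x \<Rightarrow>\<^sub>0 int) \<Rightarrow> ('y \<Rightarrow>\<^sub>0 int)" and a b
  proof -
    have "F (0 - b) = F 0 - F b" "F (0 - 0) = F 0 - F 0" "F (a - (0 - b)) = F a - F (0 - b)"
      by (rule that)+
    then show ?thesis by simp
  qed
  let ?h = "\<lambda>n c. H (lift (proj n c) - c)"
  have C_complex: "chain_complex C"
    unfolding chain_complex_def C
    by (auto simp: C abelian_free_Abelian_group hom_def keys_D DD keys_add_subset frag_extend_linear)
  have C'_complex: "chain_complex C'"
    unfolding chain_complex_def C'
    by (auto simp: C' abelian_free_Abelian_group hom_def keys_Dq DqDq keys_add_subset frag_extend_linear)
  have proj_add: "proj n (a + b) = proj n a + proj n b" for n a b
    by (rule plus) (rule proj_diff)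
  have lift_add: "lift (a + b) = lift a + lift b" for a b
    by (rule plus) (rule lift_diff)
  have proj: "chain_map C C' proj"
    unfolding chain_map_def
    by (auto simp: C C' hom_def proj_D subsetD[OF keys_proj] keys_proj proj_add)
  have lift: "chain_map C' C (\<lambda>n. lift)"
    unfolding chain_map_def
  proof (intro conjI allI ballI)
    fix n x assume "x \<in> carrier (grp C' (Suc n))"
    then have "Poly_Mapping.keys x \<subseteq> Q (Suc n)" by (simp add: C')
    then show "lift (dif C' (Suc n) x) = dif C (Suc n) (lift x)"
      by (simp add: C C' D_lift keys_lift)
  qed (auto simp: C C' hom_def subsetD[OF keys_lift] lift_add)
  have defect: "Poly_Mapping.keys (lift (proj n c) - c) \<subseteq> noncrit n" if "Poly_Mapping.keys c \<subseteq> X n" for c n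
    using that by (intro kernel_proj keys_diff_subset keys_lift keys_proj) (simp_all add: proj_diff proj_lift keys_proj)
  have keys_h: "Poly_Mapping.keys (?h n c) \<subseteq> X (Suc n)" if "Poly_Mapping.keys c \<subseteq> X n" for n c
    using keys_H[OF defect[OF that]] by (auto simp: noncrit_def)
  have h_add: "?h n (a + b) = ?h n a + ?h n b" for n a b
    by (simp add: proj_add lift_add H_linear)
  have h_hom: "?h n \<in> hom (grp C n) (grp C (Suc n))" for n
    by (rule homI) (use keys_h in \<open>simp_all only: C(1) mult_free_Abelian_group h_add carrier_free_Abelian_group_iff\<close>)
  have "chain_homotopic C C (\<lambda>n x. lift (proj n x)) (\<lambda>n x. x)"
    unfolding chain_homotopic_def
  proof (intro exI conjI allI ballI)
    fix c assume "c \<in> carrier (grp C 0)"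
    then have c: "Poly_Mapping.keys c \<subseteq> X 0" by (simp add: C)
    have "lift (proj 0 c) - c = D (?h 0 c) + H (D (lift (proj 0 c) - c))"
      using contraction[OF defect[OF c]] by simp
    also have "D (lift (proj 0 c) - c) = 0"
      using c by (intro D_0 keys_diff_subset keys_lift keys_proj)
    also have "D (?h 0 c) = dif C (Suc 0) (?h 0 c)"
      by (rule C(2)[OF keys_h[OF c], symmetric])
    finally show "lift (proj 0 c) \<otimes>\<^bsub>grp C 0\<^esub> inv\<^bsub>grp C 0\<^esub> c = dif C (Suc 0) (?h 0 c)"
      unfolding H_linear(5) C(1) mult_free_Abelian_group inv_free_Abelian_group[OF c] add_uminus_conv_diff add_0_right .
  next
    fix n c assume "c \<in> carrier (grp C (Suc n))"
    then have c: "Poly_Mapping.keys c \<subseteq> X (Suc n)" by (simp add: C)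
    have "lift (proj (Suc n) c) - c = D (?h (Suc n) c) + H (D (lift (proj (Suc n) c) - c))"
      using contraction[OF defect[OF c]] by simp
    also have "D (lift (proj (Suc n) c) - c) = lift (proj n (D c)) - D c"
      using c by (simp add: frag_extend_linear D_lift[of _ n] proj_D keys_proj)
    also have "D (?h (Suc n) c) = dif C (Suc (Suc n)) (?h (Suc n) c)"
      by (rule C(2)[OF keys_h[OF c], symmetric])
    finally show "lift (proj (Suc n) c) \<otimes>\<^bsub>grp C (Suc n)\<^esub> inv\<^bsub>grp C (Suc n)\<^esub> c =
         dif C (Suc (Suc n)) (?h (Suc n) c) \<otimes>\<^bsub>grp C (Suc n)\<^esub> ?h n (dif C (Suc n) c)"
      unfolding C(1) C(2)[OF c] mult_free_Abelian_group inv_free_Abelian_group[OF c] add_uminus_conv_diff .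
  qed (rule h_hom)
  moreover have "chain_homotopic C' C' (\<lambda>n y. proj n (lift y)) (\<lambda>n y. y)"
    unfolding chain_homotopic_def
    by (rule exI[of _ "\<lambda>n x. 0"]) (simp add: C' hom_def proj_lift keys_Dq)
  ultimately show ?thesis
    unfolding chain_homotopy_equivalent_def using C_complex C'_complex proj lift by blast
qed

end

section \<open>Faces of magnitude tuples\<close>

definition steps :: "'a list \<Rightarrow> ('a \<times> 'a) list" where
  "steps xs = zip xs (tl xs)"

lemma steps_simps [simp]:
  "steps [] = []" "steps [x] = []" "steps (x # y # zs) = (x, y) # steps (y # zs)"
  by (simp_all add: steps_def)

lemma steps_append: "steps (us @ x # ws) = steps (us @ [x]) @ steps (x # ws)"
proof (induction us)
  case (Cons u us)
  then show ?case by (cases us) auto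
qed simp

lemma steps_append_Cons:
  "steps (us @ x # y # ws) = steps (us @ [x]) @ (x, y) # steps (y # ws)"
  by (simp add: steps_append[of us x "y # ws"])

lemma length_steps [simp]: "length (steps xs) = length xs - 1"
  by (simp add: steps_def)

lemma steps_nth: "Suc i < length xs \<Longrightarrow> steps xs ! i = (xs ! i, xs ! Suc i)"
  by (simp add: steps_def nth_tl)

lemma set_steps_subset: "set (steps xs) \<subseteq> set xs \<times> set xs"
  unfolding steps_def
  by (auto dest: set_zip_leftD set_zip_rightD) (metis list.sel(2) list.set_sel(2) set_zip_rightD)

definition path_length :: "'a metric \<Rightarrow> 'a list \<Rightarrow> real" where
  "path_length X xs = (\<Sum>(x, y) \<leftarrow> steps xs. mdist X x y)"

lemma path_length_simps [simp]:
  "path_length X [] = 0" "path_length X [x] = 0"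
  "path_length X (x # y # zs) = mdist X x y + path_length X (y # zs)"
  by (simp_all add: path_length_def)

lemma path_length_append:
  "path_length X (us @ x # ws) = path_length X (us @ [x]) + path_length X (x # ws)"
  by (simp add: path_length_def steps_append[of us x ws])

lemma path_length_nonneg: "0 \<le> path_length X xs"
  unfolding path_length_def by (rule sum_list_nonneg) auto

lemma magnitude_tuples_iff:
  "xs \<in> magnitude_tuples X l n \<longleftrightarrow>
     length xs = Suc n \<and> set xs \<subseteq> mspace X \<and> (\<forall>(x, y) \<in> set (steps xs). x \<noteq> y) \<and> path_length X xs = l"
proof (cases "length xs = Suc n")
  case True
  have "(\<Sum>i<n. mdist X (xs ! i) (xs ! Suc i)) = path_length X xs"
    unfolding path_length_def using True
    by (auto simp: sum_list_sum_nth steps_nth atLeast0LessThan intro!: sum.cong)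
  moreover have "(\<forall>i<n. xs ! i \<noteq> xs ! Suc i) \<longleftrightarrow> (\<forall>(x, y) \<in> set (steps xs). x \<noteq> y)"
    using True by (simp add: all_set_conv_all_nth steps_nth)
  ultimately show ?thesis using True by (simp add: magnitude_tuples_def)
qed (simp add: magnitude_tuples_def)

definition del :: "nat \<Rightarrow> 'a list \<Rightarrow> 'a list" where
  "del i xs = take i xs @ drop (Suc i) xs"

lemma length_del: "i < length xs \<Longrightarrow> length (del i xs) = length xs - 1"
  by (simp add: del_def)

lemma del_append: "del (Suc (length us)) (us @ x # y # ws) = us @ x # ws"
  by (simp add: del_def)

lemma set_del: "set (del i xs) \<subseteq> set xs"
  by (auto simp: del_def dest: in_set_takeD in_set_dropD)

lemma nth_del:
  assumes "i < length xs" "Suc k < length xs"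
  shows "del i xs ! k = (if k < i then xs ! k else xs ! Suc k)"
proof -
  have "Suc (i + (k - i)) = Suc k" if "\<not> k < i" using that by simp
  then show ?thesis using assms by (simp add: del_def nth_append del: add_Suc)
qed

lemma del_del:
  assumes "j < i" "i < length xs"
  shows "del j (del i xs) = del (i - 1) (del j xs)"
proof (rule nth_equalityI)
  show "length (del j (del i xs)) = length (del (i - 1) (del j xs))"
    using assms by (simp add: length_del)
  fix k assume "k < length (del j (del i xs))"
  then have k: "Suc (Suc k) < length xs" using assms by (simp add: length_del)
  have "del j (del i xs) ! k = (if k < j then del i xs ! k else del i xs ! Suc k)"
    using assms k by (intro nth_del) (simp_all add: length_del)
  also have "\<dots> = (if k < j then xs ! k else if Suc k < i then xs ! Suc k else xs ! Suc (Suc k))"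
    using assms k nth_del[of i xs k] nth_del[of i xs "Suc k"] by simp
  also have "\<dots> = (if k < i - 1 then del j xs ! k else del j xs ! Suc k)"
    using assms k nth_del[of j xs k] nth_del[of j xs "Suc k"] by auto
  also have "\<dots> = del (i - 1) (del j xs) ! k"
    using assms k by (intro nth_del[symmetric]) (simp_all add: length_del)
  finally show "del j (del i xs) ! k = del (i - 1) (del j xs) ! k" .
qed

text \<open>Deleting an inner point never lengthens a tuple, and it keeps the length exactly when the
  point lies between its neighbours.  Membership in the index set below is therefore a condition
  on total lengths only, which makes the simplicial identities available without case
  distinctions on adjacent indices.\<close>

definition faces :: "'a metric \<Rightarrow> 'a list \<Rightarrow> nat set" where
  "faces X xs = {i. 1 \<le> i \<and> Suc i < length xs \<and> path_length X (del i xs) = path_length X xs}"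

lemma finite_faces [simp]: "finite (faces X xs)"
  by (rule finite_subset[of _ "{..length xs}"]) (auto simp: faces_def)

lemma inner_index_split:
  assumes "1 \<le> i" "Suc i < length xs"
  obtains us x y z ws where "xs = us @ x # y # z # ws" "i = Suc (length us)"
    "del i xs = us @ x # z # ws" "x = xs ! (i - 1)" "y = xs ! i" "z = xs ! (i + 1)"
proof -
  obtain k where k: "i = Suc k" using assms(1) by (cases i) auto
  have "xs = take k xs @ xs ! k # xs ! Suc k # xs ! Suc (Suc k) # drop (Suc (Suc (Suc k))) xs"
    using assms k by (metis Cons_nth_drop_Suc Suc_lessD append_take_drop_id)
  moreover have "length (take k xs) = k" using assms k by simp
  ultimately show thesis
    using that[of "take k xs" "xs ! k" "xs ! Suc k" "xs ! Suc (Suc k)" "drop (Suc (Suc (Suc k))) xs"] k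
    by (metis add.commute del_append diff_Suc_1 plus_1_eq_Suc)
qed

lemma path_length_del:
  assumes "xs = us @ x # y # z # ws"
  shows "path_length X xs - path_length X (us @ x # z # ws) = mdist X x y + mdist X y z - mdist X x z"
  by (simp add: assms path_length_def steps_append_Cons)

lemma path_length_del_le:
  assumes "1 \<le> i" "Suc i < length xs" "set xs \<subseteq> mspace X"
  shows "path_length X (del i xs) \<le> path_length X xs"
proof -
  obtain us x y z ws where *: "xs = us @ x # y # z # ws" "del i xs = us @ x # z # ws"
    using inner_index_split[OF assms(1,2)] by metis
  then show ?thesis
    using path_length_del[OF *(1), of X] mdist_triangle[of x X y z] assms(3) by auto
qed

lemma mem_faces_iff_between:
  assumes "1 \<le> i" "Suc i < length xs"
  shows "i \<in> faces X xs \<longleftrightarrow> metric_between X (xs ! (i - 1)) (xs ! i) (xs ! (i + 1))"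
proof -
  obtain us x y z ws where *: "xs = us @ x # y # z # ws" "i = Suc (length us)" "del i xs = us @ x # z # ws"
     "x = xs ! (i - 1)" "y = xs ! i" "z = xs ! (i + 1)"
    by (rule inner_index_split[OF assms])
  have "path_length X (del i xs) = path_length X xs \<longleftrightarrow> mdist X x z = mdist X x y + mdist X y z"
    using path_length_del[OF *(1), of X] unfolding *(3) by argo
  then show ?thesis
    using assms by (simp add: faces_def metric_between_def *(4-6))
qed

definition face_sum :: "'a metric \<Rightarrow> 'a list \<Rightarrow> ('a list \<Rightarrow>\<^sub>0 int)" where
  "face_sum X xs = (\<Sum>i \<in> faces X xs. frag_cmul ((-1) ^ i) (frag_of (del i xs)))"

lemma magnitude_boundary_eq:
  assumes "Poly_Mapping.keys c \<subseteq> magnitude_tuples X l n"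
  shows "magnitude_boundary X n c = frag_extend (face_sum X) c"
  unfolding magnitude_boundary_def
proof (rule frag_extend_eq)
  fix xs assume "xs \<in> Poly_Mapping.keys c"
  then have "length xs = Suc n" using assms by (auto simp: magnitude_tuples_iff)
  then have "{i. 1 \<le> i \<and> i < n \<and> metric_between X (xs ! (i - 1)) (xs ! i) (xs ! (i + 1))} = faces X xs"
    using mem_faces_iff_between[of _ xs X] by (auto simp: faces_def)
  then show "(\<Sum>i\<in>{i. 1 \<le> i \<and> i < n \<and> metric_between X (xs ! (i - 1)) (xs ! i) (xs ! (i + 1))}.
             frag_cmul ((- 1) ^ i) (frag_of (take i xs @ drop (Suc i) xs))) = face_sum X xs"
    by (simp add: face_sum_def del_def)
qed

text \<open>The neighbours of a deleted point are distinct, for a point between \<open>x\<close> and \<open>x\<close> is \<open>x\<close>.\<close>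

lemma del_in_magnitude_tuples:
  assumes xs: "xs \<in> magnitude_tuples X l (Suc n)" and i: "i \<in> faces X xs"
  shows "del i xs \<in> magnitude_tuples X l n"
proof -
  have "1 \<le> i" "Suc i < length xs" using i by (auto simp: faces_def)
  then obtain us x y z ws where *: "xs = us @ x # y # z # ws" "i = Suc (length us)" "del i xs = us @ x # z # ws"
    by (rule inner_index_split)
  have sub: "set xs \<subseteq> mspace X" and ne: "\<forall>(x, y) \<in> set (steps xs). x \<noteq> y"
    using xs by (auto simp: magnitude_tuples_iff)
  have "x \<noteq> y" using ne by (simp add: *(1) steps_append_Cons)
  have "mdist X x z = mdist X x y + mdist X y z"
    using i path_length_del[OF *(1), of X] *(3) by (simp add: faces_def)
  moreover have "mdist X x y \<noteq> 0" using \<open>x \<noteq> y\<close> sub *(1) by simp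
  moreover have "mdist X x x = 0" using sub *(1) by simp
  ultimately have "x \<noteq> z"
    using mdist_nonneg[of X x y] mdist_nonneg[of X y z] by (auto simp: add_nonneg_eq_0_iff)
  then have "\<forall>(x, y) \<in> set (steps (del i xs)). x \<noteq> y"
    using ne unfolding *(3) unfolding *(1) steps_append_Cons by auto
  moreover have "length (del i xs) = Suc n"
    using xs i by (simp add: length_del faces_def magnitude_tuples_iff)
  ultimately show ?thesis
    using xs i set_del[of i xs] by (auto simp: magnitude_tuples_iff faces_def)
qed

lemma keys_face_sum:
  "xs \<in> magnitude_tuples X l (Suc n) \<Longrightarrow> Poly_Mapping.keys (face_sum X xs) \<subseteq> magnitude_tuples X l n"
  unfolding face_sum_def
  by (intro keys_sum_subset keys_cmul_subset) (simp add: del_in_magnitude_tuples)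

lemma keys_face_sum_subset:
  "Poly_Mapping.keys (face_sum X xs) \<subseteq> (\<lambda>i. del i xs) ` faces X xs"
  unfolding face_sum_def
  by (intro keys_sum_subset keys_cmul_subset) auto

text \<open>Deleting two inner points in either order gives the same tuple with opposite signs, and
  both orders are allowed under the same condition: the total length does not change.\<close>

lemma face_sum_face_sum:
  assumes "set xs \<subseteq> mspace X"
  shows "frag_extend (face_sum X) (face_sum X xs) = 0"
proof -
  define P where "P = (SIGMA i:faces X xs. faces X (del i xs))"
  define t where "t = (\<lambda>(i, j). frag_cmul ((-1) ^ (i + j)) (frag_of (del j (del i xs))))"
  have P: "P = {(i, j). 1 \<le> i \<and> Suc i < length xs \<and> 1 \<le> j \<and> Suc (Suc j) < length xs \<and>
                 path_length X (del j (del i xs)) = path_length X xs}" (is "_ = ?P")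
  proof (intro equalityI subsetI)
    fix q assume "q \<in> P" then show "q \<in> ?P"
      by (auto simp: P_def faces_def length_del)
  next
    fix q assume "q \<in> ?P"
    then obtain i j where q: "q = (i, j)" "1 \<le> i" "Suc i < length xs" "1 \<le> j" "Suc (Suc j) < length xs"
      "path_length X (del j (del i xs)) = path_length X xs" by auto
    have "path_length X (del j (del i xs)) \<le> path_length X (del i xs)"
      using q assms set_del[of i xs] by (intro path_length_del_le) (auto simp: length_del)
    moreover have "path_length X (del i xs) \<le> path_length X xs"
      using q assms by (intro path_length_del_le) auto
    ultimately show "q \<in> P"
      using q by (auto simp: P_def faces_def length_del)
  qed
  have fin: "finite P" by (simp add: P_def)
  have "frag_extend (face_sum X) (face_sum X xs) = (\<Sum>i\<in>faces X xs. \<Sum>j\<in>faces X (del i xs). t (i, j))"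
    by (simp add: face_sum_def[of X xs] frag_extend_sum frag_extend_cmul comp_def)
       (simp add: face_sum_def frag_cmul_sum t_def power_add)
  also have "\<dots> = sum t P" by (simp add: P_def sum.Sigma)
  also have "\<dots> = sum t (P \<inter> {(i, j). j < i}) + sum t (P \<inter> {(i, j). i \<le> j})"
    by (subst sum.union_disjoint[symmetric]) (auto simp: fin intro: sum.cong)
  \<comment> \<open>Deleting \<open>i\<close> and then \<open>j < i\<close> is deleting \<open>j\<close> and then \<open>i - 1\<close>, by the index shift.\<close>
  also have "sum t (P \<inter> {(i, j). j < i}) = sum (\<lambda>q. - t q) (P \<inter> {(i, j). i \<le> j})"
  proof (rule sum.reindex_bij_witness[where i = "\<lambda>(i, j). (Suc j, i)" and j = "\<lambda>(i, j). (j, i - 1)"])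
    fix q assume "q \<in> P \<inter> {(i, j). j < i}"
    then obtain i j where q: "q = (i, j)" "j < i" "(i, j) \<in> P" by auto
    then have "Suc i < length xs" "del j (del i xs) = del (i - 1) (del j xs)"
      using del_del[of j i xs] by (auto simp: P)
    moreover have "(-1 :: int) ^ (i + j) = - ((-1) ^ (j + (i - 1)))"
      using q(2) by (cases i) (auto simp: power_add)
    ultimately show "- t (case q of (i, j) \<Rightarrow> (j, i - 1)) = t q"
      "(case q of (i, j) \<Rightarrow> (j, i - 1)) \<in> P \<inter> {(i, j). i \<le> j}"
      using q by (auto simp: t_def P)
  next
    fix q assume "q \<in> P \<inter> {(i, j). i \<le> j}"
    then obtain i j where q: "q = (i, j)" "i \<le> j" "(i, j) \<in> P" by auto
    then have "del i (del (Suc j) xs) = del j (del i xs)"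
      using del_del[of i "Suc j" xs] by (auto simp: P)
    then show "(case q of (i, j) \<Rightarrow> (Suc j, i)) \<in> P \<inter> {(i, j). j < i}"
      using q by (auto simp: P)
  qed auto
  finally show ?thesis by (simp add: sum_negf)
qed

section \<open>Transport in a metric fibration\<close>

locale fibred_metric =
  fixes E :: "'a metric" and B :: "'b metric" and p :: "'a \<Rightarrow> 'b"
  assumes fibration: "metric_fibration E B p"
begin

text \<open>The transported point \<open>x\<^sup>c\<close>.\<close>

definition tr :: "'a \<Rightarrow> 'b \<Rightarrow> 'a" where
  "tr x c = (THE x'. x' \<in> mspace (metric_fiber E p c) \<and> mdist E x x' = mdist B (p x) c \<and>
     (\<forall>y \<in> mspace (metric_fiber E p c). mdist E x y = mdist E x x' + mdist E x' y))"

lemma mspace_fiber: "mspace (metric_fiber E p c) = {x \<in> mspace E. p x = c}"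
  by (auto simp: metric_fiber_def)

lemma mdist_fiber [simp]: "mdist (metric_fiber E p c) = mdist E"
  by (simp add: metric_fiber_def)

lemma p_in [simp]: "x \<in> mspace E \<Longrightarrow> p x \<in> mspace B"
  using fibration by (auto simp: metric_fibration_def Lipschitz_continuous_map_def)

lemma tr_prop:
  assumes "x \<in> mspace E" "c \<in> mspace B"
  shows "tr x c \<in> mspace (metric_fiber E p c) \<and> mdist E x (tr x c) = mdist B (p x) c \<and>
     (\<forall>y \<in> mspace (metric_fiber E p c). mdist E x y = mdist E x (tr x c) + mdist E (tr x c) y)"
  unfolding tr_def by (rule theI') (use fibration assms in \<open>auto simp: metric_fibration_def\<close>)

lemma tr_in [simp]: "x \<in> mspace E \<Longrightarrow> c \<in> mspace B \<Longrightarrow> tr x c \<in> mspace E"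
  and p_tr [simp]: "x \<in> mspace E \<Longrightarrow> c \<in> mspace B \<Longrightarrow> p (tr x c) = c"
  and mdist_tr: "x \<in> mspace E \<Longrightarrow> c \<in> mspace B \<Longrightarrow> mdist E x (tr x c) = mdist B (p x) c"
proof -
  assume "x \<in> mspace E" "c \<in> mspace B"
  note tr = tr_prop[OF this]
  show "tr x c \<in> mspace E" "p (tr x c) = c"
    using conjunct1[OF tr] by (simp_all add: mspace_fiber)
  show "mdist E x (tr x c) = mdist B (p x) c"
    using tr by blast
qed

lemma mdist_split:
  assumes "x \<in> mspace E" "y \<in> mspace E"
  shows "mdist E x y = mdist B (p x) (p y) + mdist E (tr x (p y)) y"
proof -
  have y: "y \<in> mspace (metric_fiber E p (p y))" using assms by (simp add: mspace_fiber)
  note tr = tr_prop[OF assms(1) p_in[OF assms(2)]]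
  have "mdist E x y = mdist E x (tr x (p y)) + mdist E (tr x (p y)) y"
    using tr y by blast
  then show ?thesis unfolding conjunct1[OF conjunct2[OF tr]] .
qed

lemma tr_self [simp]: "x \<in> mspace E \<Longrightarrow> tr x (p x) = x"
  using mdist_tr[of x "p x"] by (metis mdist_zero p_in tr_in)

lemma tr_tr_same [simp]: "x \<in> mspace E \<Longrightarrow> c \<in> mspace B \<Longrightarrow> tr (tr x c) c = tr x c"
  using tr_self[of "tr x c"] by simp

text \<open>Transport is an isometry between fibres because the distance from \<open>x\<close> to \<open>tr y c\<close> splits
  into the same base distance and a fibre distance at either end.\<close>

lemma tr_isometry:
  assumes "x \<in> mspace E" "y \<in> mspace E" "p x = p y" "c \<in> mspace B"
  shows "mdist E (tr x c) (tr y c) = mdist E x y"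
proof -
  have "mdist E x (tr y c) = mdist B (p x) c + mdist E (tr x c) (tr y c)"
    using mdist_split[of x "tr y c"] assms by simp
  moreover have "mdist E (tr y c) x = mdist E (tr y c) y + mdist E y x"
  proof -
    have y: "tr (tr y c) (p y) = y"
    proof -
      have "mdist E (tr y c) y = mdist B c (p y) + mdist E (tr (tr y c) (p y)) y"
        using mdist_split[of "tr y c" y] assms by simp
      then have "mdist E (tr (tr y c) (p y)) y = 0"
        using mdist_tr[of y c] assms by (simp add: mdist_commute)
      then show ?thesis using assms by simp
    qed
    show ?thesis
      using mdist_split[of "tr y c" x] mdist_tr[of "tr y c" "p y"] assms y by simp
  qed
  moreover have "mdist E (tr y c) y = mdist B (p x) c"
    using mdist_tr[of y c] assms by (simp add: mdist_commute)
  ultimately show ?thesis by (simp add: mdist_commute)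
qed

text \<open>The step back to \<open>x\<close> is horizontal because the distances in both directions agree.\<close>

lemma tr_tr_back:
  assumes "x \<in> mspace E" "c \<in> mspace B"
  shows "tr (tr x c) (p x) = x"
proof -
  have "mdist E (tr x c) x = mdist B c (p x) + mdist E (tr (tr x c) (p x)) x"
    using mdist_split[of "tr x c" x] assms by simp
  then have "mdist E (tr (tr x c) (p x)) x = 0"
    using mdist_tr[of x c] assms by (simp add: mdist_commute)
  then show ?thesis using assms by simp
qed

text \<open>Transport need not be functorial, but it is functorial along geodesics: the composite of
  two transports realises a distance that only \<open>tr x d\<close> realises.\<close>

lemma tr_tr_between:
  assumes "x \<in> mspace E" "c \<in> mspace B" "d \<in> mspace B" "mdist B (p x) d = mdist B (p x) c + mdist B c d"
  shows "tr (tr x c) d = tr x d"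
proof -
  have "mdist E x (tr (tr x c) d) \<le> mdist B (p x) c + mdist B c d"
    using mdist_triangle[of x E "tr x c" "tr (tr x c) d"] mdist_tr[of x c] mdist_tr[of "tr x c" d] assms by simp
  moreover have "mdist E x (tr (tr x c) d) = mdist B (p x) d + mdist E (tr x d) (tr (tr x c) d)"
    using mdist_split[of x "tr (tr x c) d"] assms by simp
  ultimately have "mdist E (tr x d) (tr (tr x c) d) = 0"
    using assms(4) mdist_nonneg[of E "tr x d" "tr (tr x c) d"] by linarith
  then show ?thesis using assms by simp
qed

definition hor :: "'a \<Rightarrow> 'a \<Rightarrow> bool" where
  "hor x y \<longleftrightarrow> p x \<noteq> p y \<and> y = tr x (p y)"

text \<open>A point \<open>y\<close> between two points of one fibre lies in that fibre: transporting both ends into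
  the fibre of \<open>y\<close> preserves their distance, so any base distance would be travelled in vain.\<close>

lemma between_same_fibre:
  assumes "x \<in> mspace E" "y \<in> mspace E" "z \<in> mspace E"
    and "mdist E x z = mdist E x y + mdist E y z" "p x = p z"
  shows "p x = p y"
proof -
  have "mdist E x z = mdist E (tr x (p y)) (tr z (p y))"
    using assms by (simp add: tr_isometry)
  also have "\<dots> \<le> mdist E (tr x (p y)) y + mdist E y (tr z (p y))"
    using assms by (intro mdist_triangle) auto
  finally have "2 * mdist B (p x) (p y) \<le> 0"
    using mdist_split[of x y] mdist_split[of z y] assms by (simp add: mdist_commute)
  then have "mdist B (p x) (p y) = 0" using mdist_nonneg[of B "p x" "p y"] by linarith
  then show ?thesis using assms by simp
qed

text \<open>A horizontal step has no fibre part.  Hence neither has a subdivision of it, whose base parts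
  must add up to the base distance.\<close>

lemma between_horizontal:
  assumes "x \<in> mspace E" "y \<in> mspace E" "z \<in> mspace E"
    and "mdist E x z = mdist E x y + mdist E y z" "z = tr x (p z)"
  shows "y = tr x (p y)" "z = tr y (p z)" "mdist B (p x) (p z) = mdist B (p x) (p y) + mdist B (p y) (p z)"
proof -
  have "mdist E x z = mdist B (p x) (p z)" using mdist_tr[of x "p z"] assms by simp
  also have "\<dots> \<le> mdist B (p x) (p y) + mdist B (p y) (p z)"
    using assms by (intro mdist_triangle) auto
  finally have le: "mdist E x z \<le> mdist B (p x) (p y) + mdist B (p y) (p z)" .
  then have "mdist E (tr x (p y)) y = 0" "mdist E (tr y (p z)) z = 0"
    using mdist_split[of x y] mdist_split[of y z] assms(1-4)
      mdist_nonneg[of E "tr x (p y)" y] mdist_nonneg[of E "tr y (p z)" z] by linarith+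
  then show 1: "y = tr x (p y)" "z = tr y (p z)" using assms by auto
  show "mdist B (p x) (p z) = mdist B (p x) (p y) + mdist B (p y) (p z)"
    using \<open>mdist E x z = mdist B (p x) (p z)\<close> assms(4) mdist_split[of x y] mdist_split[of y z]
      \<open>mdist E (tr x (p y)) y = 0\<close> \<open>mdist E (tr y (p z)) z = 0\<close> assms(1-3) by simp
qed

section \<open>Step types and the measure that decreases along faces\<close>

text \<open>\<open>hcount\<close> counts the steps that move in the base and \<open>vcount\<close> those that move in the fibres;
  tilted steps are counted in both.  An inversion is a step that moves in a fibre together with a
  later one that moves in the base.\<close>

definition hcount :: "('a \<times> 'a) list \<Rightarrow> nat" where
  "hcount ss = length (filter (\<lambda>(x, y). p x \<noteq> p y) ss)"

definition vcount :: "('a \<times> 'a) list \<Rightarrow> nat" where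
  "vcount ss = length (filter (\<lambda>(x, y). y \<noteq> tr x (p y)) ss)"

fun inversions :: "('a \<times> 'a) list \<Rightarrow> nat" where
  "inversions [] = 0"
| "inversions ((x, y) # ss) = (if y \<noteq> tr x (p y) then hcount ss else 0) + inversions ss"

lemma hcount_simps [simp]:
  "hcount [] = 0" "hcount ((x, y) # ss) = (if p x \<noteq> p y then 1 else 0) + hcount ss"
  "hcount (ss @ ts) = hcount ss + hcount ts"
  by (simp_all add: hcount_def)

lemma vcount_simps [simp]:
  "vcount [] = 0" "vcount ((x, y) # ss) = (if y \<noteq> tr x (p y) then 1 else 0) + vcount ss"
  "vcount (ss @ ts) = vcount ss + vcount ts"
  by (simp_all add: vcount_def)

lemma inversions_append [simp]:
  "inversions (ss @ ts) = inversions ss + vcount ss * hcount ts + inversions ts"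
  by (induction ss rule: inversions.induct) (auto simp: algebra_simps)

definition step_measure :: "'a list \<Rightarrow> nat \<times> nat \<times> nat" where
  "step_measure xs = (let ss = steps xs in (hcount ss, vcount ss, inversions ss))"

definition step_order :: "('a list \<times> 'a list) set" where
  "step_order = inv_image (less_than <*lex*> less_than <*lex*> less_than) step_measure"

lemma wf_step_order: "wf step_order"
  unfolding step_order_def by auto

text \<open>If both merged steps move in the base, then \<open>hcount\<close> drops.  Otherwise it is
  preserved, and if both move in the fibres, then \<open>vcount\<close> drops.  The remaining merged pairs consist
  of one purely vertical and one purely horizontal step; both counts are preserved, and the pair
  is an inversion unless it is a horizontal-vertical corner.\<close>

lemma face_decreases:
  assumes E: "x \<in> mspace E" "y \<in> mspace E" "z \<in> mspace E" and ne: "x \<noteq> y" "y \<noteq> z"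
    and btw: "mdist E x z = mdist E x y + mdist E y z"
    and corner: "\<not> (hor x y \<and> p y = p z)"
  shows "(us @ x # z # ws, us @ x # y # z # ws) \<in> step_order"
proof -
  have V: "z \<noteq> tr x (p z)" if "y \<noteq> tr x (p y) \<or> z \<noteq> tr y (p z)"
    using between_horizontal[OF E btw] that by blast
  have Hz: "p x \<noteq> p z" if "p x \<noteq> p y \<or> p y \<noteq> p z"
    using between_same_fibre[OF E btw] that by metis
  have h1: "y = tr x (p y) \<Longrightarrow> p x \<noteq> p y" and h2: "z = tr y (p z) \<Longrightarrow> p y \<noteq> p z"
    using ne E by (metis tr_self)+
  have st: "steps (us @ x # z # ws) = steps (us @ [x]) @ (x, z) # steps (z # ws)"
    "steps (us @ x # y # z # ws) = steps (us @ [x]) @ (x, y) # (y, z) # steps (z # ws)"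
    by (simp_all add: steps_append_Cons)
  consider "p x \<noteq> p y" "p y \<noteq> p z"
    | "p x = p y" "p y = p z" | "p x \<noteq> p y" "p y = p z" | "p x = p y" "p y \<noteq> p z" by blast
  then show ?thesis
  proof cases
    case 1
    then show ?thesis by (simp add: step_order_def step_measure_def Let_def st)
  next
    case 2
    then have "y \<noteq> tr x (p y)" "z \<noteq> tr y (p z)" using h1 h2 by auto
    then show ?thesis using 2 V by (simp add: step_order_def step_measure_def Let_def st)
  next
    case 3
    then have "y \<noteq> tr x (p y)" "z \<noteq> tr y (p z)" using h2 corner by (auto simp: hor_def)
    then show ?thesis using 3 V Hz by (simp add: step_order_def step_measure_def Let_def st)
  next
    case 4
    then have "y \<noteq> tr x (p y)" using h1 by auto
    then show ?thesis using 4 V Hz by (simp add: step_order_def step_measure_def Let_def st)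
  qed
qed

text \<open>Splitting a tilted step into a corner, with the base movement first, creates no inversion.\<close>

lemma step_measure_insert:
  assumes "x \<in> mspace E" "y \<in> mspace E" "p x \<noteq> p y" "y \<noteq> tr x (p y)"
  shows "step_measure (us @ x # tr x (p y) # y # ws) = step_measure (us @ x # y # ws)"
  using assms
  by (simp add: step_measure_def Let_def steps_append_Cons)

section \<open>Tuples that run vertically first and horizontally afterwards\<close>

text \<open>The good tuples are those that will be critical: some vertical steps, then some horizontal
  steps.\<close>

definition good :: "'a list \<Rightarrow> bool" where
  "good xs \<longleftrightarrow> (\<exists>As Bs. steps xs = As @ Bs \<and> (\<forall>(x, y) \<in> set As. p x = p y) \<and> (\<forall>(x, y) \<in> set Bs. hor x y))"

lemma good_prefix: "good (xs @ ys) \<Longrightarrow> good xs"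
proof (cases "xs = []")
  case False
  assume "good (xs @ ys)"
  then obtain As Bs where *: "steps (xs @ ys) = As @ Bs" "\<forall>(x, y) \<in> set As. p x = p y" "\<forall>(x, y) \<in> set Bs. hor x y"
    by (auto simp: good_def)
  have "steps xs = take (length (steps xs)) (steps (xs @ ys))"
    using False by (cases xs rule: rev_cases; cases ys) (auto simp: steps_append_Cons)
  also have "\<dots> = take (length (steps xs)) As @ take (length (steps xs) - length As) Bs"
    by (simp add: *)
  finally show "good xs" unfolding good_def
    using *(2,3) by (meson in_set_takeD)
qed (auto simp: good_def)

lemma good_Nil [simp]: "good []" and good_single [simp]: "good [x]"
  by (auto simp: good_def)

lemma good_snoc: "good (us @ [x, y]) \<longleftrightarrow> good (us @ [x]) \<and>
    (hor x y \<or> p x = p y \<and> (\<forall>(x, y) \<in> set (steps (us @ [x])). p x = p y))"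
    (is "?l \<longleftrightarrow> ?r")
proof
  have st: "steps (us @ [x, y]) = steps (us @ [x]) @ [(x, y)]"
    by (simp add: steps_append_Cons)
  {
    assume l: ?l
    then have g: "good (us @ [x])" using good_prefix[of "us @ [x]" "[y]"] by simp
    from l obtain As Bs where *: "steps (us @ [x]) @ [(x, y)] = As @ Bs" "\<forall>(x, y) \<in> set As. p x = p y" "\<forall>(x, y) \<in> set Bs. hor x y"
      by (auto simp: good_def st)
    show ?r
    proof (cases Bs rule: rev_cases)
      case Nil
      then have "As = steps (us @ [x]) @ [(x, y)]" using *(1) by simp
      then show ?thesis using *(2) g by auto
    next
      case (snoc Bs' c)
      then show ?thesis using * g by auto
    qed
  }
  {
    assume r: ?r
    then obtain As Bs where *: "steps (us @ [x]) = As @ Bs" "\<forall>(x, y) \<in> set As. p x = p y" "\<forall>(x, y) \<in> set Bs. hor x y"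
      by (auto simp: good_def)
    from r consider "hor x y" | "p x = p y" "\<forall>(x, y) \<in> set (steps (us @ [x])). p x = p y" by blast
    then show ?l
    proof cases
      case 1
      then show ?thesis unfolding good_def st using *
        by (intro exI[of _ As] exI[of _ "Bs @ [(x, y)]"]) auto
    next
      case 2
      then show ?thesis unfolding good_def st
        by (intro exI[of _ "steps (us @ [x]) @ [(x, y)]"] exI[of _ "[]"]) auto
    qed
  }
qed

lemma good_stepD: "good (us @ x # y # ws) \<Longrightarrow> p x = p y \<or> hor x y"
  using good_prefix[of "us @ [x, y]" ws] by (auto simp: good_snoc)

lemma good_no_corner:
  assumes "good (us @ x # y # z # ws)" "hor x y" shows "p y \<noteq> p z"
proof -
  have "good (us @ [x, y, z])" using good_prefix[of "us @ [x, y, z]" ws] assms by simp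
  then have "hor y z \<or> p y = p z \<and> p x = p y"
    using good_snoc[of "us @ [x]" y z] by (auto simp: steps_append_Cons)
  then show ?thesis using assms(2) by (auto simp: hor_def)
qed

text \<open>Subdividing a vertical or horizontal step keeps its type.  Read backwards, the faces
  of a tuple that is not good are not good.\<close>

lemma good_insert:
  assumes E: "x \<in> mspace E" "y \<in> mspace E" "z \<in> mspace E" and ne: "x \<noteq> y" "y \<noteq> z"
    and btw: "mdist E x z = mdist E x y + mdist E y z"
    and good: "good (us @ x # z # ws)"
  shows "good (us @ x # y # z # ws)"
proof -
  obtain As Bs where *: "steps (us @ x # z # ws) = As @ Bs" "\<forall>(x, y) \<in> set As. p x = p y" "\<forall>(x, y) \<in> set Bs. hor x y"
    using good by (auto simp: good_def)
  have st: "steps (us @ x # z # ws) = steps (us @ [x]) @ (x, z) # steps (z # ws)"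
    "steps (us @ x # y # z # ws) = steps (us @ [x]) @ (x, y) # (y, z) # steps (z # ws)"
    by (simp_all add: steps_append_Cons)
  have "(\<exists>us'. As = steps (us @ [x]) @ (x, z) # us' \<and> steps (z # ws) = us' @ Bs) \<or>
        (\<exists>us'. steps (us @ [x]) = As @ us' \<and> Bs = us' @ (x, z) # steps (z # ws))"
    using *(1) unfolding st by (auto simp: append_eq_append_conv2 Cons_eq_append_conv)
  then show ?thesis
  proof (elim disjE exE conjE)
    fix us' assume As: "As = steps (us @ [x]) @ (x, z) # us'" and w: "steps (z # ws) = us' @ Bs"
    have "p x = p z" using *(2) As by auto
    then have "p x = p y" "p y = p z" using between_same_fibre[OF E btw] by auto
    then show ?thesis unfolding good_def st w using *(2,3) As
      by (intro exI[of _ "steps (us @ [x]) @ (x, y) # (y, z) # us'"] exI[of _ Bs]) auto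
  next
    fix us' assume w: "steps (us @ [x]) = As @ us'" and Bs: "Bs = us' @ (x, z) # steps (z # ws)"
    have "hor x z" using *(3) Bs by auto
    then have "y = tr x (p y)" "z = tr y (p z)"
      using between_horizontal[OF E btw] by (auto simp: hor_def)
    moreover then have "p x \<noteq> p y" "p y \<noteq> p z" using ne E by (metis tr_self)+
    ultimately have "hor x y" "hor y z" by (auto simp: hor_def)
    then show ?thesis unfolding good_def st w using *(2,3) Bs
      by (intro exI[of _ As] exI[of _ "us' @ (x, y) # (y, z) # steps (z # ws)"]) auto
  qed
qed

definition bad_pos :: "'a list \<Rightarrow> nat" where
  "bad_pos xs = (LEAST k. \<not> good (take (Suc (Suc k)) xs))"

lemma bad_pos_eq:
  assumes "good (us @ [x])" "\<not> good (us @ [x, y])"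
  shows "bad_pos (us @ x # y # ws) = length us"
  unfolding bad_pos_def
proof (rule Least_equality)
  show "\<not> good (take (Suc (Suc (length us))) (us @ x # y # ws))" using assms by simp
  fix k assume k: "\<not> good (take (Suc (Suc k)) (us @ x # y # ws))"
  show "length us \<le> k"
  proof (rule ccontr)
    assume "\<not> length us \<le> k"
    then have *: "take (Suc (Suc k)) (us @ x # y # ws) = take (Suc (Suc k)) (us @ [x])"
      by (auto simp: take_Cons' )
    have "good (take (Suc (Suc k)) (us @ [x]))"
      using good_prefix[of "take (Suc (Suc k)) (us @ [x])" "drop (Suc (Suc k)) (us @ [x])"] assms(1)
      by (simp only: append_take_drop_id)
    then show False using k * by simp
  qed
qed

lemma bad_split:
  assumes "\<not> good xs"
  obtains us x y ws where "xs = us @ x # y # ws" "length us = bad_pos xs" "good (us @ [x])" "\<not> good (us @ [x, y])"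
proof -
  have "\<exists>us x y ws. xs = us @ x # y # ws \<and> good (us @ [x]) \<and> \<not> good (us @ [x, y])"
    using assms
  proof (induction xs rule: rev_induct)
    case (snoc y xs)
    show ?case
    proof (cases "good xs")
      case True
      then obtain us x where "xs = us @ [x]" using snoc.prems by (cases xs rule: rev_cases) auto
      then show ?thesis using True snoc.prems by (intro exI[of _ us] exI[of _ x] exI[of _ y] exI[of _ "[]"]) simp
    next
      case False
      then obtain us x y' ws where "xs = us @ x # y' # ws \<and> good (us @ [x]) \<and> \<not> good (us @ [x, y'])"
        using snoc.IH by blast
      then show ?thesis by (intro exI[of _ us] exI[of _ x] exI[of _ y'] exI[of _ "ws @ [y]"]) simp
    qed
  qed simp
  then show thesis using that bad_pos_eq by metis
qed

section \<open>Critical tuples\<close>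

text \<open>The horizontal lift of a path in the base, starting at \<open>x\<close>; the start is not included.\<close>

fun hlift :: "'a \<Rightarrow> 'b list \<Rightarrow> 'a list" where
  "hlift x [] = []"
| "hlift x (c # cs) = tr x c # hlift (tr x c) cs"

lemma length_hlift [simp]: "length (hlift x cs) = length cs"
  by (induction cs arbitrary: x) auto

lemma set_hlift: "x \<in> mspace E \<Longrightarrow> set cs \<subseteq> mspace B \<Longrightarrow> set (hlift x cs) \<subseteq> mspace E"
  by (induction cs arbitrary: x) auto

lemma map_p_hlift: "x \<in> mspace E \<Longrightarrow> set cs \<subseteq> mspace B \<Longrightarrow> map p (hlift x cs) = cs"
  by (induction cs arbitrary: x) auto

lemma path_length_hlift:
  "x \<in> mspace E \<Longrightarrow> set cs \<subseteq> mspace B \<Longrightarrow> path_length E (x # hlift x cs) = path_length B (p x # cs)"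
  by (induction cs arbitrary: x) (auto simp: mdist_tr)

lemma hor_hlift:
  "x \<in> mspace E \<Longrightarrow> set cs \<subseteq> mspace B \<Longrightarrow> \<forall>(c, d) \<in> set (steps (p x # cs)). c \<noteq> d \<Longrightarrow>
    \<forall>(y, z) \<in> set (steps (x # hlift x cs)). hor y z"
proof (induction cs arbitrary: x)
  case (Cons c cs)
  then show ?case using Cons.IH[of "tr x c"] by (auto simp: hor_def)
qed simp

lemma hlift_of_hor:
  "\<forall>(y, z) \<in> set (steps (x # ws)). hor y z \<Longrightarrow> hlift x (map p ws) = ws"
proof (induction ws arbitrary: x)
  case (Cons w ws)
  have w: "tr x (p w) = w" using Cons.prems by (auto simp: hor_def)
  have "hlift w (map p ws) = ws" using Cons.prems by (intro Cons.IH) simp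
  then show ?case using w by simp
qed simp

text \<open>A pair of a path in a fibre and a path in the base becomes a path in the total space: the
  fibre path is moved to the fibre over the start of the base path, and the base path is lifted
  from the end of the moved path.\<close>

definition emb :: "'a list \<times> 'b list \<Rightarrow> 'a list" where
  "emb q = (let fs = map (\<lambda>f. tr f (hd (snd q))) (fst q) in fs @ hlift (last fs) (tl (snd q)))"

lemma emb_snoc_Cons:
  "emb (fs @ [f], c # cs) = map (\<lambda>f. tr f c) fs @ tr f c # hlift (tr f c) cs"
  by (simp add: emb_def Let_def)

lemma steps_map: "steps (map g xs) = map (\<lambda>(x, y). (g x, g y)) (steps xs)"
  by (induction xs rule: induct_list012) auto

lemma path_length_map_tr:
  assumes "set fs \<subseteq> {x \<in> mspace E. p x = b}" "c \<in> mspace B"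
  shows "path_length E (map (\<lambda>f. tr f c) fs) = path_length E fs"
  using assms(1)
proof (induction fs rule: induct_list012)
  case (3 x y zs)
  have "mdist E (tr x c) (tr y c) = mdist E x y"
    using 3(3) assms(2) by (intro tr_isometry) auto
  moreover have "path_length E (map (\<lambda>f. tr f c) (y # zs)) = path_length E (y # zs)"
    using 3(3) by (intro 3(2)) auto
  ultimately show ?case by simp
qed simp_all

lemma inj_tr:
  assumes "x \<in> mspace E" "y \<in> mspace E" "p x = p y" "c \<in> mspace B" "tr x c = tr y c"
  shows "x = y"
  using tr_tr_back[OF assms(1,4)] tr_tr_back[OF assms(2,4)] unfolding assms(3,5) by (rule trans[OF sym])

end

locale pointed_metric_fibration = fibred_metric +
  fixes b :: 'b
  assumes b [simp]: "b \<in> mspace B"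
begin

abbreviation F where "F \<equiv> metric_fiber E p b"

lemma path_length_F [simp]: "path_length F = path_length E"
  by (simp add: path_length_def fun_eq_iff)

definition pairs :: "real \<Rightarrow> nat \<Rightarrow> ('a list \<times> 'b list) set" where
  "pairs l n = {(fs, bs). \<exists>i j lv lh. i + j = n \<and> lv + lh = l \<and>
     fs \<in> magnitude_tuples F lv i \<and> bs \<in> magnitude_tuples B lh j}"

lemma pairs_iff:
  "(fs, bs) \<in> pairs l n \<longleftrightarrow> fs \<noteq> [] \<and> bs \<noteq> [] \<and> length fs + length bs = Suc (Suc n) \<and>
     set fs \<subseteq> {x \<in> mspace E. p x = b} \<and> set bs \<subseteq> mspace B \<and>
     (\<forall>(x, y) \<in> set (steps fs). x \<noteq> y) \<and> (\<forall>(x, y) \<in> set (steps bs). x \<noteq> y) \<and>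
     path_length E fs + path_length B bs = l"
  (is "_ \<longleftrightarrow> ?r")
proof
  assume "(fs, bs) \<in> pairs l n" then show ?r
    by (auto simp: pairs_def magnitude_tuples_iff mspace_fiber)
next
  assume ?r
  then show "(fs, bs) \<in> pairs l n"
    unfolding pairs_def
    by (simp add: magnitude_tuples_iff mspace_fiber)
      (rule exI[of _ "length fs - 1"], rule exI[of _ "length bs - 1"], cases fs; cases bs; auto)
qed

text \<open>The boundary of a tensor product of basis elements, where the first factor has degree
  \<open>length fs - 1\<close>.\<close>

definition pair_face_sum :: "'a list \<times> 'b list \<Rightarrow> ('a list \<times> 'b list \<Rightarrow>\<^sub>0 int)" where
  "pair_face_sum = (\<lambda>(fs, bs).
     (\<Sum>i \<in> faces F fs. frag_cmul ((-1) ^ i) (frag_of (del i fs, bs))) +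
     (\<Sum>j \<in> faces B bs. frag_cmul ((-1) ^ (length fs - 1 + j)) (frag_of (fs, del j bs))))"

lemma pairsE:
  assumes "(fs, bs) \<in> pairs l n"
  obtains us f c cs where "fs = us @ [f]" "bs = c # cs" "set us \<subseteq> mspace E" "f \<in> mspace E" "p f = b"
    "\<And>u. u \<in> set us \<Longrightarrow> p u = b" "c \<in> mspace B" "set cs \<subseteq> mspace B"
    "tr f c \<in> mspace E" "p (tr f c) = c"
proof -
  obtain us f where fs: "fs = us @ [f]" using assms by (cases fs rule: rev_cases) (auto simp: pairs_iff)
  obtain c cs where bs: "bs = c # cs" using assms by (cases bs) (auto simp: pairs_iff)
  show thesis using assms by (intro that[OF fs bs]) (auto simp: pairs_iff fs bs)
qed

lemma steps_emb:
  "steps (emb (us @ [f], c # cs)) = steps (map (\<lambda>f. tr f c) (us @ [f])) @ steps (tr f c # hlift (tr f c) cs)"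
  unfolding emb_snoc_Cons by (subst steps_append) simp

lemma ver_tr:
  assumes "(fs, bs) \<in> pairs l n" "c \<in> mspace B"
  shows "\<forall>(x, y) \<in> set (steps (map (\<lambda>f. tr f c) fs)). p x = p y \<and> x \<noteq> y"
proof -
  have "p (tr x c) = p (tr y c) \<and> tr x c \<noteq> tr y c" if xy: "(x, y) \<in> set (steps fs)" for x y
  proof -
    have "x \<noteq> y" using xy assms(1) unfolding pairs_iff by blast
    moreover have "x \<in> mspace E" "y \<in> mspace E" "p x = p y"
      using xy set_steps_subset[of fs] assms(1) unfolding pairs_iff by blast+
    ultimately show ?thesis using assms(2) inj_tr[of x y c] by auto
  qed
  then show ?thesis unfolding steps_map by fastforce
qed

lemma path_length_emb:
  assumes "set us \<subseteq> {x \<in> mspace E. p x = b}" "f \<in> mspace E" "p f = b" "c \<in> mspace B" "set cs \<subseteq> mspace B"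
  shows "path_length E (emb (us @ [f], c # cs)) = path_length E (us @ [f]) + path_length B (c # cs)"
proof -
  have "path_length E (emb (us @ [f], c # cs)) =
      path_length E (map (\<lambda>f. tr f c) (us @ [f])) + path_length E (tr f c # hlift (tr f c) cs)"
    unfolding path_length_def steps_emb by simp
  also have "path_length E (map (\<lambda>f. tr f c) (us @ [f])) = path_length E (us @ [f])"
    using assms by (intro path_length_map_tr[of _ b]) auto
  also have "path_length E (tr f c # hlift (tr f c) cs) = path_length B (c # cs)"
    using path_length_hlift[of "tr f c" cs] assms by simp
  finally show ?thesis .
qed

lemma emb_in:
  assumes q: "q \<in> pairs l n" shows "emb q \<in> magnitude_tuples E l n" and "good (emb q)"
proof -
  obtain fs bs where qq: "q = (fs, bs)" by (cases q)
  obtain us f c cs where *: "fs = us @ [f]" "bs = c # cs" "set us \<subseteq> mspace E" "f \<in> mspace E" "p f = b"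
    "\<And>u. u \<in> set us \<Longrightarrow> p u = b" "c \<in> mspace B" "set cs \<subseteq> mspace B"
    "tr f c \<in> mspace E" "p (tr f c) = c" by (rule pairsE[OF q[unfolded qq]]) blast
  note q' = q[unfolded qq * pairs_iff]
  have v: "\<forall>(x, y) \<in> set (steps (map (\<lambda>f. tr f c) (us @ [f]))). p x = p y \<and> x \<noteq> y"
    by (rule ver_tr[OF q[unfolded qq *] *(7)])
  have h: "\<forall>(x, y) \<in> set (steps (tr f c # hlift (tr f c) cs)). hor x y"
    using hor_hlift[OF *(9,8)] q' unfolding *(10) by blast
  show "good (emb q)"
    unfolding good_def qq *(1,2) steps_emb using v h by blast
  have "\<forall>(x, y) \<in> set (steps (emb q)). x \<noteq> y"
    unfolding qq *(1,2) steps_emb using v h by (auto simp: hor_def)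
  moreover have "path_length E (emb q) = l"
    unfolding qq *(1,2) using path_length_emb[of us f c cs] * q' by simp
  moreover have "set (emb q) \<subseteq> mspace E"
    unfolding qq *(1,2) emb_snoc_Cons using * set_hlift[OF *(9,8)] by auto
  moreover have "length (emb q) = Suc n"
    unfolding qq *(1,2) emb_snoc_Cons using q' by simp
  ultimately show "emb q \<in> magnitude_tuples E l n"
    by (simp add: magnitude_tuples_iff)
qed

definition vsteps :: "'a list \<Rightarrow> nat" where
  "vsteps xs = length (filter (\<lambda>(x, y). p x = p y) (steps xs))"

text \<open>The inverse of the embedding on good tuples.  The number of vertical steps locates the last
  point of the vertical part, which is also the first point of the horizontal part.\<close>

definition unemb :: "'a list \<Rightarrow> 'a list \<times> 'b list" where
  "unemb xs = (map (\<lambda>x. tr x b) (take (Suc (vsteps xs)) xs), map p (drop (vsteps xs) xs))"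

lemma vsteps_emb:
  assumes "(fs, bs) \<in> pairs l n" shows "vsteps (emb (fs, bs)) = length fs - 1"
proof -
  obtain us f c cs where *: "fs = us @ [f]" "bs = c # cs" "set us \<subseteq> mspace E" "f \<in> mspace E" "p f = b"
    "\<And>u. u \<in> set us \<Longrightarrow> p u = b" "c \<in> mspace B" "set cs \<subseteq> mspace B"
    "tr f c \<in> mspace E" "p (tr f c) = c" by (rule pairsE[OF assms]) blast
  have "filter (\<lambda>(x, y). p x = p y) (steps (map (\<lambda>f. tr f c) (us @ [f]))) = steps (map (\<lambda>f. tr f c) (us @ [f]))"
    using ver_tr[OF assms *(7)] unfolding * by (auto simp: filter_id_conv)
  moreover have "filter (\<lambda>(x, y). p x = p y) (steps (tr f c # hlift (tr f c) cs)) = []"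
    using hor_hlift[OF *(9,8)] assms unfolding * *(10) pairs_iff by (fastforce simp: filter_empty_conv hor_def)
  ultimately show ?thesis unfolding vsteps_def *(1,2) steps_emb by simp
qed

lemma unemb_emb:
  assumes "q \<in> pairs l n" shows "unemb (emb q) = q"
proof -
  obtain fs bs where q: "q = (fs, bs)" by (cases q)
  obtain us f c cs where *: "fs = us @ [f]" "bs = c # cs" "set us \<subseteq> mspace E" "f \<in> mspace E" "p f = b"
    "\<And>u. u \<in> set us \<Longrightarrow> p u = b" "c \<in> mspace B" "set cs \<subseteq> mspace B"
    "tr f c \<in> mspace E" "p (tr f c) = c" by (rule pairsE[OF assms[unfolded q]]) blast
  have v: "vsteps (emb q) = length us" using vsteps_emb assms * q by simp
  have "tr (tr f c) b = f" using tr_tr_back[of f c] * by simp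
  moreover have "map (\<lambda>x. tr (tr x c) b) us = us"
  proof (rule map_idI)
    fix u assume "u \<in> set us"
    then show "tr (tr u c) b = u" using tr_tr_back[of u c] *(3,6,7) by auto
  qed
  ultimately show ?thesis
    unfolding unemb_def v unfolding q *(1,2) emb_snoc_Cons
    using map_p_hlift[OF *(9,8)] *(10) by (simp add: comp_def)
qed

lemma emb_unemb:
  assumes xs: "xs \<in> magnitude_tuples E l n" and "good xs"
  shows "unemb xs \<in> pairs l n" "emb (unemb xs) = xs"
proof -
  obtain As Bs where AB: "steps xs = As @ Bs" "\<forall>(x, y) \<in> set As. p x = p y" "\<forall>(x, y) \<in> set Bs. hor x y"
    using \<open>good xs\<close> by (auto simp: good_def)
  have len: "length xs = Suc n" and sub: "set xs \<subseteq> mspace E" and ne: "\<forall>(x, y) \<in> set (steps xs). x \<noteq> y"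
    and pl: "path_length E xs = l" using xs by (auto simp: magnitude_tuples_iff)
  define us where "us = take (length As) xs"
  have "length As < length xs" using arg_cong[OF AB(1), of length] len by simp
  then obtain x ws where x: "xs = us @ x # ws" and lus: "length us = length As"
    unfolding us_def by (metis id_take_nth_drop length_take min.absorb2 min.commute nat_less_le)
  have st: "steps (us @ [x]) @ steps (x # ws) = As @ Bs" using AB(1) steps_append[of us x ws] x by simp
  then have sA: "steps (us @ [x]) = As" and sB: "steps (x # ws) = Bs"
    using lus by (auto dest: append_eq_append_conv[THEN iffD1, rotated])
  have v: "vsteps xs = length us"
  proof -
    have "filter (\<lambda>(x, y). p x = p y) As = As" using AB(2) by (auto simp: filter_id_conv)
    moreover have "filter (\<lambda>(x, y). p x = p y) Bs = []"
      using AB(3) by (fastforce simp: filter_empty_conv hor_def)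
    ultimately show ?thesis unfolding vsteps_def AB(1) lus by simp
  qed
  have un: "unemb xs = (map (\<lambda>y. tr y b) us @ [tr x b], p x # map p ws)"
    unfolding unemb_def v unfolding x by simp
  have fib: "p u = p x" if "u \<in> set us" for u
  proof -
    have "\<forall>(x, y) \<in> set (steps (us @ [x])). p x = p y" using AB(2) sA by simp
    then show ?thesis using that
    proof (induction us arbitrary: u)
      case (Cons a us)
      then show ?case by (cases us) auto
    qed simp
  qed
  have E: "x \<in> mspace E" "set us \<subseteq> mspace E" "set ws \<subseteq> mspace E" using sub x by auto
  have ret: "tr (tr u b) (p x) = u" if "u \<in> set us" for u
    using tr_tr_back[of u b] that E fib[OF that] by auto
  have "tr (tr x b) (p x) = x" using tr_tr_back[of x b] E by simp
  moreover have "hlift x (map p ws) = ws" using hlift_of_hor AB(3) sB by simp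
  moreover have "map (\<lambda>u. tr (tr u b) (p x)) us = us" by (rule map_idI) (rule ret)
  ultimately show 1: "emb (unemb xs) = xs"
    unfolding un emb_snoc_Cons by (simp add: x comp_def)
  have hor: "\<forall>(y, z) \<in> set (steps (p x # map p ws)). y \<noteq> z"
  proof -
    have "\<forall>(y, z) \<in> set (steps (map p (x # ws))). y \<noteq> z"
      unfolding steps_map sB using AB(3) by (auto simp: hor_def)
    then show ?thesis by simp
  qed
  have ver: "\<forall>(y, z) \<in> set (steps (map (\<lambda>y. tr y b) (us @ [x]))). y \<noteq> z"
  proof -
    have "tr y b \<noteq> tr z b" if yz: "(y, z) \<in> set (steps (us @ [x]))" for y z
    proof -
      have "y \<in> mspace E" "z \<in> mspace E" "p y = p z"
        using set_steps_subset[of "us @ [x]"] yz E fib by auto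
      moreover have "y \<noteq> z" using ne yz unfolding AB(1) sA[symmetric] by auto
      ultimately show ?thesis using inj_tr[of y z b] by auto
    qed
    then show ?thesis unfolding steps_map by auto
  qed
  have "path_length E xs = path_length E (us @ [x]) + path_length E (x # ws)"
    unfolding x by (rule path_length_append)
  also have "path_length E (x # ws) = path_length B (p x # map p ws)"
  proof -
    have "set (map p ws) \<subseteq> mspace B" using E by auto
    from path_length_hlift[OF E(1) this] show ?thesis
      using hlift_of_hor[of x ws] AB(3) sB by simp
  qed
  also have "path_length E (us @ [x]) = path_length E (map (\<lambda>y. tr y b) (us @ [x]))"
    using E fib by (intro path_length_map_tr[of _ "p x", symmetric]) auto
  finally have pl': "path_length E (map (\<lambda>y. tr y b) us @ [tr x b]) + path_length B (p x # map p ws) = l"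
    using pl by simp
  show "unemb xs \<in> pairs l n"
    unfolding un pairs_iff
  proof (intro conjI)
    show "length (map (\<lambda>y. tr y b) us @ [tr x b]) + length (p x # map p ws) = Suc (Suc n)"
      using len x by simp
    show "set (map (\<lambda>y. tr y b) us @ [tr x b]) \<subseteq> {x \<in> mspace E. p x = b}"
      using E by auto
    show "set (p x # map p ws) \<subseteq> mspace B" using E by auto
    show "\<forall>(y, z) \<in> set (steps (map (\<lambda>y. tr y b) us @ [tr x b])). y \<noteq> z" using ver by simp
    show "\<forall>(y, z) \<in> set (steps (p x # map p ws)). y \<noteq> z" by (rule hor)
    show "path_length E (map (\<lambda>y. tr y b) us @ [tr x b]) + path_length B (p x # map p ws) = l" by (rule pl')
  qed simp_all
qed

lemma inj_emb: "inj_on emb (pairs l n)"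
  by (rule inj_on_inverseI[of _ unemb]) (rule unemb_emb)

lemma noncritical_iff:
  "xs \<in> magnitude_tuples E l n - emb ` pairs l n \<longleftrightarrow> xs \<in> magnitude_tuples E l n \<and> \<not> good xs"
proof -
  have "xs \<in> emb ` pairs l n \<longleftrightarrow> xs \<in> magnitude_tuples E l n \<and> good xs"
  proof
    assume "xs \<in> emb ` pairs l n"
    then show "xs \<in> magnitude_tuples E l n \<and> good xs" by (auto intro: emb_in)
  next
    assume "xs \<in> magnitude_tuples E l n \<and> good xs"
    then have "unemb xs \<in> pairs l n" "emb (unemb xs) = xs" using emb_unemb[of xs l n] by auto
    then show "xs \<in> emb ` pairs l n" by force
  qed
  then show ?thesis by blast
qed

end

context fibred_metric
begin

text \<open>This is the only way in which a face can be good: the merged step comes from two vertical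
  steps, or from two horizontal ones over a geodesic.\<close>

lemma good_merge:
  assumes E: "x \<in> mspace E" "y \<in> mspace E" "z \<in> mspace E" and ne: "x \<noteq> y" "y \<noteq> z"
    and btw: "mdist E x z = mdist E x y + mdist E y z"
    and good: "good (us @ x # z # ws)"
  shows "(p x = p y \<and> p y = p z) \<or>
    (hor x y \<and> hor y z \<and> mdist B (p x) (p z) = mdist B (p x) (p y) + mdist B (p y) (p z))"
  using good_stepD[OF good]
proof
  assume "p x = p z"
  then show ?thesis using between_same_fibre[OF E btw] by auto
next
  assume "hor x z"
  then have z: "z = tr x (p z)" by (simp add: hor_def)
  note h = between_horizontal[OF E btw z]
  have "p x \<noteq> p y" using h(1) ne(1) E(1) by (metis tr_self)
  moreover have "p y \<noteq> p z" using h(2) ne(2) E(2) by (metis tr_self)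
  ultimately show ?thesis using h by (simp add: hor_def)
qed

lemma del_Cons [simp]: "del (Suc n) (y # ys) = y # del n ys"
  and del_0_Cons [simp]: "del 0 (y # ys) = ys"
  by (simp_all add: del_def)

lemma del_append_left: "i < length us \<Longrightarrow> del i (us @ ws) = del i us @ ws"
  by (simp add: del_def)

lemma del_append_right: "del (length us + i) (us @ ws) = us @ del i ws"
  by (simp add: del_def)

text \<open>Transport is functorial along geodesics, so the lift does not change behind the deleted
  point.\<close>

lemma hlift_del:
  assumes "x \<in> mspace E" "set (as @ b # d # ws) \<subseteq> mspace B"
    and "mdist B (last (p x # as)) d = mdist B (last (p x # as)) b + mdist B b d"
  shows "del (length as) (hlift x (as @ b # d # ws)) = hlift x (as @ d # ws)"
  using assms
proof (induction as arbitrary: x)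
  case Nil
  then have "tr (tr x b) d = tr x d" by (intro tr_tr_between) auto
  then show ?case by simp
next
  case (Cons a as)
  then have "last (p (tr x a) # as) = last (p x # a # as)" by simp
  with Cons show ?case using Cons.IH[of "tr x a"] by simp
qed

text \<open>The first step at which a tuple ceases to be good is either tilted, or vertical after a
  horizontal one.  This distinguishes the lower cells from the upper cells of the matching, and
  the matching replaces the tilted step by a corner.\<close>

definition lower :: "'a list set" where
  "lower = {xs. \<not> good xs \<and> (let x = xs ! bad_pos xs; y = xs ! Suc (bad_pos xs) in p x \<noteq> p y \<and> y \<noteq> tr x (p y))}"

definition upper :: "'a list set" where
  "upper = {xs. \<not> good xs \<and> p (xs ! bad_pos xs) = p (xs ! Suc (bad_pos xs))}"

definition insert_corner :: "'a list \<Rightarrow> 'a list" where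
  "insert_corner xs = (let k = bad_pos xs in
     take (Suc k) xs @ tr (xs ! k) (p (xs ! Suc k)) # drop (Suc k) xs)"

lemma lower_or_upper:
  assumes "\<not> good xs" shows "xs \<in> lower \<or> xs \<in> upper"
proof -
  obtain us x y ws where xs: "xs = us @ x # y # ws" "length us = bad_pos xs" "good (us @ [x])" "\<not> good (us @ [x, y])"
    using bad_split[OF assms] .
  have "\<not> hor x y" using xs(3,4) good_snoc by blast
  moreover have "xs ! bad_pos xs = x" "xs ! Suc (bad_pos xs) = y"
    unfolding xs(2)[symmetric] unfolding xs(1) by (simp_all add: nth_append)
  ultimately show ?thesis using assms by (auto simp: lower_def upper_def hor_def)
qed

lemma lower_split:
  assumes "xs \<in> lower"
  obtains us x y ws where "xs = us @ x # y # ws" "bad_pos xs = length us" "good (us @ [x])"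
    "p x \<noteq> p y" "y \<noteq> tr x (p y)" "insert_corner xs = us @ x # tr x (p y) # y # ws"
proof -
  have "\<not> good xs" using assms by (simp add: lower_def)
  then obtain us x y ws where xs: "xs = us @ x # y # ws" "length us = bad_pos xs" "good (us @ [x])" "\<not> good (us @ [x, y])"
    by (rule bad_split)
  have n: "xs ! bad_pos xs = x" "xs ! Suc (bad_pos xs) = y"
    unfolding xs(2)[symmetric] unfolding xs(1) by (simp_all add: nth_append)
  have "insert_corner xs = us @ x # tr x (p y) # y # ws"
    unfolding insert_corner_def Let_def n unfolding xs(2)[symmetric] unfolding xs(1) by simp
  moreover have "p x \<noteq> p y" "y \<noteq> tr x (p y)" using assms n by (simp_all add: lower_def Let_def)
  ultimately show thesis using that xs by metis
qed

lemma lowerI: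
  assumes "good (us @ [x])" "p x \<noteq> p y" "y \<noteq> tr x (p y)"
  shows "us @ x # y # ws \<in> lower"
    and "insert_corner (us @ x # y # ws) = us @ x # tr x (p y) # y # ws"
proof -
  have ng: "\<not> good (us @ [x, y])" using assms by (auto simp: good_snoc hor_def)
  then have g: "\<not> good (us @ x # y # ws)" using good_prefix[of "us @ [x, y]" ws] by auto
  have pos: "bad_pos (us @ x # y # ws) = length us" by (rule bad_pos_eq[OF assms(1) ng])
  show "us @ x # y # ws \<in> lower"
    using g assms(2,3) unfolding lower_def Let_def by (simp add: pos nth_append)
  show "insert_corner (us @ x # y # ws) = us @ x # tr x (p y) # y # ws"
    unfolding insert_corner_def Let_def pos by (simp add: nth_append)
qed

lemma upperI:
  assumes "good (us @ [x, c])" "hor x c" "p c = p y"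
  shows "us @ x # c # y # ws \<in> upper"
proof -
  have ng: "\<not> good ((us @ [x]) @ [c, y])" using good_no_corner[of us x c y "[]"] assms by auto
  then have g: "\<not> good (us @ x # c # y # ws)" using good_prefix[of "us @ [x, c, y]" ws] by auto
  have pos: "bad_pos ((us @ [x]) @ c # y # ws) = length (us @ [x])"
    by (rule bad_pos_eq[OF _ ng]) (use assms in simp)
  then show ?thesis
    using g assms(3) by (simp add: upper_def nth_append)
qed

lemma good_insert_prefix:
  assumes "x \<in> mspace E" "y \<in> mspace E" "good (us @ [x])" "p x \<noteq> p y"
  shows "good (us @ [x, tr x (p y)])" "hor x (tr x (p y))"
  using assms by (simp_all add: good_snoc hor_def)

text \<open>Every upper cell arises from a lower one: removing the point at its first corner
  leaves a tilted step there.\<close>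

lemma upper_split:
  assumes "xs \<in> upper" "set xs \<subseteq> mspace E" "\<forall>(x, y) \<in> set (steps xs). x \<noteq> y"
  obtains us x y ws where "xs = us @ x # tr x (p y) # y # ws" "good (us @ [x])"
    "p x \<noteq> p y" "y \<noteq> tr x (p y)"
proof -
  have ng: "\<not> good xs" using assms by (simp add: upper_def)
  then obtain vs x y ws where xs: "xs = vs @ x # y # ws" "length vs = bad_pos xs" "good (vs @ [x])" "\<not> good (vs @ [x, y])"
    by (rule bad_split)
  have n: "xs ! bad_pos xs = x" "xs ! Suc (bad_pos xs) = y"
    unfolding xs(2)[symmetric] unfolding xs(1) by (simp_all add: nth_append)
  have pxy: "p x = p y" using assms(1) n by (simp add: upper_def)
  have nv: "\<not> (\<forall>(x, y) \<in> set (steps (vs @ [x])). p x = p y)" using xs(3,4) pxy by (auto simp: good_snoc)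
  then obtain us w where vs: "vs = us @ [w]" by (cases vs rule: rev_cases) auto
  have "good (us @ [w, x])" using xs(3) vs by simp
  then have *: "good (us @ [w])" "hor w x \<or> p w = p x \<and> (\<forall>(x, y) \<in> set (steps (us @ [w])). p x = p y)"
    using good_snoc[of us w x] by blast+
  have "steps (vs @ [x]) = steps (us @ [w]) @ [(w, x)]" using vs by (simp add: steps_append_Cons)
  then have "hor w x" using *(2) nv by auto
  then have "p w \<noteq> p y" "tr w (p y) = x" using pxy by (auto simp: hor_def)
  moreover have "x \<noteq> y" using assms(3) xs(1) by (simp add: steps_append_Cons)
  ultimately show thesis
    using that[of us w y ws] *(1) xs(1) vs by simp
qed

lemma insert_corner_tuple:
  assumes xs: "us @ x # y # ws \<in> magnitude_tuples E l n" and "p x \<noteq> p y" "y \<noteq> tr x (p y)"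
  shows "us @ x # tr x (p y) # y # ws \<in> magnitude_tuples E l (Suc n)"
proof -
  have sub: "x \<in> mspace E" "y \<in> mspace E" "set us \<subseteq> mspace E" "set ws \<subseteq> mspace E"
    using xs by (auto simp: magnitude_tuples_iff)
  have "x \<noteq> tr x (p y)"
  proof
    assume "x = tr x (p y)"
    then have "p x = p (tr x (p y))" by simp
    then show False using sub assms(2) by simp
  qed
  moreover have "path_length E (us @ x # tr x (p y) # y # ws) = path_length E (us @ x # y # ws)"
    using mdist_split[OF sub(1,2)] mdist_tr[of x "p y"] sub
    by (simp add: path_length_def steps_append_Cons)
  ultimately show ?thesis
    using xs sub assms(3) by (auto simp: magnitude_tuples_iff steps_append_Cons)
qed

lemma corner_removed_tuple:
  assumes xs: "us @ x # tr x (p y) # y # ws \<in> magnitude_tuples E l n" and "p x \<noteq> p y" "y \<noteq> tr x (p y)"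
  obtains m where "n = Suc m" "us @ x # y # ws \<in> magnitude_tuples E l m"
    "Suc (length us) \<in> faces E (us @ x # tr x (p y) # y # ws)"
proof -
  have sub: "x \<in> mspace E" "y \<in> mspace E" "set us \<subseteq> mspace E" "set ws \<subseteq> mspace E"
    using xs by (auto simp: magnitude_tuples_iff)
  have pl: "path_length E (us @ x # tr x (p y) # y # ws) = path_length E (us @ x # y # ws)"
    using mdist_split[OF sub(1,2)] mdist_tr[of x "p y"] sub
    by (simp add: path_length_def steps_append_Cons)
  obtain m where m: "n = Suc m" using xs by (cases n) (auto simp: magnitude_tuples_iff)
  have "x \<noteq> y" using assms(2) by auto
  then have "us @ x # y # ws \<in> magnitude_tuples E l m"
    using xs sub pl m by (auto simp: magnitude_tuples_iff steps_append_Cons)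
  then show thesis using m pl
    by (intro that) (auto simp: faces_def del_append)
qed

text \<open>Acyclicity of the matching.  A face that does not merge a corner is smaller than the upper
  cell, which has the same measure as its lower partner.  A face that merges a corner other than
  the first one leaves the first one in place and is therefore upper.\<close>

lemma face_of_upper:
  assumes V: "us @ x # tr x (p y) # y # ws \<in> magnitude_tuples E l n"
    and good: "good (us @ [x])" and xy: "p x \<noteq> p y" "y \<noteq> tr x (p y)"
    and i: "i \<in> faces E (us @ x # tr x (p y) # y # ws)" "i \<noteq> Suc (length us)"
  shows "del i (us @ x # tr x (p y) # y # ws) \<in> upper \<or>
    (del i (us @ x # tr x (p y) # y # ws), us @ x # y # ws) \<in> step_order"
proof -
  let ?V = "us @ x # tr x (p y) # y # ws"
  let ?c = "tr x (p y)"
  have sub: "set ?V \<subseteq> mspace E" and ne: "\<forall>(x, y) \<in> set (steps ?V). x \<noteq> y"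
    using V unfolding magnitude_tuples_iff by blast+
  have E: "x \<in> mspace E" "y \<in> mspace E" using sub by auto
  note gc = good_insert_prefix[OF E good xy(1)]
  have "1 \<le> i" "Suc i < length ?V" using i(1) unfolding faces_def by blast+
  then obtain us' x' y' z' ws' where *: "?V = us' @ x' # y' # z' # ws'" "i = Suc (length us')"
    "del i ?V = us' @ x' # z' # ws'" "x' = ?V ! (i - 1)" "y' = ?V ! i" "z' = ?V ! (i + 1)"
    by (rule inner_index_split)
  have E': "x' \<in> mspace E" "y' \<in> mspace E" "z' \<in> mspace E" using sub unfolding *(1) by auto
  have ne': "x' \<noteq> y'" "y' \<noteq> z'" using ne unfolding *(1) steps_append_Cons by auto
  have btw: "mdist E x' z' = mdist E x' y' + mdist E y' z'"
    using i(1) path_length_del[OF *(1), of E] unfolding faces_def *(3)[symmetric] by simp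
  show ?thesis
  proof (cases "hor x' y' \<and> p y' = p z'")
    case False
    have "(del i ?V, ?V) \<in> step_order"
      unfolding *(3) unfolding *(1) by (rule face_decreases[OF E' ne' btw False])
    then show ?thesis
      using step_measure_insert[OF E xy, of us ws] by (simp add: step_order_def)
  next
    case True
    consider "i \<le> length us" | "i = Suc (Suc (length us))" | "length us + 3 \<le> i" using i(2) by linarith
    then show ?thesis
    proof cases
      (* The merged corner would lie inside the good prefix, which contains none. *)
      case 1
      have "take (length us + 2) ?V = us @ [x, ?c]" by simp
      moreover have "take (length us + 2) ?V = us' @ x' # y' # z' # take (length us - Suc (length us')) ws'"
        unfolding *(1) using 1 *(2) by (simp add: take_Cons' Suc_diff_Suc)
      ultimately have "good (us' @ x' # y' # z' # take (length us - Suc (length us')) ws')" using gc(1) by simp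
      then show ?thesis using good_no_corner True by blast
    next
      (* The step that follows the inserted point is vertical, so no corner starts with it. *)
      case 2
      then have "x' = ?c" "y' = y" unfolding *(4,5) by (simp_all add: nth_append)
      then show ?thesis using True E by (simp add: hor_def)
    next
      (* The deletion takes place behind the first corner. *)
      case 3
      have "take (length us + 3) (del i ?V) = take (length us + 3) ?V"
        using 3 by (simp add: del_def)
      then have "del i ?V = us @ x # ?c # y # drop (length us + 3) (del i ?V)"
        using append_take_drop_id[of "length us + 3" "del i ?V"] by simp
      moreover have "us @ x # ?c # y # drop (length us + 3) (del i ?V) \<in> upper"
        by (rule upperI[OF gc]) (use E in simp)
      ultimately show ?thesis by simp
    qed
  qed
qed

end

context pointed_metric_fibration
begin

section \<open>The chain equivalence with the complex of pairs\<close>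

lemma del_in_pairs:
  assumes q: "(fs, bs) \<in> pairs l (Suc n)"
  shows "i \<in> faces F fs \<Longrightarrow> (del i fs, bs) \<in> pairs l n"
    and "j \<in> faces B bs \<Longrightarrow> (fs, del j bs) \<in> pairs l n"
proof -
  obtain k m lv lh where *: "k + m = Suc n" "lv + lh = l"
    "fs \<in> magnitude_tuples F lv k" "bs \<in> magnitude_tuples B lh m"
    using q unfolding pairs_def by blast
  {
    assume i: "i \<in> faces F fs"
    then have "2 < length fs" unfolding faces_def by auto
    then obtain k' where k: "k = Suc k'" using *(3) by (cases k) (auto simp: magnitude_tuples_iff)
    then have "del i fs \<in> magnitude_tuples F lv k'"
      using *(3) i by (intro del_in_magnitude_tuples) auto
    moreover have "k' + m = n" using *(1) k by simp
    ultimately show "(del i fs, bs) \<in> pairs l n"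
      unfolding pairs_def using *(2,4) by blast
  }
  {
    assume j: "j \<in> faces B bs"
    then have "2 < length bs" unfolding faces_def by auto
    then obtain m' where m: "m = Suc m'" using *(4) by (cases m) (auto simp: magnitude_tuples_iff)
    then have "del j bs \<in> magnitude_tuples B lh m'"
      using *(4) j by (intro del_in_magnitude_tuples) auto
    moreover have "k + m' = n" using *(1) m by simp
    ultimately show "(fs, del j bs) \<in> pairs l n"
      unfolding pairs_def using *(2,3) by blast
  }
qed

lemma keys_pair_face_sum:
  assumes "q \<in> pairs l (Suc n)"
  shows "Poly_Mapping.keys (pair_face_sum q) \<subseteq> pairs l n"
proof -
  obtain fs bs where q: "q = (fs, bs)" by (cases q)
  show ?thesis
    unfolding q pair_face_sum_def prod.case using assms[unfolded q]
    by (intro keys_add_subset keys_sum_subset keys_cmul_subset) (simp_all add: del_in_pairs)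
qed

lemma pair_face_sum_0:
  assumes "q \<in> pairs l 0"
  shows "pair_face_sum q = 0"
proof -
  obtain fs bs where q: "q = (fs, bs)" by (cases q)
  have "length fs < 2" "length bs < 2"
    using assms unfolding q pairs_def by (auto simp: magnitude_tuples_iff)
  then have "faces F fs = {}" "faces B bs = {}" unfolding faces_def by auto
  then show ?thesis by (simp add: q pair_face_sum_def)
qed

lemma face_emb_vertical:
  assumes q: "(fs, bs) \<in> pairs l (Suc n)" and i: "i \<in> faces F fs"
  shows "i \<in> faces E (emb (fs, bs))" "del i (emb (fs, bs)) = emb (del i fs, bs)"
proof -
  obtain us f c cs where *: "fs = us @ [f]" "bs = c # cs" "set us \<subseteq> mspace E" "f \<in> mspace E" "p f = b"
    "\<And>u. u \<in> set us \<Longrightarrow> p u = b" "c \<in> mspace B" "set cs \<subseteq> mspace B"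
    "tr f c \<in> mspace E" "p (tr f c) = c" by (rule pairsE[OF q]) blast
  have "1 \<le> i" "i < length us" using i unfolding faces_def *(1) by auto
  then show del: "del i (emb (fs, bs)) = emb (del i fs, bs)"
    unfolding * by (simp add: del_append_left emb_snoc_Cons) (simp add: del_def take_map drop_map)
  have "path_length E (emb (del i fs, bs)) = l" "path_length E (emb (fs, bs)) = l"
    using emb_in(1)[OF del_in_pairs(1)[OF q i]] emb_in(1)[OF q] by (simp_all add: magnitude_tuples_iff)
  moreover have "Suc i < length (emb (fs, bs))"
    using \<open>i < length us\<close> unfolding * emb_snoc_Cons by simp
  ultimately show "i \<in> faces E (emb (fs, bs))"
    using \<open>1 \<le> i\<close> del by (simp add: faces_def)
qed

lemma face_emb_horizontal:
  assumes q: "(fs, bs) \<in> pairs l (Suc n)" and j: "j \<in> faces B bs"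
  shows "length fs - 1 + j \<in> faces E (emb (fs, bs))"
    "del (length fs - 1 + j) (emb (fs, bs)) = emb (fs, del j bs)"
proof -
  obtain us f c cs where *: "fs = us @ [f]" "bs = c # cs" "set us \<subseteq> mspace E" "f \<in> mspace E" "p f = b"
    "\<And>u. u \<in> set us \<Longrightarrow> p u = b" "c \<in> mspace B" "set cs \<subseteq> mspace B"
    "tr f c \<in> mspace E" "p (tr f c) = c" by (rule pairsE[OF q]) blast
  have j1: "1 \<le> j" "Suc j < length bs" using j unfolding faces_def by auto
  then obtain vs a d e ws where v: "bs = vs @ a # d # e # ws" "j = Suc (length vs)" "del j bs = vs @ a # e # ws"
    "a = bs ! (j - 1)" "d = bs ! j" "e = bs ! (j + 1)" by (rule inner_index_split)
  have btw: "mdist B a e = mdist B a d + mdist B d e"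
    using j path_length_del[OF v(1), of B] unfolding faces_def v(3)[symmetric] by simp
  obtain as where as: "vs @ [a] = c # as" using v(1) *(2) by (cases vs) auto
  then have la: "last (c # as) = a" "length as = length vs"
    by (metis last_snoc, metis Suc_inject length_Cons length_append_singleton)
  have cs: "cs = as @ d # e # ws" using v(1) *(2) as
    by (metis append_Cons append_Nil append_assoc list.inject)
  have del_bs: "del j bs = c # as @ e # ws" using v(3) as
    by (metis append_Cons append_Nil append_assoc)
  have hl: "del (length vs) (hlift (tr f c) cs) = hlift (tr f c) (as @ e # ws)"
    using hlift_del[OF *(9), of as d e ws] *(8,10) la btw unfolding cs by simp
  have "del (length us + Suc (length vs)) (map (\<lambda>f. tr f c) us @ tr f c # hlift (tr f c) cs) =
      map (\<lambda>f. tr f c) us @ tr f c # hlift (tr f c) (as @ e # ws)"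
    using del_append_right[of "map (\<lambda>f. tr f c) us" "Suc (length vs)" "tr f c # hlift (tr f c) cs"] hl by simp
  then show del: "del (length fs - 1 + j) (emb (fs, bs)) = emb (fs, del j bs)"
    unfolding del_bs unfolding *(1,2) emb_snoc_Cons v(2) by simp
  have "path_length E (emb (fs, del j bs)) = l" "path_length E (emb (fs, bs)) = l"
    using emb_in(1)[OF del_in_pairs(2)[OF q j]] emb_in(1)[OF q] by (simp_all add: magnitude_tuples_iff)
  moreover have "Suc (length fs - 1 + j) < length (emb (fs, bs))"
    using j1 unfolding *(1,2) emb_snoc_Cons by simp
  ultimately show "length fs - 1 + j \<in> faces E (emb (fs, bs))"
    using j1 del by (simp add: faces_def)
qed

lemma emb_nth:
  assumes "(fs, bs) \<in> pairs l n" "j < length bs"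
  shows "p (emb (fs, bs) ! (length fs - 1 + j)) = bs ! j"
proof -
  obtain us f c cs where *: "fs = us @ [f]" "bs = c # cs" "set us \<subseteq> mspace E" "f \<in> mspace E" "p f = b"
    "\<And>u. u \<in> set us \<Longrightarrow> p u = b" "c \<in> mspace B" "set cs \<subseteq> mspace B"
    "tr f c \<in> mspace E" "p (tr f c) = c" by (rule pairsE[OF assms(1)]) blast
  have "map p (tr f c # hlift (tr f c) cs) = bs"
    using map_p_hlift[OF *(9,8)] *(2,10) by simp
  then have "p ((tr f c # hlift (tr f c) cs) ! j) = bs ! j"
    using assms(2) by (metis length_map nth_map)
  moreover have "emb (fs, bs) ! (length us + j) = (tr f c # hlift (tr f c) cs) ! j"
    unfolding *(1,2) emb_snoc_Cons using nth_append_length_plus[of "map (\<lambda>f. tr f c) us"] by simp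
  ultimately show ?thesis using *(1) by simp
qed

text \<open>Deleting the corner merges a vertical with a horizontal step, which gives a tilted one.
  Behind the corner two horizontal steps merge into a horizontal one only over a geodesic.\<close>

lemma good_face_emb:
  assumes q: "(fs, bs) \<in> pairs l (Suc n)" and i: "i \<in> faces E (emb (fs, bs))" and good: "good (del i (emb (fs, bs)))"
  shows "i \<in> faces F fs \<or> (\<exists>j \<in> faces B bs. i = length fs - 1 + j)"
proof -
  obtain us f c cs where *: "fs = us @ [f]" "bs = c # cs" "set us \<subseteq> mspace E" "f \<in> mspace E" "p f = b"
    "\<And>u. u \<in> set us \<Longrightarrow> p u = b" "c \<in> mspace B" "set cs \<subseteq> mspace B"
    "tr f c \<in> mspace E" "p (tr f c) = c" by (rule pairsE[OF q]) blast
  let ?V = "emb (fs, bs)"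
  have i1: "1 \<le> i" "Suc i < length ?V" using i unfolding faces_def by blast+
  have lenV: "length ?V = length us + length bs" unfolding *(1,2) emb_snoc_Cons by simp
  have V: "?V \<in> magnitude_tuples E l (Suc n)" by (rule emb_in(1)[OF q])
  show ?thesis
  proof (cases "i < length us")
    case True
    have del: "del i ?V = emb (del i us @ [f], c # cs)"
      using True unfolding *(1,2) emb_snoc_Cons by (simp add: del_append_left) (simp add: del_def take_map drop_map)
    have "path_length E (emb (del i us @ [f], c # cs)) = path_length E (del i us @ [f]) + path_length B (c # cs)"
      using set_del[of i us] * by (intro path_length_emb) auto
    moreover have "path_length E (emb (us @ [f], c # cs)) = path_length E (us @ [f]) + path_length B (c # cs)"
      using * by (intro path_length_emb) auto
    moreover have "path_length E (del i ?V) = path_length E ?V" using i by (simp add: faces_def)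
    ultimately have "path_length E (del i us @ [f]) = path_length E (us @ [f])"
      unfolding del unfolding *(1,2) by simp
    then have "i \<in> faces F fs"
      using i1(1) True unfolding faces_def *(1) by (simp add: del_append_left)
    then show ?thesis ..
  next
    case False
    from i1 obtain us' x y z ws where s: "?V = us' @ x # y # z # ws" "i = Suc (length us')"
      "del i ?V = us' @ x # z # ws" "x = ?V ! (i - 1)" "y = ?V ! i" "z = ?V ! (i + 1)"
      by (rule inner_index_split)
    have E: "x \<in> mspace E" "y \<in> mspace E" "z \<in> mspace E" and ne: "x \<noteq> y" "y \<noteq> z"
      using V unfolding magnitude_tuples_iff s(1) steps_append_Cons by auto
    have btw: "mdist E x z = mdist E x y + mdist E y z"
      using i path_length_del[OF s(1), of E] unfolding faces_def s(3)[symmetric] by simp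
    note m = good_merge[OF E ne btw good[unfolded s(3)]]
    define j where "j = i - length us"
    have j: "i = length fs - 1 + j" using False by (simp add: j_def *(1))
    have jb: "Suc j < length bs" using i1(2) lenV False by (simp add: j_def)
    have yz: "p y = bs ! j" "p z = bs ! Suc j"
      using emb_nth[OF q, of j] emb_nth[OF q, of "Suc j"] jb unfolding s(5,6) j by simp_all
    have "bs ! j \<noteq> bs ! Suc j"
    proof -
      have "steps bs ! j \<in> set (steps bs)" using jb by simp
      then show ?thesis using q jb unfolding pairs_iff by (auto simp: steps_nth)
    qed
    then have h: "p x \<noteq> p y" "mdist B (p x) (p z) = mdist B (p x) (p y) + mdist B (p y) (p z)"
      using m yz by (auto simp: hor_def)
    (* For j = 0 the corner itself would be deleted, but its first step is vertical. *)
    have j0: "1 \<le> j"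
    proof (rule ccontr)
      assume "\<not> 1 \<le> j"
      then have il: "i = length us" using False by (simp add: j_def)
      then have "i - 1 < length us" using i1(1) by simp
      then have "x = tr (us ! (i - 1)) c" "us ! (i - 1) \<in> set us"
        unfolding s(4) *(1,2) emb_snoc_Cons by (simp_all add: nth_append)
      then have "p x = c" using *(3,7) by auto
      moreover have "y = tr f c" unfolding s(5) *(1,2) emb_snoc_Cons il by (simp add: nth_append)
      ultimately show False using h(1) *(10) by simp
    qed
    have "p x = bs ! (j - 1)"
      using emb_nth[OF q, of "j - 1"] jb j0 unfolding s(4) j by simp
    then have "j \<in> faces B bs"
      using mem_faces_iff_between[OF j0 jb, of B] h(2) yz by (simp add: metric_between_def)
    then show ?thesis using j by blast
  qed
qed

lemma face_sum_emb:
  assumes "q \<in> pairs l (Suc n)"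
  shows "frag_restrict (emb ` pairs l n) (face_sum E (emb q)) = frag_extend (\<lambda>q. frag_of (emb q)) (pair_face_sum q)"
proof -
  obtain fs bs where qq: "q = (fs, bs)" by (cases q)
  note q = assms[unfolded qq]
  let ?V = "emb (fs, bs)" and ?v = "length fs - 1"
  define t where "t i = frag_cmul ((-1) ^ i) (frag_of (del i ?V))" for i
  have V: "?V \<in> magnitude_tuples E l (Suc n)" by (rule emb_in(1)[OF q])
  have crit: "del i ?V \<in> emb ` pairs l n \<longleftrightarrow> good (del i ?V)" if "i \<in> faces E ?V" for i
    using noncritical_iff[of "del i ?V" l n] del_in_magnitude_tuples[OF V that] by auto
  have "{i \<in> faces E ?V. good (del i ?V)} = faces F fs \<union> (+) ?v ` faces B bs"
  proof (intro equalityI subsetI)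
    fix i assume "i \<in> {i \<in> faces E ?V. good (del i ?V)}"
    then show "i \<in> faces F fs \<union> (+) ?v ` faces B bs"
      using good_face_emb[OF q, of i] by blast
  next
    fix i assume "i \<in> faces F fs \<union> (+) ?v ` faces B bs"
    then consider "i \<in> faces F fs" | j where "j \<in> faces B bs" "i = ?v + j" by blast
    then show "i \<in> {i \<in> faces E ?V. good (del i ?V)}"
    proof cases
      case 1
      then show ?thesis using face_emb_vertical[OF q 1] emb_in(2)[OF del_in_pairs(1)[OF q 1]] by simp
    next
      case 2
      then show ?thesis
        using face_emb_horizontal[OF q 2(1)] emb_in(2)[OF del_in_pairs(2)[OF q 2(1)]] by simp
    qed
  qed
  moreover have "faces F fs \<inter> (+) ?v ` faces B bs = {}"
    by (auto simp: faces_def)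
  ultimately have sum: "sum t {i \<in> faces E ?V. good (del i ?V)} = sum t (faces F fs) + (\<Sum>j\<in>faces B bs. t (?v + j))"
    by (simp add: sum.union_disjoint sum.reindex)
  have "frag_restrict (emb ` pairs l n) (face_sum E ?V) = (\<Sum>i\<in>faces E ?V. if good (del i ?V) then t i else 0)"
    unfolding face_sum_def frag_restrict_def
    by (simp add: frag_extend_sum frag_extend_cmul comp_def) (rule sum.cong, auto simp: crit t_def)
  also have "\<dots> = sum t {i \<in> faces E ?V. good (del i ?V)}"
    by (simp add: sum.inter_filter)
  also have "\<dots> = (\<Sum>i\<in>faces F fs. frag_cmul ((-1) ^ i) (frag_of (emb (del i fs, bs)))) +
      (\<Sum>j\<in>faces B bs. frag_cmul ((-1) ^ (?v + j)) (frag_of (emb (fs, del j bs))))"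
    unfolding sum t_def
    by (intro arg_cong2[of _ _ _ _ "(+)"] sum.cong refl)
       (simp_all only: face_emb_vertical(2)[OF q] face_emb_horizontal(2)[OF q])
  also have "\<dots> = frag_extend (\<lambda>q. frag_of (emb q)) (pair_face_sum (fs, bs))"
    unfolding pair_face_sum_def prod.case
    by (simp add: frag_extend_add frag_extend_sum frag_extend_cmul comp_def)
  finally show ?thesis by (simp add: qq)
qed

text \<open>The sign is that of the face which deletes the inserted point; its index exceeds by one the
  position of the tilted step.\<close>

lemma acyclic_matching:
  "acyclic_matching (magnitude_tuples E l) (face_sum E) (pairs l) pair_face_sum emb lower upper
     insert_corner (\<lambda>xs. (-1) ^ Suc (bad_pos xs)) step_order"
proof
  note nc = noncritical_iff
  show "face_sum E x = 0" if "x \<in> magnitude_tuples E l 0" for x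
    using that by (auto simp: face_sum_def faces_def magnitude_tuples_iff)
  show "Poly_Mapping.keys (face_sum E x) \<subseteq> magnitude_tuples E l n"
    if "x \<in> magnitude_tuples E l (Suc n)" for x n
    using that by (rule keys_face_sum)
  show "frag_extend (face_sum E) (face_sum E x) = 0" if "x \<in> magnitude_tuples E l n" for x n
    using that by (intro face_sum_face_sum) (simp add: magnitude_tuples_iff)
  show "pair_face_sum q = 0" if "q \<in> pairs l 0" for q
    using that by (rule pair_face_sum_0)
  show "Poly_Mapping.keys (pair_face_sum q) \<subseteq> pairs l n" if "q \<in> pairs l (Suc n)" for q n
    using that by (rule keys_pair_face_sum)
  show "emb q \<in> magnitude_tuples E l n" if "q \<in> pairs l n" for q n
    using that by (rule emb_in)
  show "inj_on emb (pairs l n)" for n by (rule inj_emb)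
  show "Poly_Mapping.keys (face_sum E x) \<inter> emb ` pairs l n = {}"
    if x: "x \<in> magnitude_tuples E l (Suc n) - emb ` pairs l (Suc n)" for x n
  proof -
    have xt: "x \<in> magnitude_tuples E l (Suc n)" and ng: "\<not> good x" using x nc by blast+
    have "\<not> good (del i x)" if i: "i \<in> faces E x" for i
    proof
      assume good: "good (del i x)"
      have "1 \<le> i" "Suc i < length x" using i unfolding faces_def by blast+
      then obtain us a c d ws where s: "x = us @ a # c # d # ws" "i = Suc (length us)"
        "del i x = us @ a # d # ws" by (rule inner_index_split)
      have "mdist E a d = mdist E a c + mdist E c d"
        using i path_length_del[OF s(1), of E] unfolding faces_def s(3)[symmetric] by simp
      moreover have "a \<in> mspace E" "c \<in> mspace E" "d \<in> mspace E" "a \<noteq> c" "c \<noteq> d"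
        using xt unfolding magnitude_tuples_iff s(1) steps_append_Cons by auto
      ultimately have "good x" using good_insert good unfolding s(3) unfolding s(1) by blast
      then show False using ng by simp
    qed
    then show ?thesis
      using keys_face_sum_subset[of E x] emb_in(2) by fastforce
  qed
  show "frag_restrict (emb ` pairs l n) (face_sum E (emb q)) = frag_extend (\<lambda>q. frag_of (emb q)) (pair_face_sum q)"
    if "q \<in> pairs l (Suc n)" for q n
    using that by (rule face_sum_emb)
  show "wf step_order" by (rule wf_step_order)
  show "x \<in> lower \<or> x \<in> upper" if "x \<in> magnitude_tuples E l n - emb ` pairs l n" for x n
    using that nc lower_or_upper by blast
  show "lower \<inter> upper = {}" by (auto simp: lower_def upper_def Let_def)
  show "insert_corner x \<in> upper \<inter> (magnitude_tuples E l (Suc n) - emb ` pairs l (Suc n))"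
    if x: "x \<in> lower" "x \<in> magnitude_tuples E l n - emb ` pairs l n" for x n
  proof -
    obtain us y z ws where s: "x = us @ y # z # ws" "bad_pos x = length us" "good (us @ [y])"
      "p y \<noteq> p z" "z \<noteq> tr y (p z)" "insert_corner x = us @ y # tr y (p z) # z # ws"
      using x(1) by (rule lower_split)
    have t: "us @ y # z # ws \<in> magnitude_tuples E l n" using x(2) s(1) by simp
    then have E: "y \<in> mspace E" "z \<in> mspace E" by (auto simp: magnitude_tuples_iff)
    have "insert_corner x \<in> upper"
      unfolding s(6) by (rule upperI[OF good_insert_prefix[OF E s(3,4)]]) (use E in simp)
    moreover have "insert_corner x \<in> magnitude_tuples E l (Suc n)"
      unfolding s(6) by (rule insert_corner_tuple[OF t s(4,5)])
    moreover have "\<not> good (insert_corner x)" using calculation(1) by (simp add: upper_def)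
    ultimately show ?thesis using nc by blast
  qed
  show "\<exists>m x. n = Suc m \<and> x \<in> lower \<inter> (magnitude_tuples E l m - emb ` pairs l m) \<and> u = insert_corner x"
    if u: "u \<in> upper" "u \<in> magnitude_tuples E l n - emb ` pairs l n" for u n
  proof -
    have t: "u \<in> magnitude_tuples E l n" using u by blast
    then have "set u \<subseteq> mspace E" "\<forall>(x, y) \<in> set (steps u). x \<noteq> y"
      unfolding magnitude_tuples_iff by blast+
    then obtain us y z ws where s: "u = us @ y # tr y (p z) # z # ws" "good (us @ [y])"
      "p y \<noteq> p z" "z \<noteq> tr y (p z)"
      using u(1) by (metis upper_split)
    obtain m where "n = Suc m" "us @ y # z # ws \<in> magnitude_tuples E l m"
      using corner_removed_tuple t s by metis
    moreover have "\<not> good (us @ y # z # ws)" using lowerI(1)[OF s(2-4)] by (simp add: lower_def)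
    ultimately show ?thesis
      using lowerI[OF s(2-4), of ws] nc s(1) by (intro exI[of _ m] exI[of _ "us @ y # z # ws"]) auto
  qed
  show "(-1 :: int) ^ Suc (bad_pos x) * (-1) ^ Suc (bad_pos x) = 1" for x
    by (simp flip: power_mult_distrib)
  show "Poly_Mapping.keys (face_sum E (insert_corner x) - frag_cmul ((-1) ^ Suc (bad_pos x)) (frag_of x))
      \<subseteq> upper \<union> {y. (y, x) \<in> step_order}"
    if x: "x \<in> lower" "x \<in> magnitude_tuples E l n - emb ` pairs l n" for x n
  proof -
    obtain us y z ws where s: "x = us @ y # z # ws" "bad_pos x = length us" "good (us @ [y])"
      "p y \<noteq> p z" "z \<noteq> tr y (p z)" "insert_corner x = us @ y # tr y (p z) # z # ws"
      using x(1) by (rule lower_split)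
    have t: "us @ y # z # ws \<in> magnitude_tuples E l n" using x(2) s(1) by simp
    have V: "us @ y # tr y (p z) # z # ws \<in> magnitude_tuples E l (Suc n)"
      by (rule insert_corner_tuple[OF t s(4,5)])
    let ?V = "us @ y # tr y (p z) # z # ws" and ?k = "Suc (length us)"
    have "?k \<in> faces E ?V" using corner_removed_tuple[OF V s(4,5)] by metis
    moreover have "del ?k ?V = x" using s(1) by (simp add: del_append)
    ultimately have "face_sum E ?V - frag_cmul ((-1) ^ ?k) (frag_of x) =
        (\<Sum>i\<in>faces E ?V - {?k}. frag_cmul ((-1) ^ i) (frag_of (del i ?V)))"
      by (simp add: face_sum_def sum.remove[of _ ?k])
    moreover have "Poly_Mapping.keys \<dots> \<subseteq> upper \<union> {y. (y, x) \<in> step_order}"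
    proof (intro keys_sum_subset keys_cmul_subset)
      fix i assume "i \<in> faces E ?V - {?k}"
      then show "Poly_Mapping.keys (frag_of (del i ?V)) \<subseteq> upper \<union> {y. (y, x) \<in> step_order}"
        using face_of_upper[OF V s(3-5), of i] s(1) by auto
    qed
    ultimately show ?thesis unfolding s(6) s(2) by simp
  qed
qed

definition pair_complex :: "real \<Rightarrow> ('a list \<times> 'b list \<Rightarrow>\<^sub>0 int) chain_cplx" where
  "pair_complex l = \<lparr>grp = (\<lambda>n. free_Abelian_group (pairs l n)), dif = (\<lambda>n. frag_extend pair_face_sum)\<rparr>"

theorem magnitude_complex_equivalent_pair_complex:
  "chain_homotopy_equivalent (magnitude_complex E l) (pair_complex l)"
  by (rule acyclic_matching.chain_homotopy_equivalent_critical[OF acyclic_matching[of l]])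
     (simp_all add: magnitude_complex_def pair_complex_def magnitude_boundary_eq)

end

section \<open>Tensor products of free abelian groups\<close>

definition tensor_class ::
  "('a, 'c) monoid_scheme \<Rightarrow> ('b, 'd) monoid_scheme \<Rightarrow> ('a \<times> 'b \<Rightarrow>\<^sub>0 int) \<Rightarrow> ('a \<times> 'b \<Rightarrow>\<^sub>0 int) set" where
  "tensor_class G H c = tensor_rel G H #>\<^bsub>free_Abelian_group (carrier G \<times> carrier H)\<^esub> c"

locale tensor_setup = G: comm_group G + H: comm_group H
  for G :: "('a, 'c) monoid_scheme" and H :: "('b, 'd) monoid_scheme"
begin

abbreviation FA where "FA \<equiv> free_Abelian_group (carrier G \<times> carrier H)"
abbreviation R where "R \<equiv> tensor_rel G H"

sublocale FA: comm_group FA by (rule abelian_free_Abelian_group)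

lemma tensor_rel_subgroup: "subgroup R FA"
  unfolding tensor_rel_def
proof (rule FA.generate_is_subgroup)
  have "Poly_Mapping.keys (frag_of a - frag_of b - frag_of c) \<subseteq> {a, b, c}" for a b c :: "'a \<times> 'b"
    by (intro keys_diff_subset) auto
  from subsetD[OF this] show
    "{frag_of (x \<otimes>\<^bsub>G\<^esub> x', y) - frag_of (x, y) - frag_of (x', y) |x x' y.
        x \<in> carrier G \<and> x' \<in> carrier G \<and> y \<in> carrier H} \<union>
     {frag_of (x, y \<otimes>\<^bsub>H\<^esub> y') - frag_of (x, y) - frag_of (x, y') |x y y'.
        x \<in> carrier G \<and> y \<in> carrier H \<and> y' \<in> carrier H} \<subseteq> carrier FA"
    by fastforce
qed

lemma tensor_rel_normal: "R \<lhd> FA"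
  by (rule FA.subgroup_imp_normal[OF tensor_rel_subgroup])

lemma tensor_rel_carrier: "r \<in> R \<Longrightarrow> Poly_Mapping.keys r \<subseteq> carrier G \<times> carrier H"
  using subsetD[OF subgroup.subset[OF tensor_rel_subgroup], of r] by simp

lemma tensor_rel_0: "0 \<in> R"
  using subgroup.one_closed[OF tensor_rel_subgroup] by simp

lemma tensor_rel_add: "r \<in> R \<Longrightarrow> r' \<in> R \<Longrightarrow> r + r' \<in> R"
  using subgroup.m_closed[OF tensor_rel_subgroup] by fastforce

lemma tensor_rel_uminus: "r \<in> R \<Longrightarrow> - r \<in> R"
  using subgroup.m_inv_closed[OF tensor_rel_subgroup, of r] tensor_rel_carrier[of r] by simp

lemma tensor_rel_diff: "r \<in> R \<Longrightarrow> r' \<in> R \<Longrightarrow> r - r' \<in> R"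
  using tensor_rel_add[of r "- r'"] tensor_rel_uminus by simp

lemma tensor_rel_left:
  "x \<in> carrier G \<Longrightarrow> x' \<in> carrier G \<Longrightarrow> y \<in> carrier H \<Longrightarrow>
    frag_of (x \<otimes>\<^bsub>G\<^esub> x', y) - frag_of (x, y) - frag_of (x', y) \<in> R"
  unfolding tensor_rel_def by (rule generate.incl) blast

lemma tensor_rel_right:
  "x \<in> carrier G \<Longrightarrow> y \<in> carrier H \<Longrightarrow> y' \<in> carrier H \<Longrightarrow>
    frag_of (x, y \<otimes>\<^bsub>H\<^esub> y') - frag_of (x, y) - frag_of (x, y') \<in> R"
  unfolding tensor_rel_def by (rule generate.incl) blast

lemma tensor_rel_induct [consumes 1, case_names left right zero add uminus]:
  assumes "r \<in> R"
    and left: "\<And>x x' y. x \<in> carrier G \<Longrightarrow> x' \<in> carrier G \<Longrightarrow> y \<in> carrier H \<Longrightarrow>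
        P (frag_of (x \<otimes>\<^bsub>G\<^esub> x', y) - frag_of (x, y) - frag_of (x', y))"
    and right: "\<And>x y y'. x \<in> carrier G \<Longrightarrow> y \<in> carrier H \<Longrightarrow> y' \<in> carrier H \<Longrightarrow>
        P (frag_of (x, y \<otimes>\<^bsub>H\<^esub> y') - frag_of (x, y) - frag_of (x, y'))"
    and zero: "P 0" and add: "\<And>a b. P a \<Longrightarrow> P b \<Longrightarrow> P (a + b)" and uminus: "\<And>a. P a \<Longrightarrow> P (- a)"
  shows "P r"
  using assms(1) unfolding tensor_rel_def
proof (induction r rule: generate.induct)
  case one
  then show ?case using zero by simp
next
  case (incl h)
  then show ?case using left right by auto
next
  case (inv h)
  then have "h \<in> R" unfolding tensor_rel_def by (rule generate.incl)
  moreover have "P h" using inv left right by auto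
  ultimately show ?case using uminus tensor_rel_carrier[of h] by simp
next
  case (eng h1 h2)
  then show ?case using add by simp
qed

lemma tensor_class_hom: "tensor_class G H \<in> hom FA (tensor_group G H)"
  unfolding tensor_group_def tensor_class_def[abs_def]
  by (rule normal.r_coset_hom_Mod[OF tensor_rel_normal])

lemma comm_group_tensor_group: "comm_group (tensor_group G H)"
  unfolding tensor_group_def by (rule FA.abelian_FactGroup[OF tensor_rel_subgroup])

lemma carrier_tensor_group: "carrier (tensor_group G H) = tensor_class G H ` carrier FA"
  unfolding tensor_group_def tensor_class_def carrier_FactGroup ..

lemma tensor_class_eqI:
  assumes "a - b \<in> R" "Poly_Mapping.keys a \<subseteq> carrier G \<times> carrier H" "Poly_Mapping.keys b \<subseteq> carrier G \<times> carrier H"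
  shows "tensor_class G H a = tensor_class G H b"
proof -
  have "a \<in> R #>\<^bsub>FA\<^esub> b"
    unfolding r_coset_def using assms(1) by (intro UN_I[of "a - b"]) auto
  then show ?thesis
    unfolding tensor_class_def
    using FA.repr_independence[OF _ _ tensor_rel_subgroup] assms by force
qed

lemma tensor_class_eqD:
  assumes "tensor_class G H a = tensor_class G H b"
    "Poly_Mapping.keys a \<subseteq> carrier G \<times> carrier H"
  shows "a - b \<in> R"
proof -
  have "a \<in> R #>\<^bsub>FA\<^esub> b"
    using FA.rcos_self[OF _ tensor_rel_subgroup, of a] assms unfolding tensor_class_def by simp
  then show ?thesis unfolding r_coset_def by auto
qed

end

text \<open>The map on representatives sends bilinearity relations to bilinearity relations, so it maps
  a coset into a single coset, which is therefore the unique element chosen by \<open>tensor_map\<close>.\<close>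

lemma tensor_map_class:
  fixes G :: "('a, 'c) monoid_scheme" and H :: "('b, 'd) monoid_scheme"
    and G' :: "('e, 'g) monoid_scheme" and H' :: "('f, 'h) monoid_scheme"
  assumes "comm_group G" "comm_group H" "comm_group G'" "comm_group H'"
    and f: "f \<in> hom G G'" and g: "g \<in> hom H H'"
    and c: "Poly_Mapping.keys c \<subseteq> carrier G \<times> carrier H"
  shows "tensor_map G' H' f g (tensor_class G H c) =
         tensor_class G' H' (frag_extend (\<lambda>(x, y). frag_of (f x, g y)) c)"
proof -
  interpret A: tensor_setup G H using assms by (simp add: tensor_setup_def)
  interpret B: tensor_setup G' H' using assms by (simp add: tensor_setup_def)
  let ?e = "frag_extend (\<lambda>(x, y). frag_of (f x, g y))"
  have fc: "f x \<in> carrier G'" if "x \<in> carrier G" for x using f that by (rule hom_in_carrier)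
  have gc: "g x \<in> carrier H'" if "x \<in> carrier H" for x using g that by (rule hom_in_carrier)
  have keys: "Poly_Mapping.keys (?e a) \<subseteq> carrier G' \<times> carrier H'"
    if "Poly_Mapping.keys a \<subseteq> carrier G \<times> carrier H" for a
    using that by (rule keys_frag_extend_subset) (auto intro: fc gc)
  have rel: "?e r \<in> B.R" if "r \<in> A.R" for r
    using that
  proof (induction r rule: A.tensor_rel_induct)
    case (left x x' y)
    then show ?case using B.tensor_rel_left[of "f x" "f x'" "g y"] fc gc
      by (simp add: frag_extend_diff hom_mult[OF f])
  next
    case (right x y y')
    then show ?case using B.tensor_rel_right[of "f x" "g y" "g y'"] fc gc
      by (simp add: frag_extend_diff hom_mult[OF g])
  qed (simp_all add: frag_extend_linear B.tensor_rel_0 B.tensor_rel_add B.tensor_rel_uminus)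
  have "tensor_class G' H' (?e a) = tensor_class G' H' (?e c)" if a: "a \<in> tensor_class G H c" for a
  proof -
    obtain r where r: "r \<in> A.R" "a = r + c" using a unfolding tensor_class_def r_coset_def mult_free_Abelian_group by blast
    then have "?e a - ?e c = ?e r" by (simp add: frag_extend_add)
    then have "?e a - ?e c \<in> B.R" using rel[OF r(1)] by simp
    moreover have "Poly_Mapping.keys a \<subseteq> carrier G \<times> carrier H"
      unfolding r(2) using A.tensor_rel_carrier[OF r(1)] c by (rule keys_add_subset)
    ultimately show ?thesis
      using c by (intro B.tensor_class_eqI keys)
  qed
  moreover have "c \<in> tensor_class G H c"
    unfolding tensor_class_def using c A.FA.rcos_self[OF _ A.tensor_rel_subgroup] by simp
  ultimately have "(\<lambda>a. tensor_class G' H' (?e a)) ` tensor_class G H c = {tensor_class G' H' (?e c)}"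
    by blast
  then show ?thesis unfolding tensor_map_def tensor_class_def[symmetric] by simp
qed

definition frag_tensor :: "('a \<Rightarrow>\<^sub>0 int) \<Rightarrow> ('b \<Rightarrow>\<^sub>0 int) \<Rightarrow> ('a \<times> 'b \<Rightarrow>\<^sub>0 int)" where
  "frag_tensor x y = frag_extend (\<lambda>s. frag_extend (\<lambda>t. frag_of (s, t)) y) x"

lemma frag_tensor_simps:
  "frag_tensor (x + x') y = frag_tensor x y + frag_tensor x' y"
  "frag_tensor (x - x') y = frag_tensor x y - frag_tensor x' y"
  "frag_tensor 0 y = 0"
  "frag_tensor (frag_of s) (y + y') = frag_tensor (frag_of s) y + frag_tensor (frag_of s) y'"
  "frag_tensor (frag_of s) (y - y') = frag_tensor (frag_of s) y - frag_tensor (frag_of s) y'"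
  "frag_tensor (frag_of s) 0 = 0"
  "frag_tensor (frag_of s) (frag_of t) = frag_of (s, t)"
  by (simp_all add: frag_tensor_def frag_extend_linear)

lemma frag_tensor_add_right: "frag_tensor x (y + y') = frag_tensor x y + frag_tensor x y'"
  by (rule frag_additive_eq[of _ UNIV "\<lambda>x. frag_tensor x (y + y')" "\<lambda>x. frag_tensor x y + frag_tensor x y'"])
     (simp_all add: frag_tensor_simps)

lemma keys_frag_tensor:
  assumes "Poly_Mapping.keys x \<subseteq> S" "Poly_Mapping.keys y \<subseteq> T"
  shows "Poly_Mapping.keys (frag_tensor x y) \<subseteq> S \<times> T"
  unfolding frag_tensor_def using assms
  by (intro keys_frag_extend_subset[OF assms(1)] keys_frag_extend_subset[OF assms(2)]) auto

definition tensor_of_basis :: "('a \<times> 'b \<Rightarrow>\<^sub>0 int) \<Rightarrow> (('a \<Rightarrow>\<^sub>0 int) \<times> ('b \<Rightarrow>\<^sub>0 int) \<Rightarrow>\<^sub>0 int)" where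
  "tensor_of_basis = frag_extend (\<lambda>(s, t). frag_of (frag_of s, frag_of t))"

lemma tensor_of_basis_frag_of [simp]:
  "tensor_of_basis (frag_of (s, t)) = frag_of (frag_of s, frag_of t)"
  by (simp add: tensor_of_basis_def)

definition tensor_iso :: "'a set \<Rightarrow> 'b set \<Rightarrow> ('a \<times> 'b \<Rightarrow>\<^sub>0 int) \<Rightarrow> (('a \<Rightarrow>\<^sub>0 int) \<times> ('b \<Rightarrow>\<^sub>0 int) \<Rightarrow>\<^sub>0 int) set" where
  "tensor_iso S T c = tensor_class (free_Abelian_group S) (free_Abelian_group T) (tensor_of_basis c)"

lemma tensor_setup_free: "tensor_setup (free_Abelian_group S) (free_Abelian_group T)"
  by (simp add: tensor_setup_def abelian_free_Abelian_group)

lemma keys_tensor_of_basis: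
  "Poly_Mapping.keys c \<subseteq> S \<times> T \<Longrightarrow>
   Poly_Mapping.keys (tensor_of_basis c) \<subseteq> carrier (free_Abelian_group S) \<times> carrier (free_Abelian_group T)"
  unfolding tensor_of_basis_def by (rule keys_frag_extend_subset) auto

text \<open>The factors are expanded one after the other; each subtraction in a factor is absorbed by one
  bilinearity relation.\<close>

lemma expand_generator:
  assumes x: "Poly_Mapping.keys x \<subseteq> S" and y: "Poly_Mapping.keys y \<subseteq> T"
  shows "frag_of (x, y) - tensor_of_basis (frag_tensor x y) \<in> tensor_rel (free_Abelian_group S) (free_Abelian_group T)"
proof -
  interpret tensor_setup "free_Abelian_group S" "free_Abelian_group T" by (rule tensor_setup_free)
  let ?D = "\<lambda>x y. frag_of (x, y) - tensor_of_basis (frag_tensor x y)"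
  have basis: "?D (frag_of s) y \<in> R" if s: "s \<in> S" for s
    using y
  proof -
    have "Poly_Mapping.keys y \<subseteq> T \<and> ?D (frag_of s) y \<in> R" using y
    proof (induction y rule: frag_induction)
      case zero
      have "- (frag_of (frag_of s, 0)) \<in> R"
        using tensor_rel_right[of "frag_of s" 0 0] s by simp
      from tensor_rel_uminus[OF this] show ?case by (simp add: frag_tensor_simps tensor_of_basis_def)
    next
      case (one t)
      then show ?case by (simp add: frag_tensor_simps tensor_of_basis_def tensor_rel_0)
    next
      case (diff a c)
      have k: "Poly_Mapping.keys (a - c) \<subseteq> T" using diff by (intro keys_diff_subset) auto
      have r: "frag_of (frag_of s, a) - frag_of (frag_of s, a - c) - frag_of (frag_of s, c) \<in> R"
        using tensor_rel_right[of "frag_of s" "a - c" c] s k diff by simp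
      have eq: "?D (frag_of s) (a - c) = ?D (frag_of s) a - ?D (frag_of s) c -
          (frag_of (frag_of s, a) - frag_of (frag_of s, a - c) - frag_of (frag_of s, c))"
        by (simp add: frag_tensor_simps tensor_of_basis_def frag_extend_diff)
      show ?case
      unfolding eq
      using k tensor_rel_diff[OF tensor_rel_diff[OF conjunct2[OF diff(1)] conjunct2[OF diff(2)]] r] by blast
    qed
    then show ?thesis by simp
  qed
  have "Poly_Mapping.keys x \<subseteq> S \<and> ?D x y \<in> R" using x
  proof (induction x rule: frag_induction)
    case zero
    have "- (frag_of (0, y)) \<in> R"
      using tensor_rel_left[of 0 0 y] y by simp
    from tensor_rel_uminus[OF this] show ?case by (simp add: frag_tensor_simps tensor_of_basis_def)
  next
    case (one s)
    then show ?case using basis by simp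
  next
    case (diff a c)
    have k: "Poly_Mapping.keys (a - c) \<subseteq> S" using diff by (intro keys_diff_subset) auto
    have r: "frag_of (a, y) - frag_of (a - c, y) - frag_of (c, y) \<in> R"
      using tensor_rel_left[of "a - c" c y] y k diff by simp
    have eq: "?D (a - c) y = ?D a y - ?D c y - (frag_of (a, y) - frag_of (a - c, y) - frag_of (c, y))"
      by (simp add: frag_tensor_simps tensor_of_basis_def frag_extend_diff)
    show ?case
      unfolding eq
      using k tensor_rel_diff[OF tensor_rel_diff[OF conjunct2[OF diff(1)] conjunct2[OF diff(2)]] r] by blast
  qed
  then show ?thesis by simp
qed

text \<open>The inverse expands both factors of a generator; it is well defined because the expansion
  is bilinear.\<close>

lemma tensor_iso_iso:
  "tensor_iso S T \<in> iso (free_Abelian_group (S \<times> T)) (tensor_group (free_Abelian_group S) (free_Abelian_group T))"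
proof -
  interpret tensor_setup "free_Abelian_group S" "free_Abelian_group T" by (rule tensor_setup_free)
  let ?G = "tensor_group (free_Abelian_group S) (free_Abelian_group T)"
  define ev where "ev = frag_extend (\<lambda>(x, y). frag_tensor x y :: 'a \<times> 'b \<Rightarrow>\<^sub>0 int)"
  have ev_basis: "ev (tensor_of_basis c) = c" for c
    by (rule frag_additive_eq[of _ UNIV "\<lambda>c. ev (tensor_of_basis c)"])
       (auto simp: ev_def tensor_of_basis_def frag_tensor_simps frag_extend_diff)
  have ev_rel: "ev r = 0" if "r \<in> R" for r
    using that
    by (induction r rule: tensor_rel_induct)
       (simp_all add: ev_def frag_extend_linear frag_tensor_simps frag_tensor_add_right)
  have hom: "tensor_iso S T \<in> hom (free_Abelian_group (S \<times> T)) ?G"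
  proof (rule homI)
    fix c assume "c \<in> carrier (free_Abelian_group (S \<times> T))"
    then show "tensor_iso S T c \<in> carrier ?G"
      unfolding tensor_iso_def by (intro hom_in_carrier[OF tensor_class_hom]) (simp add: keys_tensor_of_basis)
  next
    fix c d assume "c \<in> carrier (free_Abelian_group (S \<times> T))" "d \<in> carrier (free_Abelian_group (S \<times> T))"
    then show "tensor_iso S T (c \<otimes>\<^bsub>free_Abelian_group (S \<times> T)\<^esub> d) = tensor_iso S T c \<otimes>\<^bsub>?G\<^esub> tensor_iso S T d"
      unfolding tensor_iso_def
      by (subst hom_mult[OF tensor_class_hom, symmetric])
         (simp_all add: keys_tensor_of_basis, simp add: tensor_of_basis_def frag_extend_add)
  qed
  moreover have "inj_on (tensor_iso S T) (carrier (free_Abelian_group (S \<times> T)))"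
  proof (rule inj_onI)
    fix c d assume cd: "c \<in> carrier (free_Abelian_group (S \<times> T))" "d \<in> carrier (free_Abelian_group (S \<times> T))"
      "tensor_iso S T c = tensor_iso S T d"
    then have "tensor_of_basis c - tensor_of_basis d \<in> R"
      unfolding tensor_iso_def by (intro tensor_class_eqD) (simp_all add: keys_tensor_of_basis)
    then have "ev (tensor_of_basis c - tensor_of_basis d) = 0" by (rule ev_rel)
    then have "ev (tensor_of_basis c) - ev (tensor_of_basis d) = 0" by (simp add: ev_def frag_extend_diff)
    then show "c = d" by (simp add: ev_basis)
  qed
  moreover have "carrier ?G \<subseteq> tensor_iso S T ` carrier (free_Abelian_group (S \<times> T))"
  proof
    fix X assume "X \<in> carrier ?G"
    then obtain c where c: "Poly_Mapping.keys c \<subseteq> carrier (free_Abelian_group S) \<times> carrier (free_Abelian_group T)"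
      and X: "X = tensor_class (free_Abelian_group S) (free_Abelian_group T) c"
      unfolding carrier_tensor_group by auto
    have k: "Poly_Mapping.keys (ev c) \<subseteq> S \<times> T"
      unfolding ev_def by (rule keys_frag_extend_subset[OF c], clarify, drule subsetD[OF keys_frag_tensor, rotated 2], auto)
    have "c - tensor_of_basis (ev c) \<in> R" using c
    proof (induction c rule: frag_induction)
      case (one q)
      then show ?case by (cases q) (simp add: ev_def expand_generator)
    next
      case (diff a b)
      have eq: "a - b - tensor_of_basis (ev (a - b)) = (a - tensor_of_basis (ev a)) - (b - tensor_of_basis (ev b))"
        by (simp add: ev_def tensor_of_basis_def frag_extend_diff)
      show ?case unfolding eq by (rule tensor_rel_diff[OF diff])
    qed (simp add: ev_def tensor_of_basis_def tensor_rel_0)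
    then have "X = tensor_iso S T (ev c)"
      unfolding X tensor_iso_def using c k by (intro tensor_class_eqI keys_tensor_of_basis)
    then show "X \<in> tensor_iso S T ` carrier (free_Abelian_group (S \<times> T))" using k by simp
  qed
  ultimately show ?thesis
    unfolding iso_def bij_betw_def using hom_carrier[OF hom] by blast
qed

lemma tensor_map_iso:
  assumes f: "f \<in> hom (free_Abelian_group S) (free_Abelian_group S')"
    and g: "g \<in> hom (free_Abelian_group T) (free_Abelian_group T')"
    and c: "Poly_Mapping.keys c \<subseteq> S \<times> T"
  shows "tensor_map (free_Abelian_group S') (free_Abelian_group T') f g (tensor_iso S T c) =
         tensor_iso S' T' (frag_extend (\<lambda>(s, t). frag_tensor (f (frag_of s)) (g (frag_of t))) c)"
proof -
  interpret tensor_setup "free_Abelian_group S'" "free_Abelian_group T'" by (rule tensor_setup_free)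
  let ?e = "frag_extend (\<lambda>(x, y). frag_of (f x, g y))"
  let ?t = "frag_extend (\<lambda>(s, t). frag_tensor (f (frag_of s)) (g (frag_of t)))"
  have f': "Poly_Mapping.keys (f (frag_of s)) \<subseteq> S'" if "s \<in> S" for s
    using hom_in_carrier[OF f, of "frag_of s"] that by simp
  have g': "Poly_Mapping.keys (g (frag_of s)) \<subseteq> T'" if "s \<in> T" for s
    using hom_in_carrier[OF g, of "frag_of s"] that by simp
  have k: "Poly_Mapping.keys (?t c) \<subseteq> S' \<times> T'"
  proof (rule keys_frag_extend_subset[OF c])
    fix q assume "q \<in> S \<times> T"
    then obtain s t where "q = (s, t)" "s \<in> S" "t \<in> T" by blast
    then show "Poly_Mapping.keys (case q of (s, t) \<Rightarrow> frag_tensor (f (frag_of s)) (g (frag_of t))) \<subseteq> S' \<times> T'"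
      using keys_frag_tensor[OF f' g'] by simp
  qed
  have k2: "Poly_Mapping.keys (?e (tensor_of_basis c)) \<subseteq> carrier (free_Abelian_group S') \<times> carrier (free_Abelian_group T')"
    by (rule keys_frag_extend_subset[OF keys_tensor_of_basis[OF c]])
       (auto simp del: carrier_free_Abelian_group_iff intro: hom_in_carrier[OF f] hom_in_carrier[OF g])
  have "?e (tensor_of_basis c) - tensor_of_basis (?t c) \<in> R" using c
  proof (induction c rule: frag_induction)
    case (one q)
    then show ?case
      using expand_generator[OF f'[of "fst q"] g'[of "snd q"]]
      by (cases q) (simp)
  next
    case (diff a b)
    have eq: "?e (tensor_of_basis (a - b)) - tensor_of_basis (?t (a - b)) =
        (?e (tensor_of_basis a) - tensor_of_basis (?t a)) - (?e (tensor_of_basis b) - tensor_of_basis (?t b))"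
      by (simp add: tensor_of_basis_def frag_extend_diff)
    show ?case unfolding eq by (rule tensor_rel_diff[OF diff])
  qed (simp add: tensor_of_basis_def tensor_rel_0)
  then have "tensor_class (free_Abelian_group S') (free_Abelian_group T') (?e (tensor_of_basis c)) = tensor_iso S' T' (?t c)"
    unfolding tensor_iso_def using k k2 by (intro tensor_class_eqI keys_tensor_of_basis)
  then show ?thesis
    unfolding tensor_iso_def[of S T]
    by (subst tensor_map_class[OF _ _ _ _ f g keys_tensor_of_basis[OF c]]) (simp_all add: abelian_free_Abelian_group)
qed

section \<open>Direct sums of free abelian groups\<close>

lemma lookup_frag_restrict:
  "Poly_Mapping.lookup (frag_restrict A c) x = (if x \<in> A then Poly_Mapping.lookup c x else 0)"
proof -
  have "Poly_Mapping.lookup (frag_restrict A c) x = (if x \<in> A then Poly_Mapping.lookup c x else 0)"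
    if "Poly_Mapping.keys c \<subseteq> UNIV" using that
  proof (induction c rule: frag_induction)
    case (one y)
    then show ?case by (simp add: frag_restrict_def)
  next
    case (diff a b)
    then show ?case by (simp add: frag_restrict_def frag_extend_diff lookup_minus)
  qed (simp add: frag_restrict_def)
  then show ?thesis by simp
qed

lemma frag_restrict_linear:
  "frag_restrict A (a + b) = frag_restrict A a + frag_restrict A b"
  "frag_restrict A (a - b) = frag_restrict A a - frag_restrict A b"
  "frag_restrict A (frag_cmul k a) = frag_cmul k (frag_restrict A a)"
  "frag_restrict A 0 = 0"
  "finite I \<Longrightarrow> frag_restrict A (sum f I) = (\<Sum>i\<in>I. frag_restrict A (f i))"
  by (simp_all add: frag_restrict_def frag_extend_linear frag_extend_sum comp_def)

lemma frag_restrict_id: "Poly_Mapping.keys c \<subseteq> A \<Longrightarrow> frag_restrict A c = c"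
  by (rule poly_mapping_eqI) (auto simp: lookup_frag_restrict in_keys_iff)

lemma frag_restrict_disjoint: "Poly_Mapping.keys c \<inter> A = {} \<Longrightarrow> frag_restrict A c = 0"
  by (rule poly_mapping_eqI) (auto simp: lookup_frag_restrict in_keys_iff)

lemma keys_frag_restrict_subset: "Poly_Mapping.keys (frag_restrict A c) \<subseteq> A"
  using keys_frag_restrict[of A c] by blast

definition sum_iso ::
  "'i set \<Rightarrow> ('i \<Rightarrow> 'a set) \<Rightarrow> ('i \<Rightarrow> ('a \<Rightarrow>\<^sub>0 int) \<Rightarrow> 'g) \<Rightarrow> ('a \<Rightarrow>\<^sub>0 int) \<Rightarrow> 'i \<Rightarrow> 'g" where
  "sum_iso K A t c = (\<lambda>k\<in>K. t k (frag_restrict (A k) c))"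

text \<open>Disjointness makes the number of nonzero restrictions finite, since each basis element of
  the chain contributes to one of them only.\<close>

lemma sum_iso_iso:
  assumes disj: "\<And>k k' x. k \<in> K \<Longrightarrow> k' \<in> K \<Longrightarrow> x \<in> A k \<Longrightarrow> x \<in> A k' \<Longrightarrow> k = k'"
    and t: "\<And>k. k \<in> K \<Longrightarrow> t k \<in> iso (free_Abelian_group (A k)) (G k)"
    and G: "\<And>k. k \<in> K \<Longrightarrow> group (G k)"
  shows "sum_iso K A t \<in> iso (free_Abelian_group (\<Union>k\<in>K. A k)) (sum_group K G)"
proof -
  let ?F = "free_Abelian_group (\<Union>k\<in>K. A k)"
  have res: "frag_restrict (A k) c \<in> carrier (free_Abelian_group (A k))" for k c
    using keys_frag_restrict[of "A k" c] by simp
  have t_hom: "t k \<in> hom (free_Abelian_group (A k)) (G k)" if "k \<in> K" for k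
    using t[OF that] by (simp add: iso_def)
  have t_bij: "bij_betw (t k) (carrier (free_Abelian_group (A k))) (carrier (G k))" if "k \<in> K" for k
    using t[OF that] by (simp add: iso_def)
  have t_0: "t k 0 = \<one>\<^bsub>G k\<^esub>" if "k \<in> K" for k
    using hom_one[OF t_hom[OF that] group_free_Abelian_group G[OF that]] by simp
  have carrier: "carrier (sum_group K G) = {x \<in> \<Pi>\<^sub>E i\<in>K. carrier (G i). finite {i \<in> K. x i \<noteq> \<one>\<^bsub>G i\<^esub>}}"
    by (rule carrier_sum_group[OF G])
  have hom: "sum_iso K A t \<in> hom ?F (sum_group K G)"
  proof (rule homI)
    fix c assume "c \<in> carrier ?F"
    have "{i \<in> K. sum_iso K A t c i \<noteq> \<one>\<^bsub>G i\<^esub>} \<subseteq> (\<Union>x \<in> Poly_Mapping.keys c. {i \<in> K. x \<in> A i})"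
    proof
      fix i assume i: "i \<in> {i \<in> K. sum_iso K A t c i \<noteq> \<one>\<^bsub>G i\<^esub>}"
      then have "frag_restrict (A i) c \<noteq> 0" using t_0 by (auto simp: sum_iso_def)
      then have "Poly_Mapping.keys c \<inter> A i \<noteq> {}" using frag_restrict_disjoint by metis
      then show "i \<in> (\<Union>x \<in> Poly_Mapping.keys c. {i \<in> K. x \<in> A i})" using i by blast
    qed
    moreover have "finite (\<Union>x \<in> Poly_Mapping.keys c. {i \<in> K. x \<in> A i})"
    proof (intro finite_UN_I finite_keys)
      fix x
      show "finite {i \<in> K. x \<in> A i}"
      proof (cases "{i \<in> K. x \<in> A i} = {}")
        case False
        then obtain i where "i \<in> K" "x \<in> A i" by blast
        then have "{i \<in> K. x \<in> A i} \<subseteq> {i}" using disj by blast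
        then show ?thesis by (rule finite_subset) simp
      next
        case True
        then show ?thesis by (simp only: finite.emptyI)
      qed
    qed
    ultimately have "finite {i \<in> K. sum_iso K A t c i \<noteq> \<one>\<^bsub>G i\<^esub>}" by (rule finite_subset)
    moreover have "sum_iso K A t c \<in> (\<Pi>\<^sub>E i\<in>K. carrier (G i))"
      unfolding sum_iso_def using hom_in_carrier[OF t_hom res] by simp
    ultimately show "sum_iso K A t c \<in> carrier (sum_group K G)"
      unfolding carrier by simp
  next
    fix c d
    show "sum_iso K A t (c \<otimes>\<^bsub>?F\<^esub> d) = sum_iso K A t c \<otimes>\<^bsub>sum_group K G\<^esub> sum_iso K A t d"
      using hom_mult[OF t_hom res res]
      by (auto simp: sum_iso_def frag_restrict_linear intro!: restrict_ext)
  qed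
  moreover have "inj_on (sum_iso K A t) (carrier ?F)"
  proof (rule inj_onI)
    fix c d assume cd: "c \<in> carrier ?F" "d \<in> carrier ?F" and eq: "sum_iso K A t c = sum_iso K A t d"
    have res_eq: "frag_restrict (A k) c = frag_restrict (A k) d" if k: "k \<in> K" for k
    proof -
      have "t k (frag_restrict (A k) c) = t k (frag_restrict (A k) d)"
        using fun_cong[OF eq, of k] k by (simp add: sum_iso_def)
      then show ?thesis
        using bij_betw_imp_inj_on[OF t_bij[OF k]] res by (meson inj_onD)
    qed
    show "c = d"
    proof (rule poly_mapping_eqI)
      fix x
      show "Poly_Mapping.lookup c x = Poly_Mapping.lookup d x"
      proof (cases "\<exists>k\<in>K. x \<in> A k")
        case True
        then obtain k where k: "k \<in> K" "x \<in> A k" by blast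
        then show ?thesis
          using arg_cong[OF res_eq[OF k(1)], of "\<lambda>c. Poly_Mapping.lookup c x"]
          by (simp add: lookup_frag_restrict)
      next
        case False
        then have "x \<notin> Poly_Mapping.keys c" "x \<notin> Poly_Mapping.keys d"
          using cd by auto
        then show ?thesis by (simp add: in_keys_iff)
      qed
    qed
  qed
  moreover have "carrier (sum_group K G) \<subseteq> sum_iso K A t ` carrier ?F"
  proof
    fix z assume z: "z \<in> carrier (sum_group K G)"
    define K0 where "K0 = {i \<in> K. z i \<noteq> \<one>\<^bsub>G i\<^esub>}"
    have fin: "finite K0" and zc: "z \<in> (\<Pi>\<^sub>E i\<in>K. carrier (G i))"
      using z unfolding carrier K0_def by auto
    define y where "y k = inv_into (carrier (free_Abelian_group (A k))) (t k) (z k)" for k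
    have y: "Poly_Mapping.keys (y k) \<subseteq> A k" "t k (y k) = z k" if k: "k \<in> K" for k
    proof -
      have "z k \<in> carrier (G k)" using zc k by (rule PiE_mem)
      then have "z k \<in> t k ` carrier (free_Abelian_group (A k))"
        using bij_betw_imp_surj_on[OF t_bij[OF k]] by simp
      from inv_into_into[OF this] f_inv_into_f[OF this]
      show "Poly_Mapping.keys (y k) \<subseteq> A k" "t k (y k) = z k"
        unfolding y_def carrier_free_Abelian_group_iff by simp_all
    qed
    define c where "c = (\<Sum>k\<in>K0. y k)"
    have c: "c \<in> carrier ?F"
      unfolding c_def using y(1) by (auto simp: K0_def intro!: keys_sum_subset) 
    have res_y: "frag_restrict (A k) (y k') = (if k' = k then y k else 0)" if k: "k \<in> K" "k' \<in> K" for k k'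
    proof (cases "k' = k")
      case True
      then show ?thesis using y(1)[OF k(1)] by (simp add: frag_restrict_id)
    next
      case False
      then have "Poly_Mapping.keys (y k') \<inter> A k = {}" using y(1)[OF k(2)] disj k by blast
      then show ?thesis using False by (simp add: frag_restrict_disjoint)
    qed
    have "t k (frag_restrict (A k) c) = z k" if k: "k \<in> K" for k
    proof -
      have "frag_restrict (A k) c = (\<Sum>k'\<in>K0. if k' = k then y k else 0)"
        unfolding c_def frag_restrict_linear(5)[OF fin]
        by (rule sum.cong[OF refl]) (use res_y[OF k] in \<open>simp add: K0_def\<close>)
      also have "\<dots> = (if k \<in> K0 then y k else 0)" using fin by simp
      finally show ?thesis using y(2)[OF k] t_0[OF k] k by (auto simp: K0_def)
    qed
    then have "sum_iso K A t c = z"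
      using zc by (auto simp: sum_iso_def fun_eq_iff PiE_def extensional_def)
    then show "z \<in> sum_iso K A t ` carrier ?F" using c by blast
  qed
  ultimately show ?thesis
    unfolding iso_def bij_betw_def using hom_carrier[OF hom] by blast
qed

lemma comm_group_sum_group:
  assumes "\<And>k. k \<in> K \<Longrightarrow> comm_group (G k)" shows "comm_group (sum_group K G)"
proof (rule group.group_comm_groupI)
  have G: "group (G k)" if "k \<in> K" for k using assms[OF that] by (simp add: comm_group_def)
  show "group (sum_group K G)" using G by simp
  fix x y assume "x \<in> carrier (sum_group K G)" "y \<in> carrier (sum_group K G)"
  then have "x k \<in> carrier (G k)" "y k \<in> carrier (G k)" if "k \<in> K" for k
    using that by (auto simp: carrier_sum_group[OF G])
  then show "x \<otimes>\<^bsub>sum_group K G\<^esub> y = y \<otimes>\<^bsub>sum_group K G\<^esub> x"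
    using assms by (auto simp: comm_groupE(4) intro!: restrict_ext)
qed

section \<open>Sums and tensor products of free complexes\<close>

text \<open>Restriction to a part of the basis commutes with the boundary, because the boundary of a
  basis element stays in its own part and the parts are disjoint.\<close>

lemma sum_complex_sum_iso:
  assumes pf: "\<And>k x. k \<in> K \<Longrightarrow> x \<in> A k (Suc n) \<Longrightarrow> Poly_Mapping.keys (pf x) \<subseteq> A k n"
    and disj: "\<And>k k' x. k \<in> K \<Longrightarrow> k' \<in> K \<Longrightarrow> x \<in> A k n \<Longrightarrow> x \<in> A k' n \<Longrightarrow> k = k'"
      "\<And>k k' x. k \<in> K \<Longrightarrow> k' \<in> K \<Longrightarrow> x \<in> A k (Suc n) \<Longrightarrow> x \<in> A k' (Suc n) \<Longrightarrow> k = k'"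
    and t: "\<And>k c. k \<in> K \<Longrightarrow> Poly_Mapping.keys c \<subseteq> A k (Suc n) \<Longrightarrow>
        t k n (frag_extend pf c) = dif (C k) (Suc n) (t k (Suc n) c)"
    and c: "Poly_Mapping.keys c \<subseteq> (\<Union>k\<in>K. A k (Suc n))"
  shows "sum_iso K (\<lambda>k. A k n) (\<lambda>k. t k n) (frag_extend pf c) =
    dif (sum_complex K C) (Suc n) (sum_iso K (\<lambda>k. A k (Suc n)) (\<lambda>k. t k (Suc n)) c)"
proof -
  have restrict: "frag_restrict (A k n) (frag_extend pf c) = frag_extend pf (frag_restrict (A k (Suc n)) c)"
    if k: "k \<in> K" for k
    using c
  proof (rule frag_additive_eq[where F = "\<lambda>c. frag_restrict (A k n) (frag_extend pf c)"
        and G = "\<lambda>c. frag_extend pf (frag_restrict (A k (Suc n)) c)"])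
    fix x assume "x \<in> (\<Union>k\<in>K. A k (Suc n))"
    then obtain k' where k': "k' \<in> K" "x \<in> A k' (Suc n)" by blast
    show "frag_restrict (A k n) (frag_extend pf (frag_of x)) = frag_extend pf (frag_restrict (A k (Suc n)) (frag_of x))"
    proof (cases "k' = k")
      case True
      then show ?thesis using pf[OF k'] k' by (simp add: frag_restrict_id)
    next
      case False
      then have "x \<notin> A k (Suc n)" using disj(2)[OF k'(1) k k'(2)] by auto
      moreover have "Poly_Mapping.keys (pf x) \<inter> A k n = {}"
        using pf[OF k'] disj(1)[OF k'(1) k] False by blast
      ultimately show ?thesis by (simp add: frag_restrict_disjoint)
    qed
  qed (simp_all add: frag_restrict_linear frag_extend_diff)
  have "t k n (frag_restrict (A k n) (frag_extend pf c)) =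
      dif (C k) (Suc n) (t k (Suc n) (frag_restrict (A k (Suc n)) c))" if k: "k \<in> K" for k
    unfolding restrict[OF k] by (rule t[OF k keys_frag_restrict_subset])
  then show ?thesis
    by (simp add: sum_iso_def sum_complex_def cong: restrict_cong)
qed

text \<open>The component of a boundary in bidegree \<open>(i, j)\<close> comes from the components of the chain in
  bidegrees \<open>(i + 1, j)\<close> and \<open>(i, j + 1)\<close>.  The differentials in degree 0 are required to vanish in
  order that the formula for \<open>pf\<close> makes sense in all bidegrees.\<close>

lemma tensor_complex_sum_iso:
  fixes C :: "('a \<Rightarrow>\<^sub>0 int) chain_cplx" and D :: "('b \<Rightarrow>\<^sub>0 int) chain_cplx"
  assumes C: "\<And>i. grp C i = free_Abelian_group (S i)" "\<And>i. dif C (Suc i) \<in> hom (grp C (Suc i)) (grp C i)"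
    and D: "\<And>j. grp D j = free_Abelian_group (T j)" "\<And>j. dif D (Suc j) \<in> hom (grp D (Suc j)) (grp D j)"
    and disj: "\<And>i i' s. s \<in> S i \<Longrightarrow> s \<in> S i' \<Longrightarrow> i = i'" "\<And>j j' t. t \<in> T j \<Longrightarrow> t \<in> T j' \<Longrightarrow> j = j'"
    and zero: "\<And>s. s \<in> S 0 \<Longrightarrow> dif C 0 (frag_of s) = 0" "\<And>t. t \<in> T 0 \<Longrightarrow> dif D 0 (frag_of t) = 0"
    and pf: "\<And>i j s t. i + j = Suc n \<Longrightarrow> s \<in> S i \<Longrightarrow> t \<in> T j \<Longrightarrow>
        pf (s, t) = frag_tensor (dif C i (frag_of s)) (frag_of t) +
                    frag_cmul ((-1) ^ i) (frag_tensor (frag_of s) (dif D j (frag_of t)))"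
    and c: "Poly_Mapping.keys c \<subseteq> (\<Union>(i, j) \<in> {(i, j). i + j = Suc n}. S i \<times> T j)"
  shows "sum_iso {(i, j). i + j = n} (\<lambda>(i, j). S i \<times> T j) (\<lambda>(i, j). tensor_iso (S i) (T j)) (frag_extend pf c) =
    dif (tensor_complex C D) (Suc n)
      (sum_iso {(i, j). i + j = Suc n} (\<lambda>(i, j). S i \<times> T j) (\<lambda>(i, j). tensor_iso (S i) (T j)) c)"
proof -
  have kC: "Poly_Mapping.keys (dif C (Suc i) (frag_of s)) \<subseteq> S i" if "s \<in> S (Suc i)" for i s
    using hom_in_carrier[OF C(2)[of i], of "frag_of s"] that by (simp add: C(1))
  have kD: "Poly_Mapping.keys (dif D (Suc i) (frag_of s)) \<subseteq> T i" if "s \<in> T (Suc i)" for i s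
    using hom_in_carrier[OF D(2)[of i], of "frag_of s"] that by (simp add: D(1))
  define a where "a i = frag_extend (\<lambda>(s, t). frag_tensor (dif C (Suc i) (frag_of s)) (frag_of t :: 'b \<Rightarrow>\<^sub>0 int))" for i
  define b where "b j = frag_extend (\<lambda>(s, t). frag_tensor (frag_of s :: 'a \<Rightarrow>\<^sub>0 int) (dif D (Suc j) (frag_of t)))" for j
  have ka: "Poly_Mapping.keys (a i d) \<subseteq> S i \<times> T j" if "Poly_Mapping.keys d \<subseteq> S (Suc i) \<times> T j" for i j d
    unfolding a_def
  proof (rule keys_frag_extend_subset[OF that])
    fix q assume "q \<in> S (Suc i) \<times> T j"
    then show "Poly_Mapping.keys (case q of (s, t) \<Rightarrow> frag_tensor (dif C (Suc i) (frag_of s)) (frag_of t)) \<subseteq> S i \<times> T j"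
      using keys_frag_tensor[OF kC, of "fst q" i "frag_of (snd q)" "T j"] by (cases q) simp
  qed
  have kb: "Poly_Mapping.keys (b j d) \<subseteq> S i \<times> T j" if "Poly_Mapping.keys d \<subseteq> S i \<times> T (Suc j)" for i j d
    unfolding b_def
  proof (rule keys_frag_extend_subset[OF that])
    fix q assume "q \<in> S i \<times> T (Suc j)"
    then show "Poly_Mapping.keys (case q of (s, t) \<Rightarrow> frag_tensor (frag_of s) (dif D (Suc j) (frag_of t))) \<subseteq> S i \<times> T j"
      using keys_frag_tensor[OF _ kD, of "frag_of (fst q)" "S i" "snd q" j] by (cases q) simp
  qed
  have split: "frag_restrict (S i \<times> T j) (frag_extend pf c) =
      a i (frag_restrict (S (Suc i) \<times> T j) c) + frag_cmul ((-1) ^ i) (b j (frag_restrict (S i \<times> T (Suc j)) c))"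
    if ij: "i + j = n" for i j
    using c
  proof (rule frag_additive_eq[where F = "\<lambda>c. frag_restrict (S i \<times> T j) (frag_extend pf c)"
        and G = "\<lambda>c. a i (frag_restrict (S (Suc i) \<times> T j) c) + frag_cmul ((-1) ^ i) (b j (frag_restrict (S i \<times> T (Suc j)) c))"])
    fix q assume "q \<in> (\<Union>(i, j) \<in> {(i, j). i + j = Suc n}. S i \<times> T j)"
    then obtain i' j' s t where q: "q = (s, t)" "s \<in> S i'" "t \<in> T j'" "i' + j' = Suc n" by auto
    have 1: "frag_restrict (S i \<times> T j) (frag_tensor (dif C i' (frag_of s)) (frag_of t)) =
        a i (frag_restrict (S (Suc i) \<times> T j) (frag_of q))"
    proof (cases "i' = Suc i")
      case True
      then have "j' = j" using q ij by simp
      then have "Poly_Mapping.keys (a i (frag_of q)) \<subseteq> S i \<times> T j"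
        using q True by (intro ka) simp
      then show ?thesis using q True \<open>j' = j\<close> by (simp add: frag_restrict_id a_def)
    next
      case False
      then have "q \<notin> S (Suc i) \<times> T j" using q disj(1) by auto
      then have r: "a i (frag_restrict (S (Suc i) \<times> T j) (frag_of q)) = 0"
        by (simp add: frag_restrict_disjoint a_def)
      show ?thesis
      proof (cases i')
        case 0
        then show ?thesis using r zero(1) q by (simp add: frag_tensor_simps frag_restrict_linear)
      next
        case (Suc m)
        then have "Poly_Mapping.keys (frag_tensor (dif C i' (frag_of s)) (frag_of t)) \<subseteq> S m \<times> T j'"
          using q by (intro keys_frag_tensor) (auto intro: kC[THEN subsetD])
        moreover have "S m \<inter> S i = {}" using disj(1)[of _ m i] False Suc by auto
        ultimately show ?thesis using r by (subst frag_restrict_disjoint) auto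
      qed
    qed
    have 2: "frag_restrict (S i \<times> T j) (frag_cmul ((-1) ^ i') (frag_tensor (frag_of s) (dif D j' (frag_of t)))) =
        frag_cmul ((-1) ^ i) (b j (frag_restrict (S i \<times> T (Suc j)) (frag_of q)))"
    proof (cases "j' = Suc j")
      case True
      then have "i' = i" using q ij by simp
      then have "Poly_Mapping.keys (b j (frag_of q)) \<subseteq> S i \<times> T j"
        using q True by (intro kb) simp
      then show ?thesis using q True \<open>i' = i\<close> by (simp add: frag_restrict_id frag_restrict_linear b_def)
    next
      case False
      then have "q \<notin> S i \<times> T (Suc j)" using q disj(2) by auto
      then have r: "b j (frag_restrict (S i \<times> T (Suc j)) (frag_of q)) = 0"
        by (simp add: frag_restrict_disjoint b_def)
      show ?thesis
      proof (cases j')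
        case 0
        then show ?thesis using r zero(2) q by (simp add: frag_tensor_simps frag_restrict_linear)
      next
        case (Suc m)
        then have "Poly_Mapping.keys (frag_tensor (frag_of s) (dif D j' (frag_of t))) \<subseteq> S i' \<times> T m"
          using q by (intro keys_frag_tensor) (auto intro: kD[THEN subsetD])
        moreover have "T m \<inter> T j = {}" using disj(2)[of _ m j] False Suc by auto
        ultimately have "frag_restrict (S i \<times> T j) (frag_tensor (frag_of s) (dif D j' (frag_of t))) = 0"
          by (intro frag_restrict_disjoint) auto
        then show ?thesis using r by (simp add: frag_restrict_linear)
      qed
    qed
    show "frag_restrict (S i \<times> T j) (frag_extend pf (frag_of q)) =
        a i (frag_restrict (S (Suc i) \<times> T j) (frag_of q)) +
        frag_cmul ((-1) ^ i) (b j (frag_restrict (S i \<times> T (Suc j)) (frag_of q)))"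
      using pf[OF q(4,2,3)] 1 2 q(1) by (simp only: frag_extend_of frag_restrict_linear(1))
  qed (simp_all add: frag_restrict_linear frag_extend_diff a_def b_def frag_cmul_diff)
  have comp: "tensor_iso (S i) (T j) (frag_restrict (S i \<times> T j) (frag_extend pf c)) =
      tensor_map (grp C i) (grp D j) (dif C (Suc i)) (\<lambda>y. y) (tensor_iso (S (Suc i)) (T j) (frag_restrict (S (Suc i) \<times> T j) c))
      \<otimes>\<^bsub>tensor_group (grp C i) (grp D j)\<^esub>
      (tensor_map (grp C i) (grp D j) (\<lambda>x. x) (dif D (Suc j)) (tensor_iso (S i) (T (Suc j)) (frag_restrict (S i \<times> T (Suc j)) c))
        [^]\<^bsub>tensor_group (grp C i) (grp D j)\<^esub> ((-1) ^ i :: int))"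
    if ij: "i + j = n" for i j
  proof -
    let ?G = "tensor_group (free_Abelian_group (S i)) (free_Abelian_group (T j))"
    let ?u = "a i (frag_restrict (S (Suc i) \<times> T j) c)" and ?v = "b j (frag_restrict (S i \<times> T (Suc j)) c)"
    have h: "tensor_iso (S i) (T j) \<in> hom (free_Abelian_group (S i \<times> T j)) ?G"
      using tensor_iso_iso[of "S i" "T j"] by (simp add: iso_def)
    have ku: "Poly_Mapping.keys ?u \<subseteq> S i \<times> T j" by (intro ka keys_frag_restrict_subset)
    have kv: "Poly_Mapping.keys ?v \<subseteq> S i \<times> T j" by (intro kb keys_frag_restrict_subset)
    have gG: "group ?G"
      using tensor_setup.comm_group_tensor_group[OF tensor_setup_free] by (rule comm_group.axioms(2))
    have id: "(\<lambda>y. y) \<in> hom (free_Abelian_group X) (free_Abelian_group X)" for X :: "'x set"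
      by (simp add: hom_def)
    have "tensor_iso (S i) (T j) (?u + frag_cmul ((-1) ^ i) ?v) =
        tensor_iso (S i) (T j) ?u \<otimes>\<^bsub>?G\<^esub> tensor_iso (S i) (T j) (frag_cmul ((-1) ^ i) ?v)"
      using hom_mult[OF h, of ?u "frag_cmul ((-1) ^ i) ?v"] ku keys_cmul_subset[OF kv] by simp
    also have "tensor_iso (S i) (T j) (frag_cmul ((-1) ^ i) ?v) = tensor_iso (S i) (T j) ?v [^]\<^bsub>?G\<^esub> ((-1) ^ i :: int)"
      using hom_int_pow[OF h, of ?v "(-1) ^ i"] int_pow_free_Abelian_group[OF kv] kv gG by simp
    also have "tensor_iso (S i) (T j) ?u = tensor_map (free_Abelian_group (S i)) (free_Abelian_group (T j))
        (dif C (Suc i)) (\<lambda>y. y) (tensor_iso (S (Suc i)) (T j) (frag_restrict (S (Suc i) \<times> T j) c))"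
      unfolding a_def using C(2)[of i] unfolding C(1)
      by (rule tensor_map_iso[OF _ id keys_frag_restrict_subset, symmetric])
    also have "tensor_iso (S i) (T j) ?v = tensor_map (free_Abelian_group (S i)) (free_Abelian_group (T j))
        (\<lambda>x. x) (dif D (Suc j)) (tensor_iso (S i) (T (Suc j)) (frag_restrict (S i \<times> T (Suc j)) c))"
      unfolding b_def using D(2)[of j] unfolding D(1)
      by (rule tensor_map_iso[OF id _ keys_frag_restrict_subset, symmetric])
    finally show ?thesis unfolding split[OF ij] C(1) D(1) .
  qed
  show ?thesis
    unfolding sum_iso_def tensor_complex_def
    by (auto simp: comp intro!: restrict_ext)
qed

section \<open>Transport along isomorphisms\<close>

lemma chain_homotopy_equivalent_iso:
  assumes CQ: "chain_homotopy_equivalent C Q"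
    and t: "\<And>n. t n \<in> iso (grp Q n) (grp D n)"
    and dif: "\<And>n x. x \<in> carrier (grp Q (Suc n)) \<Longrightarrow> t n (dif Q (Suc n) x) = dif D (Suc n) (t (Suc n) x)"
    and D: "\<And>n. comm_group (grp D n)"
  shows "chain_homotopy_equivalent C D"
proof -
  obtain f g where C: "chain_complex C" and Q: "chain_complex Q" and f: "chain_map C Q f" and g: "chain_map Q C g"
    and gf: "chain_homotopic C C (\<lambda>n x. g n (f n x)) (\<lambda>n x. x)"
    and fg: "chain_homotopic Q Q (\<lambda>n y. f n (g n y)) (\<lambda>n y. y)"
    using CQ unfolding chain_homotopy_equivalent_def by blast
  define s where "s n = inv_into (carrier (grp Q n)) (t n)" for n
  have gQ: "group (grp Q n)" for n using Q by (simp add: chain_complex_def comm_group_def)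
  have gD: "group (grp D n)" for n using D by (simp add: comm_group_def)
  have t_hom: "t n \<in> hom (grp Q n) (grp D n)" for n using t by (simp add: iso_def)
  have s_hom: "s n \<in> hom (grp D n) (grp Q n)" for n
    using group.iso_set_sym[OF gQ t, of n] unfolding s_def by (simp add: iso_def)
  have bij: "bij_betw (t n) (carrier (grp Q n)) (carrier (grp D n))" for n using t by (simp add: iso_def)
  have st: "s n (t n x) = x" if "x \<in> carrier (grp Q n)" for n x
    unfolding s_def using bij_betw_inv_into_left[OF bij that] .
  have ts: "t n (s n y) = y" if "y \<in> carrier (grp D n)" for n y
    unfolding s_def using bij_betw_inv_into_right[OF bij that] .
  have tc: "t n x \<in> carrier (grp D n)" if "x \<in> carrier (grp Q n)" for n x
    using hom_in_carrier[OF t_hom that] .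
  have sc: "s n x \<in> carrier (grp Q n)" if "x \<in> carrier (grp D n)" for n x
    using hom_in_carrier[OF s_hom that] .
  have dQ: "dif Q (Suc n) \<in> hom (grp Q (Suc n)) (grp Q n)" for n
    using Q by (simp add: chain_complex_def)
  have dQc: "dif Q (Suc n) x \<in> carrier (grp Q n)" if "x \<in> carrier (grp Q (Suc n))" for n x
    using hom_in_carrier[OF dQ that] .
  have difD: "dif D (Suc n) y = t n (dif Q (Suc n) (s (Suc n) y))" if "y \<in> carrier (grp D (Suc n))" for n y
    using dif[OF sc[OF that]] ts[OF that] by simp
  have sdif: "s n (dif D (Suc n) y) = dif Q (Suc n) (s (Suc n) y)" if "y \<in> carrier (grp D (Suc n))" for n y
    using difD[OF that] st dQc sc that by simp
  have f_hom: "f n \<in> hom (grp C n) (grp Q n)" and g_hom: "g n \<in> hom (grp Q n) (grp C n)" for n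
    using f g by (simp_all add: chain_map_def)
  have fc: "f n x \<in> carrier (grp Q n)" if "x \<in> carrier (grp C n)" for n x
    using hom_in_carrier[OF f_hom that] .
  have gc: "g n x \<in> carrier (grp C n)" if "x \<in> carrier (grp Q n)" for n x
    using hom_in_carrier[OF g_hom that] .
  have dC: "dif C (Suc n) x \<in> carrier (grp C n)" if "x \<in> carrier (grp C (Suc n))" for n x
    using C that by (auto simp: chain_complex_def dest: hom_in_carrier)
  have dD_hom: "dif D (Suc n) \<in> hom (grp D (Suc n)) (grp D n)" for n
  proof -
    have hom: "t n \<circ> (dif Q (Suc n) \<circ> s (Suc n)) \<in> hom (grp D (Suc n)) (grp D n)"
      by (rule hom_compose[OF hom_compose[OF s_hom dQ] t_hom])
    interpret Dn: group "grp D (Suc n)" by (rule gD)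
    show ?thesis
    proof (rule homI)
      fix x y assume xy: "x \<in> carrier (grp D (Suc n))" "y \<in> carrier (grp D (Suc n))"
      show "dif D (Suc n) x \<in> carrier (grp D n)"
        using hom_in_carrier[OF hom xy(1)] by (simp add: difD[OF xy(1)])
      show "dif D (Suc n) (x \<otimes>\<^bsub>grp D (Suc n)\<^esub> y) = dif D (Suc n) x \<otimes>\<^bsub>grp D n\<^esub> dif D (Suc n) y"
        using hom_mult[OF hom xy] by (simp add: difD[OF xy(1)] difD[OF xy(2)] difD[OF Dn.m_closed[OF xy]])
    qed
  qed
  have cD: "chain_complex D"
    unfolding chain_complex_def
  proof (intro conjI allI ballI D dD_hom)
    fix n x assume x: "x \<in> carrier (grp D (Suc (Suc n)))"
    have "dif D (Suc n) (dif D (Suc (Suc n)) x) = t n (dif Q (Suc n) (dif Q (Suc (Suc n)) (s (Suc (Suc n)) x)))"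
      using difD[OF hom_in_carrier[OF dD_hom x]] sdif[OF x] by simp
    also have "dif Q (Suc n) (dif Q (Suc (Suc n)) (s (Suc (Suc n)) x)) = \<one>\<^bsub>grp Q n\<^esub>"
      using Q sc[OF x] by (simp add: chain_complex_def)
    also have "t n \<one>\<^bsub>grp Q n\<^esub> = \<one>\<^bsub>grp D n\<^esub>" by (rule hom_one[OF t_hom gQ gD])
    finally show "dif D (Suc n) (dif D (Suc (Suc n)) x) = \<one>\<^bsub>grp D n\<^esub>" .
  qed
  let ?f = "\<lambda>n x. t n (f n x)" and ?g = "\<lambda>n y. g n (s n y)"
  have mf: "chain_map C D ?f"
    unfolding chain_map_def
  proof (intro conjI allI ballI)
    show "?f n \<in> hom (grp C n) (grp D n)" for n
      using hom_compose[OF f_hom t_hom] by (simp add: comp_def)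
    show "?f n (dif C (Suc n) x) = dif D (Suc n) (?f (Suc n) x)" if "x \<in> carrier (grp C (Suc n))" for n x
      using f that fc[OF that] by (simp add: chain_map_def dif)
  qed
  have mg: "chain_map D C ?g"
    unfolding chain_map_def
  proof (intro conjI allI ballI)
    show "?g n \<in> hom (grp D n) (grp C n)" for n
      using hom_compose[OF s_hom g_hom] by (simp add: comp_def)
    show "?g n (dif D (Suc n) x) = dif C (Suc n) (?g (Suc n) x)" if "x \<in> carrier (grp D (Suc n))" for n x
      using g sc[OF that] by (simp add: chain_map_def sdif[OF that])
  qed
  have hC: "chain_homotopic C C (\<lambda>n x. ?g n (?f n x)) (\<lambda>n x. x)"
    using gf unfolding chain_homotopic_def by (simp add: st fc)
  have hD: "chain_homotopic D D (\<lambda>n y. ?f n (?g n y)) (\<lambda>n y. y)"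
  proof -
    obtain h where h_hom: "\<And>n. h n \<in> hom (grp Q n) (grp Q (Suc n))"
      and h0: "\<And>x. x \<in> carrier (grp Q 0) \<Longrightarrow>
             f 0 (g 0 x) \<otimes>\<^bsub>grp Q 0\<^esub> inv\<^bsub>grp Q 0\<^esub> x = dif Q (Suc 0) (h 0 x)"
      and hS: "\<And>n x. x \<in> carrier (grp Q (Suc n)) \<Longrightarrow>
             f (Suc n) (g (Suc n) x) \<otimes>\<^bsub>grp Q (Suc n)\<^esub> inv\<^bsub>grp Q (Suc n)\<^esub> x
             = dif Q (Suc (Suc n)) (h (Suc n) x) \<otimes>\<^bsub>grp Q (Suc n)\<^esub> h n (dif Q (Suc n) x)"
      using fg unfolding chain_homotopic_def by blast
    have hc: "h n x \<in> carrier (grp Q (Suc n))" if "x \<in> carrier (grp Q n)" for n x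
      using hom_in_carrier[OF h_hom that] .
    have lhs: "?f n (?g n y) \<otimes>\<^bsub>grp D n\<^esub> inv\<^bsub>grp D n\<^esub> y =
        t n (f n (g n (s n y)) \<otimes>\<^bsub>grp Q n\<^esub> inv\<^bsub>grp Q n\<^esub> (s n y))" if y: "y \<in> carrier (grp D n)" for n y
    proof -
      interpret group_hom "grp Q n" "grp D n" "t n"
        using gQ gD t_hom by (simp add: group_hom_def group_hom_axioms_def)
      show ?thesis using fc[OF gc[OF sc[OF y]]] sc[OF y] ts[OF y] by simp
    qed
    show ?thesis
      unfolding chain_homotopic_def
    proof (intro exI[of _ "\<lambda>n y. t (Suc n) (h n (s n y))"] conjI allI ballI)
      show "(\<lambda>y. t (Suc n) (h n (s n y))) \<in> hom (grp D n) (grp D (Suc n))" for n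
        using hom_compose[OF s_hom hom_compose[OF h_hom t_hom]] by (simp add: comp_def)
    next
      fix y assume y: "y \<in> carrier (grp D 0)"
      show "?f 0 (?g 0 y) \<otimes>\<^bsub>grp D 0\<^esub> inv\<^bsub>grp D 0\<^esub> y = dif D (Suc 0) (t (Suc 0) (h 0 (s 0 y)))"
        unfolding lhs[OF y] h0[OF sc[OF y]] by (rule dif[OF hc[OF sc[OF y]]])
    next
      fix n y assume y: "y \<in> carrier (grp D (Suc n))"
      have "t (Suc n) (dif Q (Suc (Suc n)) (h (Suc n) (s (Suc n) y)) \<otimes>\<^bsub>grp Q (Suc n)\<^esub> h n (dif Q (Suc n) (s (Suc n) y)))
         = t (Suc n) (dif Q (Suc (Suc n)) (h (Suc n) (s (Suc n) y))) \<otimes>\<^bsub>grp D (Suc n)\<^esub> t (Suc n) (h n (dif Q (Suc n) (s (Suc n) y)))"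
        using sc[OF y] by (intro hom_mult[OF t_hom] dQc hc)
      then show "?f (Suc n) (?g (Suc n) y) \<otimes>\<^bsub>grp D (Suc n)\<^esub> inv\<^bsub>grp D (Suc n)\<^esub> y =
          dif D (Suc (Suc n)) (t (Suc (Suc n)) (h (Suc n) (s (Suc n) y))) \<otimes>\<^bsub>grp D (Suc n)\<^esub>
          t (Suc n) (h n (s n (dif D (Suc n) y)))"
        unfolding lhs[OF y] hS[OF sc[OF y]] sdif[OF y] by (simp add: dif[OF hc[OF sc[OF y]]])
    qed
  qed
  show ?thesis
    unfolding chain_homotopy_equivalent_def using C cD mf mg hC hD by blast
qed

section \<open>The complex of pairs as a sum of tensor products\<close>

lemma magnitude_boundary_hom:
  "magnitude_boundary X (Suc n) \<in> hom (free_Abelian_group (magnitude_tuples X l (Suc n)))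
     (free_Abelian_group (magnitude_tuples X l n))"
proof (rule homI)
  fix c assume "c \<in> carrier (free_Abelian_group (magnitude_tuples X l (Suc n)))"
  then have c: "Poly_Mapping.keys c \<subseteq> magnitude_tuples X l (Suc n)" by simp
  show "magnitude_boundary X (Suc n) c \<in> carrier (free_Abelian_group (magnitude_tuples X l n))"
    unfolding magnitude_boundary_eq[OF c] carrier_free_Abelian_group_iff
    by (rule keys_frag_extend_subset[OF c]) (rule keys_face_sum)
qed (simp add: magnitude_boundary_def frag_extend_add)

lemma magnitude_boundary_frag_of:
  "xs \<in> magnitude_tuples X l n \<Longrightarrow> magnitude_boundary X n (frag_of xs) = face_sum X xs"
  using magnitude_boundary_eq[of "frag_of xs" X l n] by simp

lemma magnitude_tuples_degree:
  "xs \<in> magnitude_tuples X l m \<Longrightarrow> xs \<in> magnitude_tuples X l' n \<Longrightarrow> m = n"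
  by (simp add: magnitude_tuples_iff)

context pointed_metric_fibration
begin

definition bigraded :: "real \<times> real \<Rightarrow> nat \<times> nat \<Rightarrow> ('a list \<times> 'b list) set" where
  "bigraded = (\<lambda>(lv, lh) (i, j). magnitude_tuples F lv i \<times> magnitude_tuples B lh j)"

definition splittings :: "real \<Rightarrow> (real \<times> real) set" where
  "splittings l = {(lv, lh). 0 \<le> lv \<and> 0 \<le> lh \<and> lv + lh = l}"

definition tensor_part :: "real \<times> real \<Rightarrow> nat \<Rightarrow> ('a list \<times> 'b list) set" where
  "tensor_part k n = (\<Union>ij \<in> {(i, j). i + j = n}. bigraded k ij)"

abbreviation tensor_cplx where
  "tensor_cplx \<equiv> (\<lambda>(lv, lh). tensor_complex (magnitude_complex F lv) (magnitude_complex B lh))"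

definition tensor_part_iso where
  "tensor_part_iso k n = sum_iso {(i, j). i + j = n} (bigraded k)
     (\<lambda>(i, j). tensor_iso (magnitude_tuples F (fst k) i) (magnitude_tuples B (snd k) j))"

lemma pairs_eq: "pairs l n = (\<Union>k \<in> splittings l. tensor_part k n)"
proof (intro equalityI subsetI)
  fix q assume "q \<in> pairs l n"
  then obtain fs bs i j lv lh where q: "q = (fs, bs)" "i + j = n" "lv + lh = l"
    "fs \<in> magnitude_tuples F lv i" "bs \<in> magnitude_tuples B lh j" unfolding pairs_def by blast
  then have "0 \<le> lv" "0 \<le> lh"
    using path_length_nonneg[of F fs] path_length_nonneg[of B bs] by (simp_all add: magnitude_tuples_iff)
  then have "(lv, lh) \<in> splittings l" using q by (simp add: splittings_def)
  moreover have "q \<in> tensor_part (lv, lh) n"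
    unfolding tensor_part_def bigraded_def using q by auto
  ultimately show "q \<in> (\<Union>k \<in> splittings l. tensor_part k n)" by blast
qed (auto simp: splittings_def tensor_part_def bigraded_def pairs_def)

text \<open>The lengths and degrees of its entries determine the index of a pair.\<close>

lemma bigraded_disjoint: "q \<in> bigraded k ij \<Longrightarrow> q \<in> bigraded k' ij' \<Longrightarrow> k = k' \<and> ij = ij'"
  unfolding bigraded_def by (cases k; cases ij; cases k'; cases ij') (auto simp: magnitude_tuples_iff)

lemma grp_tensor_cplx: "grp (tensor_cplx k) n = sum_group {(i, j). i + j = n}
    (\<lambda>(i, j). tensor_group (free_Abelian_group (magnitude_tuples F (fst k) i)) (free_Abelian_group (magnitude_tuples B (snd k) j)))"
  by (cases k) (simp add: tensor_complex_def magnitude_complex_def)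

lemma comm_group_tensor_cplx: "comm_group (grp (tensor_cplx k) n)"
  unfolding grp_tensor_cplx
  by (rule comm_group_sum_group) (auto intro: tensor_setup.comm_group_tensor_group[OF tensor_setup_free])

lemma tensor_part_iso: "tensor_part_iso k n \<in> iso (free_Abelian_group (tensor_part k n)) (grp (tensor_cplx k) n)"
  unfolding tensor_part_iso_def tensor_part_def grp_tensor_cplx
proof (rule sum_iso_iso)
  show "ij = ij'" if "q \<in> bigraded k ij" "q \<in> bigraded k ij'" for ij ij' q
    using bigraded_disjoint that by blast
  fix ij :: "nat \<times> nat"
  obtain i j where ij: "ij = (i, j)" by (cases ij)
  obtain lv lh where k: "k = (lv, lh)" by (cases k)
  show "(case ij of (i, j) \<Rightarrow> tensor_iso (magnitude_tuples F (fst k) i) (magnitude_tuples B (snd k) j)) \<in>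
    iso (free_Abelian_group (bigraded k ij)) (case ij of (i, j) \<Rightarrow>
      tensor_group (free_Abelian_group (magnitude_tuples F (fst k) i)) (free_Abelian_group (magnitude_tuples B (snd k) j)))"
    by (simp add: ij k bigraded_def tensor_iso_iso)
  show "group (case ij of (i, j) \<Rightarrow>
      tensor_group (free_Abelian_group (magnitude_tuples F (fst k) i)) (free_Abelian_group (magnitude_tuples B (snd k) j)))"
    using comm_group.axioms(2)[OF tensor_setup.comm_group_tensor_group[OF tensor_setup_free]] by (simp add: ij)
qed

lemma pair_face_sum_tensor:
  assumes "fs \<in> magnitude_tuples F lv i" "bs \<in> magnitude_tuples B lh j"
  shows "pair_face_sum (fs, bs) = frag_tensor (magnitude_boundary F i (frag_of fs)) (frag_of bs) +
     frag_cmul ((-1) ^ i) (frag_tensor (frag_of fs) (magnitude_boundary B j (frag_of bs)))"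
proof -
  have len: "length fs - 1 = i" using assms(1) by (simp add: magnitude_tuples_iff)
  have "frag_tensor (face_sum F fs) (frag_of bs) = (\<Sum>i\<in>faces F fs. frag_cmul ((-1) ^ i) (frag_of (del i fs, bs)))"
    by (simp add: frag_tensor_def face_sum_def frag_extend_sum frag_extend_cmul comp_def)
  moreover have "frag_tensor (frag_of fs) (face_sum B bs) = (\<Sum>j\<in>faces B bs. frag_cmul ((-1) ^ j) (frag_of (fs, del j bs)))"
    by (simp add: frag_tensor_def face_sum_def frag_extend_sum frag_extend_cmul comp_def)
  ultimately show ?thesis
    unfolding magnitude_boundary_frag_of[OF assms(1)] magnitude_boundary_frag_of[OF assms(2)]
    by (simp add: pair_face_sum_def len[simplified] frag_cmul_sum power_add)
qed

lemma tensor_part_iso_boundary: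
  assumes c: "Poly_Mapping.keys c \<subseteq> tensor_part k (Suc n)"
  shows "tensor_part_iso k n (frag_extend pair_face_sum c) = dif (tensor_cplx k) (Suc n) (tensor_part_iso k (Suc n) c)"
proof -
  obtain lv lh where k: "k = (lv, lh)" by (cases k)
  have face_0: "magnitude_boundary X 0 (frag_of s) = 0" for X :: "'x metric" and s
    by (simp add: magnitude_boundary_def)
  have b: "bigraded k = (\<lambda>(i, j). magnitude_tuples F lv i \<times> magnitude_tuples B lh j)"
    by (simp add: bigraded_def k)
  have "Poly_Mapping.keys c \<subseteq> (\<Union>(i, j) \<in> {(i, j). i + j = Suc n}. magnitude_tuples F lv i \<times> magnitude_tuples B lh j)"
    using c unfolding tensor_part_def b .
  then have "sum_iso {(i, j). i + j = n} (\<lambda>(i, j). magnitude_tuples F lv i \<times> magnitude_tuples B lh j)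
      (\<lambda>(i, j). tensor_iso (magnitude_tuples F lv i) (magnitude_tuples B lh j)) (frag_extend pair_face_sum c) =
    dif (tensor_complex (magnitude_complex F lv) (magnitude_complex B lh)) (Suc n)
      (sum_iso {(i, j). i + j = Suc n} (\<lambda>(i, j). magnitude_tuples F lv i \<times> magnitude_tuples B lh j)
        (\<lambda>(i, j). tensor_iso (magnitude_tuples F lv i) (magnitude_tuples B lh j)) c)"
    by (intro tensor_complex_sum_iso)
       (auto simp: magnitude_complex_def magnitude_boundary_hom face_0 pair_face_sum_tensor
          intro: magnitude_tuples_degree)
  then show ?thesis unfolding tensor_part_iso_def b unfolding k by simp
qed

lemma keys_pair_face_sum_tensor_part:
  assumes "q \<in> tensor_part k (Suc n)"
  shows "Poly_Mapping.keys (pair_face_sum q) \<subseteq> tensor_part k n"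
proof -
  obtain fs bs i j lv lh where q: "k = (lv, lh)" "q = (fs, bs)" "i + j = Suc n"
    "fs \<in> magnitude_tuples F lv i" "bs \<in> magnitude_tuples B lh j"
    using assms by (cases k) (auto simp: tensor_part_def bigraded_def)
  have del_fs: "(del m fs, bs) \<in> tensor_part k n" if m: "m \<in> faces F fs" for m
  proof -
    obtain i' where "i = Suc i'" using m q(4) by (cases i) (auto simp: faces_def magnitude_tuples_iff)
    then show ?thesis
      using del_in_magnitude_tuples[of fs F lv i' m] m q unfolding tensor_part_def bigraded_def by auto
  qed
  have del_bs: "(fs, del m bs) \<in> tensor_part k n" if m: "m \<in> faces B bs" for m
  proof -
    obtain j' where "j = Suc j'" using m q(5) by (cases j) (auto simp: faces_def magnitude_tuples_iff)
    then show ?thesis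
      using del_in_magnitude_tuples[of bs B lh j' m] m q unfolding tensor_part_def bigraded_def by auto
  qed
  show ?thesis
    unfolding q(2) pair_face_sum_def prod.case
    by (intro keys_add_subset keys_sum_subset keys_cmul_subset) (simp_all add: del_fs del_bs)
qed

theorem magnitude_complex_equivalent_tensor:
  "chain_homotopy_equivalent (magnitude_complex E l) (sum_complex (splittings l) tensor_cplx)"
proof (rule chain_homotopy_equivalent_iso[OF magnitude_complex_equivalent_pair_complex])
  let ?t = "\<lambda>n. sum_iso (splittings l) (\<lambda>k. tensor_part k n) (\<lambda>k. tensor_part_iso k n)"
  have disj: "k = k'" if "q \<in> tensor_part k n" "q \<in> tensor_part k' n" for k k' q n
    using that bigraded_disjoint unfolding tensor_part_def by blast
  have grp: "grp (sum_complex (splittings l) tensor_cplx) n = sum_group (splittings l) (\<lambda>k. grp (tensor_cplx k) n)" for n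
    by (simp add: sum_complex_def)
  show "?t n \<in> iso (grp (pair_complex l) n) (grp (sum_complex (splittings l) tensor_cplx) n)" for n
    unfolding grp pair_complex_def chain_cplx.simps pairs_eq
    by (rule sum_iso_iso[OF disj tensor_part_iso]) (use comm_group_tensor_cplx in \<open>auto simp: comm_group_def\<close>)
  show "?t n (dif (pair_complex l) (Suc n) c) = dif (sum_complex (splittings l) tensor_cplx) (Suc n) (?t (Suc n) c)"
    if "c \<in> carrier (grp (pair_complex l) (Suc n))" for n c
    unfolding pair_complex_def chain_cplx.simps
  proof (rule sum_complex_sum_iso)
    show "Poly_Mapping.keys c \<subseteq> (\<Union>k\<in>splittings l. tensor_part k (Suc n))"
      using that by (simp add: pair_complex_def pairs_eq)
  qed (rule keys_pair_face_sum_tensor_part disj tensor_part_iso_boundary; assumption)+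
  show "comm_group (grp (sum_complex (splittings l) tensor_cplx) n)" for n
    unfolding grp by (rule comm_group_sum_group) (rule comm_group_tensor_cplx)
qed

end

theorem theorem1p1:
  fixes E :: "'a metric" and B :: "'b metric" and p :: "'a \<Rightarrow> 'b" and b :: 'b and l :: real
  assumes "metric_fibration E B p"
    and "b \<in> mspace B"
    and "l > 0"
  shows "chain_homotopy_equivalent
           (magnitude_complex E l)
           (sum_complex {(lv, lh). 0 \<le> lv \<and> 0 \<le> lh \<and> lv + lh = l}
             (\<lambda>(lv, lh). tensor_complex
                (magnitude_complex (metric_fiber E p b) lv)
                (magnitude_complex B lh)))"
proof -
  interpret pointed_metric_fibration E B p b
    by unfold_locales (rule assms)+
  show ?thesis
    using magnitude_complex_equivalent_tensor[of l] unfolding splittings_def .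
qed

end
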